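(* Let $\Xi\subseteq\mathbb{R}^m$ be convex, $\widehat\xi_1,\dots,\widehat\xi_N\in\Xi$, $\widehat{\mathbb P}_N=\frac1N\sum_{i=1}^N\delta_{\widehat\xi_i}$, $\varepsilon\ge0$, let $\|\cdot\|$ be a norm on $\mathbb{R}^m$ with dual norm $\|\cdot\|_*$, and let $\rho$ be a law-invariant coherent risk measure. If $\ell:\mathbb{R}^m\to\mathbb{R}$ is concave, then the worst-case expectation problem $$\sup_{\Pi}\ \mathbb{E}^{\Pi}[\ell(\xi)]\quad\text{subject to}\quad \rho^{\Pi}(\|\widehat\xi-\xi\|)\le\varepsilon,$$ where $\Pi$ ranges over the probability distributions on $\Xi\times\Xi$ of a pair $(\widehat\xi,\xi)$ with first marginal $\widehat{\mathbb P}_N$, is equivalent to $$\begin{aligned}\inf_{\lambda,p,s,z_i,\nu_i}\ \ &\lambda\varepsilon+\frac1N\sum_{i=1}^N s_i\\ \text{subject to}\ \ &[-\ell]^*(z_i-\nu_i)+\sigma_\Xi(\nu_i)-z_i^\top\widehat\xi_i\le s_i,\quad i=1,\dots,N,\\ &\|z_i\|_*\le p_i,\quad i=1,\dots,N,\\ &\sum_{i=1}^N p_i=\lambda,\\ &\frac{p}{\lambda}\in A_\rho,\end{aligned}$$ where $\lambda\in\mathbb{R}$, $p\in\mathbb{R}^N$, $s\in\mathbb{R}^N$, $z_i,\nu_i\in\mathbb{R}^m$, $\sigma_\Xi$ is the support function of $\Xi$, and $A_\rho$ is a subset of a probability simplex, defined by $$A_\rho=\Big\{y\in\mathbb{R}^N:\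 \exists\, Z\sim\tfrac1N\textstyle\sum_{i=1}^N\delta_{y_i},\ Z\in\mathcal Z_\rho\Big\},$$ with $\mathcal Z_\rho$ the risk envelope of $\rho$. It is defined that $\frac p0\notin A_\rho$ for any $p\ne\mathbf 0$ and $\frac{\mathbf 0}{0}\in A_\rho$.
   Context: A law-invariant coherent risk measure $\rho$ is a functional on random variables (here applied to transportation costs) satisfying $\rho(0)=0$, translation invariance $\rho(X+c)=\rho(X)+c$ for $c\ge0$, monotonicity ($\rho(X_1)\ge\rho(X_2)$ if $X_1\ge X_2$), subadditivity $\rho(X_1+X_2)\le\rho(X_1)+\rho(X_2)$, positive homogeneity $\rho(cX)=c\rho(X)$ for $c>0$, and law invariance ($\rho(X_1)=\rho(X_2)$ if $X_1,X_2$ have the same distribution). $\rho^{\Pi}(\|\widehat\xi-\xi\|)$ is the value of $\rho$ on $\|\widehat\xi-\xi\|$ when $(\widehat\xi,\xi)\sim\Pi$. The risk envelope of $\rho$ is $\mathcal Z_\rho=\{Z\ge0:\ \mathbb{E}[Z]=1,\ \mathbb{E}[ZX]\le\rho(X)\text{ for all }X\}$. $[-\ell]^*$ is the convex conjugate of $-\ell$, and $\sigma_\Xi(\nu)=\sup_{\xi\in\Xi}\nu^\top\xi$.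
   Formalization: The constraint that the p_i sum to λ is corrected to (1/N) times the sum of the p_i equals λ, since every y in A_ρ has entries summing to N (E[Z]=1), so the printed constraints force λ=0 when N≥2; the probability simplex is read as nonnegative y with mean 1. *)

theory Defs
  imports "HOL-Probability.Probability"
begin

(* Expectation with values in the extended reals. It only matters where the positive or
   the negative part has a finite integral. *)
definition ext_expectation :: "'a measure \<Rightarrow> ('a \<Rightarrow> real) \<Rightarrow> ereal" where
  "ext_expectation M f =
     enn2ereal (\<integral>\<^sup>+ x. ennreal (f x) \<partial>M) - enn2ereal (\<integral>\<^sup>+ x. ennreal (- f x) \<partial>M)"

definition is_norm :: "('b::euclidean_space \<Rightarrow> real) \<Rightarrow> bool" where
  "is_norm n \<longleftrightarrow>
     (\<forall>x. 0 \<le> n x) \<and> (\<forall>x. n x = 0 \<longleftrightarrow> x = 0) \<and>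
     (\<forall>c x. n (c *\<^sub>R x) = \<bar>c\<bar> * n x) \<and> (\<forall>x y. n (x + y) \<le> n x + n y)"

definition dual_norm :: "('b::euclidean_space \<Rightarrow> real) \<Rightarrow> 'b \<Rightarrow> real" where
  "dual_norm n z = (SUP x\<in>{x. n x \<le> 1}. z \<bullet> x)"

definition conjugate :: "('b::euclidean_space \<Rightarrow> real) \<Rightarrow> 'b \<Rightarrow> ereal" where
  "conjugate f z = (SUP x. ereal (z \<bullet> x - f x))"

definition support_fun :: "'b::euclidean_space set \<Rightarrow> 'b \<Rightarrow> ereal" where
  "support_fun S v = (SUP x\<in>S. ereal (v \<bullet> x))"

(* The measure (1/N) * (sum of the Dirac measures at x i), where N is the size of the index type. *)
definition empirical :: "('k::finite \<Rightarrow> 'b::topological_space) \<Rightarrow> 'b measure" where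
  "empirical x = distr (uniform_count_measure (UNIV :: 'k set)) borel x"

(* Probability spaces on which every law on the real line is the law of some random variable;
   carrying a uniform random variable is equivalent to being atomless. *)
definition rich_prob_space :: "'w measure \<Rightarrow> bool" where
  "rich_prob_space M \<longleftrightarrow> prob_space M \<and>
     (\<exists>U\<in>borel_measurable M. distr M borel U = uniform_measure lborel {0..1::real})"

(* Risk measures are considered on random variables that are essentially bounded below. These
   include all bounded random variables and all transportation costs, bounded or not; in exchange
   the risk measure may take the value infinity. *)
definition risk_domain :: "'w measure \<Rightarrow> ('w \<Rightarrow> real) set" where
  "risk_domain M = {X \<in> borel_measurable M. \<exists>b. AE \<omega> in M. b \<le> X \<omega>}"

definition coherent_risk_measure :: "'w measure \<Rightarrow> (('w \<Rightarrow> real) \<Rightarrow> ereal) \<Rightarrow> bool" where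
  "coherent_risk_measure M \<rho> \<longleftrightarrow>
     \<rho> (\<lambda>_. 0) = 0 \<and>
     (\<forall>X\<in>risk_domain M. \<forall>c\<ge>0. \<rho> (\<lambda>\<omega>. X \<omega> + c) = \<rho> X + ereal c) \<and>
     (\<forall>X\<in>risk_domain M. \<forall>Y\<in>risk_domain M. (AE \<omega> in M. Y \<omega> \<le> X \<omega>) \<longrightarrow> \<rho> Y \<le> \<rho> X) \<and>
     (\<forall>X\<in>risk_domain M. \<forall>Y\<in>risk_domain M. \<rho> (\<lambda>\<omega>. X \<omega> + Y \<omega>) \<le> \<rho> X + \<rho> Y) \<and>
     (\<forall>X\<in>risk_domain M. \<forall>c>0. \<rho> (\<lambda>\<omega>. c * X \<omega>) = ereal c * \<rho> X)"

definition law_invariant :: "'w measure \<Rightarrow> (('w \<Rightarrow> real) \<Rightarrow> ereal) \<Rightarrow> bool" where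
  "law_invariant M \<rho> \<longleftrightarrow>
     (\<forall>X\<in>risk_domain M. \<forall>Y\<in>risk_domain M. distr M borel X = distr M borel Y \<longrightarrow> \<rho> X = \<rho> Y)"

(* The value of a law-invariant risk measure at a random variable C that lives on another
   probability space P: evaluate at any copy of C on the reference space M. *)
definition risk_under ::
  "'w measure \<Rightarrow> (('w \<Rightarrow> real) \<Rightarrow> ereal) \<Rightarrow> 'c measure \<Rightarrow> ('c \<Rightarrow> real) \<Rightarrow> ereal" where
  "risk_under M \<rho> P C = \<rho> (SOME X. X \<in> borel_measurable M \<and> distr M borel X = distr P borel C)"

(* For X bounded below, the negative part of Z * X is integrable. *)
definition risk_envelope :: "'w measure \<Rightarrow> (('w \<Rightarrow> real) \<Rightarrow> ereal) \<Rightarrow> ('w \<Rightarrow> real) set" where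
  "risk_envelope M \<rho> =
     {Z. integrable M Z \<and> (AE \<omega> in M. 0 \<le> Z \<omega>) \<and> (\<integral>\<omega>. Z \<omega> \<partial>M) = 1 \<and>
         (\<forall>X\<in>risk_domain M. ext_expectation M (\<lambda>\<omega>. Z \<omega> * X \<omega>) \<le> \<rho> X)}"

(* Since Z has mean 1, every y in this set has nonnegative entries with arithmetic mean 1:
   y lists the values of a density with respect to the uniform distribution on the indices,
   so the entries add up to N, not to 1. *)
definition A_risk :: "'w measure \<Rightarrow> (('w \<Rightarrow> real) \<Rightarrow> ereal) \<Rightarrow> (real ^ 'k::finite) set" where
  "A_risk M \<rho> = {y. \<exists>Z\<in>risk_envelope M \<rho>. distr M borel Z = empirical (\<lambda>i. y $ i)}"

(* "p / lam lies in A", where 0/0 is declared to be in A and p/0 not to be in A for nonzero p. *)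
definition ratio_in :: "real ^ 'k::finite \<Rightarrow> real \<Rightarrow> (real ^ 'k) set \<Rightarrow> bool" where
  "ratio_in p lam A \<longleftrightarrow> (if lam = 0 then p = 0 else p /\<^sub>R lam \<in> A)"

(* Probability measures on the Borel sets of the subspace S \<times> S (S itself need not be
   a Borel set) whose first marginal is the empirical measure of x. *)
definition transport_plans ::
  "'b::euclidean_space set \<Rightarrow> ('k::finite \<Rightarrow> 'b) \<Rightarrow> ('b \<times> 'b) measure set" where
  "transport_plans S x =
     {P. prob_space P \<and> sets P = sets (restrict_space borel (S \<times> S)) \<and>
         distr P borel fst = empirical x}"

end

theory Submission
  imports Defs
begin

text \<open>Write \<open>N\<close> for the number of indices, and for \<open>c\<close> in \<open>\<real>\<^sup>N\<close> let \<open>\<phi>(c)\<close> be the risk of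
a random variable whose law is the empirical measure of the entries of \<open>c\<close>. On \<open>\<real>\<^sup>N\<close> the
functional \<open>\<phi>\<close> is finite, monotone, sublinear and compatible with adding constants, so it is the
support function of the set of all \<open>y\<close> with \<open>(1/N) (y \<bullet> c) \<le> \<phi>(c)\<close> for every \<open>c\<close>.

The bridge between the risk measure and finite-dimensional duality is that this set is exactly
\<open>A_risk M \<rho>\<close> (\<open>A_risk_eq_weights\<close>). One inclusion says that a weight vector, spread over a uniform
random index, is a density in the risk envelope. It rests on \<open>risk_conditional_mean_le\<close>: replacing
a random variable by its conditional means given a uniform index does not increase the risk. The
conditional means are approximated uniformly by finite averages of variables with the law of the
original one, and subadditivity and homogeneity bound the risk of such an average. On each piece the
variable is replaced by a quantile function, and the \<open>K\<close> rotations of this function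
by multiples of \<open>1/K\<close> all have the same law; since it is monotone, their average differs from the
mean by at most its range divided by \<open>K\<close>, uniformly (\<open>mono_rotation_average\<close>). The other inclusion
splits the level sets of a density with empirical law into \<open>N\<close> equally likely events, which is
possible on a rich space (\<open>rich_uniform_label\<close>).

Weak duality: a dual feasible point bounds the loss \<open>l \<xi>\<close> by \<open>s\<^sub>i + p\<^sub>i \<parallel>x\<^sub>i - \<xi>\<parallel>\<close> on \<open>\<Xi>\<close>. A plan is the
average of its conditional laws given the atoms \<open>x\<^sub>i\<close>, and the conditional mean costs, weighted by
\<open>p / \<lambda>\<close>, stay below the risk of the cost (\<open>weak_duality\<close>).

Strong duality uses the plans that move each \<open>x\<^sub>i\<close> to a single point. If \<open>\<epsilon> > 0\<close>, the set
of attainable pairs (cost vector, mean loss) is separated from the pairs with \<open>\<phi>(c) \<le> \<epsilon>\<close> and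
mean loss above the optimal value; since \<open>\<phi>\<close> commutes with adding constants, the normal of the
separating hyperplane is \<open>\<lambda>\<close> times a point of \<open>A_risk M \<rho>\<close> (\<open>lagrange_multipliers\<close>). The Lagrangian
splits into one maximisation for each index, and two applications of the sandwich theorem
(\<open>affine_sandwich\<close>) produce \<open>\<nu>\<^sub>i\<close> and \<open>z\<^sub>i\<close>. If \<open>\<epsilon> = 0\<close> there is no Slater point; instead the
supergradients of \<open>l\<close> at the points \<open>x\<^sub>i\<close> are dual feasible once \<open>\<lambda>\<close> exceeds their dual norms, because
the constant vector \<open>1\<close> lies in \<open>A_risk M \<rho>\<close>.\<close>

section \<open>Separating a concave from a convex function\<close>

text \<open>The hyperplane separating the hypograph of \<open>F\<close> from the strict epigraph of \<open>H\<close> over \<open>C\<close> cannot be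
vertical, because \<open>F\<close> is finite on the whole space; it is therefore the graph of an affine function.\<close>
lemma affine_sandwich:
  fixes F H :: "'a::euclidean_space \<Rightarrow> real"
  assumes F: "concave_on UNIV F" and H: "convex_on C H" and ne: "C \<noteq> {}"
    and le: "\<And>x. x \<in> C \<Longrightarrow> F x \<le> H x"
  obtains a b where "\<And>x. F x \<le> a \<bullet> x + b" and "\<And>x. x \<in> C \<Longrightarrow> a \<bullet> x + b \<le> H x"
proof -
  define S where "S = {(x, t). t \<le> F x}"
  define T where "T = {(x, t). x \<in> C \<and> H x < t}"
  obtain x0 where x0: "x0 \<in> C" using ne by auto
  have "convex S"
  proof (rule convexI)
    fix p q :: "'a \<times> real" and u v :: real
    assume A: "p \<in> S" "q \<in> S" "0 \<le> u" "0 \<le> v" "u + v = 1"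
    obtain x t y s where pq: "p = (x, t)" "q = (y, s)" by (cases p, cases q) auto
    have "u * t + v * s \<le> u * F x + v * F y"
      using A pq by (intro add_mono mult_left_mono) (auto simp: S_def)
    also have "\<dots> \<le> F (u *\<^sub>R x + v *\<^sub>R y)"
      using F A by (simp add: concave_on_iff)
    finally show "u *\<^sub>R p + v *\<^sub>R q \<in> S" by (simp add: S_def pq)
  qed
  moreover have "convex T"
  proof (rule convexI)
    fix p q :: "'a \<times> real" and u v :: real
    assume A: "p \<in> T" "q \<in> T" "0 \<le> u" "0 \<le> v" "u + v = 1"
    obtain x t y s where pq: "p = (x, t)" "q = (y, s)" by (cases p, cases q) auto
    have xy: "x \<in> C" "y \<in> C" "H x < t" "H y < s" using A pq by (auto simp: T_def)
    have "H (u *\<^sub>R x + v *\<^sub>R y) \<le> u * H x + v * H y"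
      using H A xy by (simp add: convex_on_def)
    also have "\<dots> < u * t + v * s"
    proof (cases "u = 0")
      case True then show ?thesis using A xy by simp
    next
      case False
      then have "u * H x < u * t" using A xy by simp
      moreover have "v * H y \<le> v * s" using A xy by (intro mult_left_mono) auto
      ultimately show ?thesis by simp
    qed
    finally have "H (u *\<^sub>R x + v *\<^sub>R y) < u * t + v * s" .
    moreover have "u *\<^sub>R x + v *\<^sub>R y \<in> C"
      using H A xy by (auto simp: convex_on_def dest: convexD)
    ultimately show "u *\<^sub>R p + v *\<^sub>R q \<in> T" by (simp add: T_def pq)
  qed
  moreover have "(x0, F x0) \<in> S" "(x0, H x0 + 1) \<in> T" using x0 by (auto simp: S_def T_def)
  moreover have "S \<inter> T = {}" using le by (force simp: S_def T_def)
  ultimately obtain n \<beta> where n: "n \<noteq> 0" "\<forall>p\<in>S. n \<bullet> p \<le> \<beta>" "\<forall>p\<in>T. \<beta> \<le> n \<bullet> p"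
    using separating_hyperplane_sets[of S T] by (metis empty_iff)
  obtain a \<alpha> where na: "n = (a, \<alpha>)" by (cases n)
  have Sle: "a \<bullet> x + \<alpha> * t \<le> \<beta>" if "t \<le> F x" for x t
    using n(2) that by (force simp: S_def na)
  have Tge: "\<beta> \<le> a \<bullet> x + \<alpha> * t" if "x \<in> C" "H x < t" for x t
    using n(3) that by (force simp: T_def na)
  have "\<alpha> \<ge> 0"
  proof (rule ccontr)
    assume neg: "\<not> \<alpha> \<ge> 0"
    \<comment> \<open>a point of the hypograph so low that it lies beyond the hyperplane\<close>
    define t where "t = min (F x0) ((\<beta> + 1 - a \<bullet> x0) / \<alpha>)"
    have "\<alpha> * t \<ge> \<alpha> * ((\<beta> + 1 - a \<bullet> x0) / \<alpha>)"
      using neg by (intro mult_left_mono_neg) (auto simp: t_def)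
    then have "\<alpha> * t \<ge> \<beta> + 1 - a \<bullet> x0" using neg by simp
    then show False using Sle[of t x0] by (simp add: t_def)
  qed
  moreover have "\<alpha> \<noteq> 0"
  proof
    assume 0: "\<alpha> = 0"
    then have "a \<noteq> 0" using n(1) by (simp add: na zero_prod_def)
    then have "a \<bullet> (((\<beta> + 1) / (a \<bullet> a)) *\<^sub>R a) = \<beta> + 1" by simp
    then show False using Sle[OF order_refl, of "((\<beta> + 1) / (a \<bullet> a)) *\<^sub>R a"] 0 by simp
  qed
  ultimately have pos: "\<alpha> > 0" by simp
  show ?thesis
  proof
    show "F x \<le> (- (a /\<^sub>R \<alpha>)) \<bullet> x + \<beta> / \<alpha>" for x
      using Sle[OF order_refl, of x] pos by (simp add: field_simps)
    show "(- (a /\<^sub>R \<alpha>)) \<bullet> x + \<beta> / \<alpha> \<le> H x" if "x \<in> C" for x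
    proof (rule dense_ge)
      fix t assume "H x < t"
      from Tge[OF that this] pos show "(- (a /\<^sub>R \<alpha>)) \<bullet> x + \<beta> / \<alpha> \<le> t"
        by (simp add: field_simps)
    qed
  qed
qed

lemma is_norm_simps:
  assumes "is_norm n"
  shows "0 \<le> n x" "n 0 = 0" "n x = 0 \<longleftrightarrow> x = 0" "n (c *\<^sub>R x) = \<bar>c\<bar> * n x"
    "n (x + y) \<le> n x + n y" "n (- x) = n x" "n (x - y) = n (y - x)"
proof -
  show "0 \<le> n x" "n 0 = 0" "n x = 0 \<longleftrightarrow> x = 0" "n (c *\<^sub>R x) = \<bar>c\<bar> * n x" "n (x + y) \<le> n x + n y"
    using assms by (auto simp: is_norm_def)
  have *: "n (- x) = n x" for x
    using assms[unfolded is_norm_def] by (metis abs_minus_cancel abs_one mult_1 scaleR_minus1_left)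
  then show "n (- x) = n x" "n (x - y) = n (y - x)" by (metis *, metis * minus_diff_eq)
qed

lemma convex_on_is_norm:
  assumes "is_norm n"
  shows "convex_on UNIV (\<lambda>x. n (a - x))"
  unfolding convex_on_def
proof (intro conjI ballI allI impI)
  fix x y and u v :: real assume "0 \<le> u" "0 \<le> v" "u + v = 1"
  then have "a - (u *\<^sub>R x + v *\<^sub>R y) = u *\<^sub>R (a - x) + v *\<^sub>R (a - y)"
    by (simp add: algebra_simps flip: scaleR_add_left)
  then show "n (a - (u *\<^sub>R x + v *\<^sub>R y)) \<le> u * n (a - x) + v * n (a - y)"
    using is_norm_simps(5)[OF assms, of "u *\<^sub>R (a - x)" "v *\<^sub>R (a - y)"] \<open>0 \<le> u\<close> \<open>0 \<le> v\<close>
    by (simp add: is_norm_simps(4)[OF assms])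
qed simp

lemma continuous_is_norm:
  assumes "is_norm n"
  shows "continuous_on UNIV n"
proof -
  have "continuous_on UNIV (\<lambda>x. n (0 - x))"
    by (rule convex_on_continuous[OF open_UNIV convex_on_is_norm[OF assms]])
  then show ?thesis by (simp add: is_norm_simps(6)[OF assms])
qed

text \<open>The supremum that defines the dual norm is meaningful because the unit ball of any norm is bounded:
a norm is continuous, hence bounded away from zero on the Euclidean unit sphere.\<close>
lemma dual_norm_bdd:
  fixes n :: "'b::euclidean_space \<Rightarrow> real"
  assumes "is_norm n"
  shows "bdd_above ((\<lambda>x. z \<bullet> x) ` {x. n x \<le> 1})"
proof -
  have "\<exists>c>0. \<forall>x. c * norm x \<le> n x"
  proof -
    have "sphere (0::'b) 1 \<noteq> {}" by simp
    then obtain x1 where x1: "x1 \<in> sphere 0 1" "\<forall>y\<in>sphere 0 1. n x1 \<le> n y"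
      using continuous_attains_inf[OF compact_sphere _ continuous_on_subset[OF continuous_is_norm[OF assms]]]
      by (metis subset_UNIV)
    have "n x1 > 0" using x1(1) is_norm_simps(1,3)[OF assms, of x1] by force
    moreover have "n x1 * norm x \<le> n x" for x
    proof (cases "x = 0")
      case False
      then have "n x1 \<le> n (x /\<^sub>R norm x)" using x1(2) by simp
      also have "\<dots> = n x / norm x" by (simp add: is_norm_simps(4)[OF assms] field_simps)
      finally show ?thesis using False by (simp add: field_simps)
    qed (simp add: is_norm_simps(2)[OF assms])
    ultimately show ?thesis by blast
  qed
  then obtain c where c: "c > 0" "\<And>x. c * norm x \<le> n x" by blast
  have "z \<bullet> x \<le> norm z * (1 / c)" if "n x \<le> 1" for x
  proof -
    have "norm x \<le> 1 / c" using c(2)[of x] that c(1) by (simp add: field_simps)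
    then have "norm z * norm x \<le> norm z * (1 / c)" by (intro mult_left_mono) auto
    then show ?thesis using norm_cauchy_schwarz[of z x] by linarith
  qed
  then show ?thesis by (intro bdd_aboveI2) auto
qed

lemma inner_le_dual_norm:
  assumes "is_norm n"
  shows "z \<bullet> x \<le> dual_norm n z * n x"
proof (cases "x = 0")
  case False
  then have pos: "n x > 0" using is_norm_simps(1,3)[OF assms, of x] by simp
  then have "n (x /\<^sub>R n x) \<le> 1" by (simp add: is_norm_simps(4)[OF assms])
  then have "z \<bullet> (x /\<^sub>R n x) \<le> dual_norm n z"
    unfolding dual_norm_def by (intro cSUP_upper dual_norm_bdd[OF assms]) auto
  then show ?thesis using pos by (simp add: field_simps)
qed (simp add: is_norm_simps(2)[OF assms])

lemma dual_norm_nonneg: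
  assumes "is_norm n"
  shows "0 \<le> dual_norm n z"
  unfolding dual_norm_def
  using cSUP_upper[OF _ dual_norm_bdd[OF assms], of 0 z] by (simp add: is_norm_simps(2)[OF assms])

lemma dual_norm_le:
  assumes "is_norm n" and "0 \<le> p" and "\<And>x. z \<bullet> x \<le> p * n x"
  shows "dual_norm n z \<le> p"
  unfolding dual_norm_def
proof (rule cSUP_least)
  show "{x. n x \<le> 1} \<noteq> {}" using is_norm_simps(2)[OF assms(1)] by (auto intro: exI[of _ 0])
  fix x assume "x \<in> {x. n x \<le> 1}"
  then have "p * n x \<le> p" using assms(2) by (simp add: mult_left_le)
  then show "z \<bullet> x \<le> p" using assms(3)[of x] by linarith
qed

text \<open>The Fenchel-Young inequality for \<open>- l\<close> and for the support function; \<open>\<nu>\<close> cancels in the sum.\<close>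
lemma dual_feasible_majorant:
  assumes "conjugate (\<lambda>x. - l x) (z - \<nu>) + support_fun S \<nu> - ereal (z \<bullet> a) \<le> ereal s"
    and "\<xi> \<in> S"
  shows "l \<xi> \<le> s + z \<bullet> (a - \<xi>)"
proof -
  have "ereal ((z - \<nu>) \<bullet> \<xi> - - l \<xi>) \<le> conjugate (\<lambda>x. - l x) (z - \<nu>)"
    unfolding conjugate_def by (rule SUP_upper) simp
  moreover have "ereal (\<nu> \<bullet> \<xi>) \<le> support_fun S \<nu>"
    unfolding support_fun_def by (rule SUP_upper) fact
  ultimately have "ereal ((z - \<nu>) \<bullet> \<xi> - - l \<xi>) + ereal (\<nu> \<bullet> \<xi>) - ereal (z \<bullet> a) \<le> ereal s"
    by (intro order_trans[OF ereal_minus_mono[OF add_mono order_refl] assms(1)])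
  then show ?thesis by (simp add: algebra_simps)
qed

text \<open>Conversely to \<open>dual_feasible_majorant\<close>, an upper bound on the penalised loss over \<open>S\<close> is witnessed by
multipliers. A first sandwich, between the penalised loss and the constant \<open>s\<close> on \<open>S\<close>, yields \<open>\<nu>\<close>
and removes the constraint \<open>\<xi> \<in> S\<close>; a second one, between \<open>l\<close> and the resulting convex majorant,
yields \<open>z\<close>.\<close>
lemma fenchel_multipliers:
  fixes l nrm :: "'b::euclidean_space \<Rightarrow> real"
  assumes nrm: "is_norm nrm" and l: "concave_on UNIV l" and S: "convex S" "S \<noteq> {}" and p: "0 \<le> p"
    and le: "\<And>\<xi>. \<xi> \<in> S \<Longrightarrow> l \<xi> - p * nrm (a - \<xi>) \<le> s"
  obtains z \<nu> where "dual_norm nrm z \<le> p"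
    and "conjugate (\<lambda>x. - l x) (z - \<nu>) + support_fun S \<nu> - ereal (z \<bullet> a) \<le> ereal s"
proof -
  have cvn: "convex_on UNIV (\<lambda>x. p * nrm (a - x))"
    by (intro convex_on_cmul p convex_on_is_norm nrm)
  have "concave_on UNIV (\<lambda>x. l x - p * nrm (a - x))"
    using convex_on_add[OF l[unfolded concave_on_def] cvn] by (simp add: concave_on_def algebra_simps)
  moreover have "convex_on S (\<lambda>_. s)"
    using S by (simp add: convex_on_def flip: distrib_right)
  ultimately obtain \<nu> b where \<nu>: "\<And>x. l x - p * nrm (a - x) \<le> \<nu> \<bullet> x + b"
    "\<And>\<xi>. \<xi> \<in> S \<Longrightarrow> \<nu> \<bullet> \<xi> + b \<le> s"
    using affine_sandwich[of "\<lambda>x. l x - p * nrm (a - x)" S "\<lambda>_. s"] S(2) le by metis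
  have lin: "convex_on UNIV (\<lambda>x. \<nu> \<bullet> x + b)"
    by (simp add: convex_on_def inner_simps algebra_simps)
      (metis distrib_right mult_1 order_refl)
  have "concave_on UNIV l" by fact
  moreover have "convex_on UNIV (\<lambda>x. (\<nu> \<bullet> x + b) + p * nrm (a - x))"
    by (rule convex_on_add[OF lin cvn])
  ultimately obtain y d where y: "\<And>x. l x \<le> y \<bullet> x + d"
    "\<And>x. y \<bullet> x + d \<le> (\<nu> \<bullet> x + b) + p * nrm (a - x)"
    using affine_sandwich[of l UNIV "\<lambda>x. (\<nu> \<bullet> x + b) + p * nrm (a - x)"] \<nu>(1)
    by (smt (verit, best) UNIV_I UNIV_not_empty)
  define z where "z = \<nu> - y"
  define e where "e = (y - \<nu>) \<bullet> a + d - b"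
  have e0: "e \<le> 0" using y(2)[of a] by (simp add: e_def is_norm_simps[OF nrm] inner_simps)
  have scaled: "z \<bullet> x + e \<le> p * nrm x" for x
    using y(2)[of "a - x"] by (simp add: z_def e_def inner_simps algebra_simps)
  have "z \<bullet> x \<le> p * nrm x" for x
  proof (rule ccontr)
    assume "\<not> z \<bullet> x \<le> p * nrm x"
    then have g: "z \<bullet> x - p * nrm x > 0" (is "?g > 0") by simp
    \<comment> \<open>scaling \<open>x\<close> by \<open>k\<close> makes the violation exceed the offset \<open>- e\<close>\<close>
    define k where "k = (1 - e) / ?g"
    have "k \<ge> 0" using e0 g by (simp add: k_def)
    moreover have "k * ?g = 1 - e" using g by (simp add: k_def)
    ultimately show False
      using scaled[of "k *\<^sub>R x"] by (simp add: is_norm_simps(4)[OF nrm] algebra_simps)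
  qed
  then have 1: "dual_norm nrm z \<le> p" by (rule dual_norm_le[OF nrm p])
  have "conjugate (\<lambda>x. - l x) (z - \<nu>) \<le> ereal d"
    unfolding conjugate_def
  proof (rule SUP_least)
    fix x show "ereal ((z - \<nu>) \<bullet> x - - l x) \<le> ereal d"
      using y(1)[of x] by (simp add: z_def inner_simps)
  qed
  moreover have "support_fun S \<nu> \<le> ereal (s - b)"
    unfolding support_fun_def
  proof (rule SUP_least)
    fix \<xi> assume "\<xi> \<in> S" then show "ereal (\<nu> \<bullet> \<xi>) \<le> ereal (s - b)" using \<nu>(2)[of \<xi>] by simp
  qed
  ultimately have "conjugate (\<lambda>x. - l x) (z - \<nu>) + support_fun S \<nu> - ereal (z \<bullet> a)
      \<le> ereal d + ereal (s - b) - ereal (z \<bullet> a)"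
    by (intro ereal_minus_mono add_mono) auto
  also have "\<dots> \<le> ereal s" using e0 by (simp add: e_def z_def inner_simps)
  finally show ?thesis using 1 that by blast
qed

section \<open>Uniform indices and quantiles\<close>

abbreviation unif01 :: "real measure" where
  "unif01 \<equiv> uniform_measure lborel {0..1}"

lemma prob_space_unif01: "prob_space unif01"
  by (rule prob_space_uniform_measure) auto

lemma nn_integral_unif01:
  fixes f :: "real \<Rightarrow> ennreal"
  assumes [measurable]: "f \<in> borel_measurable borel"
  shows "(\<integral>\<^sup>+v. f v \<partial>unif01) = (\<integral>\<^sup>+v. f v * indicator {0..<1} v \<partial>lborel)"
proof -
  have "(\<integral>\<^sup>+v. f v \<partial>unif01) = (\<integral>\<^sup>+v. f v * indicator {0..1} v \<partial>lborel)"
    by (subst nn_integral_uniform_measure) (auto simp: divide_ennreal_def)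
  also have "\<dots> = (\<integral>\<^sup>+v. f v * indicator {0..<1} v \<partial>lborel)"
    using AE_lborel_singleton[of "1::real"]
    by (intro nn_integral_cong_AE) (auto elim!: eventually_mono simp: indicator_def)
  finally show ?thesis .
qed

lemma AE_unif01: "AE v in unif01. 0 \<le> v \<and> v < 1"
  using AE_lborel_singleton[of "1::real"]
  by (intro AE_uniform_measureI) (auto elim!: eventually_mono)

lemma measurable_frac[measurable]: "frac \<in> borel_measurable (borel :: real measure)"
  unfolding frac_def[abs_def] by measurable

lemma nn_integral_unif01_frac_shift:
  fixes f :: "real \<Rightarrow> ennreal"
  assumes [measurable]: "f \<in> borel_measurable borel" and a: "0 \<le> a" "a < 1"
  shows "(\<integral>\<^sup>+v. f (frac (v + a)) \<partial>unif01) = (\<integral>\<^sup>+v. f v \<partial>unif01)"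
proof -
  have "(\<integral>\<^sup>+v. f (frac (v + a)) \<partial>unif01)
      = (\<integral>\<^sup>+v. f (frac (v + a)) * indicator {0..<1} v \<partial>lborel)"
    by (rule nn_integral_unif01) measurable
  also have "\<dots> = (\<integral>\<^sup>+v. f (a + 1 * v) * indicator {a..<1} (a + 1 * v)
      + f (a - 1 + 1 * v) * indicator {0..<a} (a - 1 + 1 * v) \<partial>lborel)"
  proof (rule nn_integral_cong)
    fix v :: real
    consider "v < 0" | "1 \<le> v" | "0 \<le> v" "v < 1 - a" | "1 - a \<le> v" "v < 1" by linarith
    then show "f (frac (v + a)) * indicator {0..<1} v
      = f (a + 1 * v) * indicator {a..<1} (a + 1 * v)
      + f (a - 1 + 1 * v) * indicator {0..<a} (a - 1 + 1 * v)"
    proof cases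
      case 3
      then have "frac (v + a) = v + a" using a by (intro frac_eq[THEN iffD2]) auto
      then show ?thesis using 3 a by (simp add: indicator_def add.commute)
    next
      case 4
      then have *: "frac (v + a) = a - 1 + 1 * v" using a by (simp add: frac_unique_iff)
      show ?thesis unfolding * using 4 a by (auto simp: indicator_def)
    qed (use a in \<open>auto simp: indicator_def\<close>)
  qed
  also have "\<dots> = (\<integral>\<^sup>+v. f (a + 1 * v) * indicator {a..<1} (a + 1 * v) \<partial>lborel)
      + (\<integral>\<^sup>+v. f (a - 1 + 1 * v) * indicator {0..<a} (a - 1 + 1 * v) \<partial>lborel)"
    by (rule nn_integral_add) measurable
  also have "\<dots> = (\<integral>\<^sup>+v. f v * indicator {a..<1} v \<partial>lborel) + (\<integral>\<^sup>+v. f v * indicator {0..<a} v \<partial>lborel)"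
    using nn_integral_real_affine[of "\<lambda>v. f v * indicator {a..<1} v" 1 a]
      nn_integral_real_affine[of "\<lambda>v. f v * indicator {0..<a} v" 1 "a - 1"] by simp
  also have "\<dots> = (\<integral>\<^sup>+v. f v * indicator {a..<1} v + f v * indicator {0..<a} v \<partial>lborel)"
    by (rule nn_integral_add[symmetric]) measurable
  also have "\<dots> = (\<integral>\<^sup>+v. f v * indicator {0..<1} v \<partial>lborel)"
    using a by (intro nn_integral_cong) (auto simp: indicator_def)
  also have "\<dots> = (\<integral>\<^sup>+v. f v \<partial>unif01)"
    by (rule nn_integral_unif01[symmetric]) measurable
  finally show ?thesis .
qed

text \<open>Selecting one of \<open>N\<close> equal cells and then a uniform point inside it gives a uniform point again.
This produces a uniform index together with an independent uniform variable.\<close>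
lemma nn_integral_unif01_split:
  fixes g :: "real \<Rightarrow> ennreal"
  assumes [measurable]: "g \<in> borel_measurable borel" and N: "0 < N"
  shows "(\<integral>\<^sup>+u. g u \<partial>unif01) = (\<Sum>k<N. ennreal (1 / real N) * (\<integral>\<^sup>+v. g ((real k + v) / real N) \<partial>unif01))"
proof -
  have ind: "indicator {0..<real n / real N} u
      = (\<Sum>k<n. indicator {real k / real N..<(real k + 1) / real N} u :: ennreal)" for n and u :: real
  proof (induction n)
    case (Suc n)
    have "indicator {0..<b} u = (indicator {0..<a} u + indicator {a..<b} u :: ennreal)"
      if "0 \<le> a" "a \<le> b" for a b :: real
      using that by (auto simp: indicator_def)
    moreover have "real n / real N \<le> (real n + 1) / real N" "0 \<le> real n / real N"
      by (auto intro: divide_right_mono)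
    ultimately have "indicator {0..<real (Suc n) / real N} u
      = (indicator {0..<real n / real N} u
        + indicator {real n / real N..<(real n + 1) / real N} u :: ennreal)"
      unfolding of_nat_Suc by (metis add.commute)
    then show ?case using Suc by simp
  qed simp
  have "(\<integral>\<^sup>+u. g u \<partial>unif01) = (\<integral>\<^sup>+u. g u * indicator {0..<real N / real N} u \<partial>lborel)"
    using N by (simp add: nn_integral_unif01)
  also have "\<dots> = (\<integral>\<^sup>+u. (\<Sum>k<N. g u * indicator {real k / real N..<(real k + 1) / real N} u) \<partial>lborel)"
    unfolding ind by (simp add: sum_distrib_left)
  also have "\<dots> = (\<Sum>k<N. \<integral>\<^sup>+u. g u * indicator {real k / real N..<(real k + 1) / real N} u \<partial>lborel)"
    by (rule nn_integral_sum) measurable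
  also have "\<dots> = (\<Sum>k<N. ennreal (1 / real N) * (\<integral>\<^sup>+v. g ((real k + v) / real N) \<partial>unif01))"
  proof (rule sum.cong[OF refl])
    fix k
    have "(\<integral>\<^sup>+u. g u * indicator {real k / real N..<(real k + 1) / real N} u \<partial>lborel)
      = ennreal (1 / real N) * (\<integral>\<^sup>+v. g (real k / real N + 1 / real N * v)
          * indicator {real k / real N..<(real k + 1) / real N} (real k / real N + 1 / real N * v) \<partial>lborel)"
      using N by (subst nn_integral_real_affine[of _ "1 / real N" "real k / real N"]) auto
    also have "(\<integral>\<^sup>+v. g (real k / real N + 1 / real N * v)
          * indicator {real k / real N..<(real k + 1) / real N} (real k / real N + 1 / real N * v) \<partial>lborel)
      = (\<integral>\<^sup>+v. g ((real k + v) / real N) * indicator {0..<1} v \<partial>lborel)"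
    proof (rule nn_integral_cong)
      fix v :: real
      have "real k / real N + 1 / real N * v = (real k + v) / real N" by (simp add: add_divide_distrib)
      moreover have "(real k + v) / real N \<in> {real k / real N..<(real k + 1) / real N} \<longleftrightarrow> v \<in> {0..<1}"
        using N by (simp add: divide_le_cancel divide_less_cancel)
      ultimately show "g (real k / real N + 1 / real N * v)
          * indicator {real k / real N..<(real k + 1) / real N} (real k / real N + 1 / real N * v)
        = g ((real k + v) / real N) * indicator {0..<1} v"
        by (simp only: indicator_def)
    qed
    also have "\<dots> = (\<integral>\<^sup>+v. g ((real k + v) / real N) \<partial>unif01)"
      by (rule nn_integral_unif01[symmetric]) measurable
    finally show "(\<integral>\<^sup>+u. g u * indicator {real k / real N..<(real k + 1) / real N} u \<partial>lborel)
      = ennreal (1 / real N) * (\<integral>\<^sup>+v. g ((real k + v) / real N) \<partial>unif01)" .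
  qed
  finally show ?thesis .
qed

lemma real_law_quantile:
  fixes \<mu> :: "real measure"
  assumes "prob_space \<mu>" and sets: "sets \<mu> = sets borel"
  obtains q where "q \<in> borel_measurable borel" and "mono_on {0<..<1} q" and "distr unif01 borel q = \<mu>"
proof -
  interpret prob_space \<mu> by fact
  interpret cdf_distribution \<mu>
    by (simp add: cdf_distribution_def real_distribution_def real_distribution_axioms_def assms
        sets_eq_imp_space_eq[OF sets])
  let ?\<Omega> = "restrict_space lborel {0<..<1} :: real measure"
  define q where "q v = (if v \<in> {0<..<1} then I v else 0)" for v
  have q[measurable]: "q \<in> borel_measurable borel"
    unfolding q_def using measurable_CI
    by (subst (asm) measurable_restrict_space_iff[where c = 0]) auto
  have "distr unif01 borel q = distr ?\<Omega> borel I"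
  proof (rule measure_eqI)
    fix B :: "real set" assume "B \<in> sets (distr unif01 borel q)"
    then have [measurable]: "B \<in> sets borel" by simp
    have "emeasure (distr unif01 borel q) B = emeasure lborel ({0..1} \<inter> q -` B)"
      by (simp add: emeasure_distr divide_ennreal_def measurable_sets_borel[OF q])
    also have "\<dots> = emeasure lborel (I -` B \<inter> {0<..<1})"
    proof (rule emeasure_eq_AE)
      show "AE x in lborel. x \<in> {0..1} \<inter> q -` B \<longleftrightarrow> x \<in> I -` B \<inter> {0<..<1}"
        using AE_lborel_singleton[of "1::real"] AE_lborel_singleton[of "0::real"]
        by eventually_elim (auto simp: q_def)
      show "{0..1} \<inter> q -` B \<in> sets lborel"
        using measurable_sets_borel[OF q] by auto
      show "I -` B \<inter> {0<..<1} \<in> sets lborel"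
        using measurable_sets[OF measurable_CI \<open>B \<in> sets borel\<close>]
        by (simp add: space_restrict_space sets_restrict_space_iff)
    qed
    also have "\<dots> = emeasure (distr ?\<Omega> borel I) B"
    proof -
      have "I \<in> measurable ?\<Omega> borel"
        using measurable_CI by (simp add: measurable_def sets_restrict_space space_restrict_space)
      then show ?thesis
        by (simp add: emeasure_distr space_restrict_space emeasure_restrict_space)
    qed
    finally show "emeasure (distr unif01 borel q) B = emeasure (distr ?\<Omega> borel I) B" .
  qed simp
  then have "distr unif01 borel q = \<mu>" by (simp add: distr_I_eq_M)
  moreover have "mono_on {0<..<1} q"
    using mono_I by (auto simp: mono_on_def q_def)
  ultimately show ?thesis using q that by blast
qed

text \<open>The bounds on \<open>q\<close> hold everywhere, not just almost everywhere, after clipping the quantile function.\<close>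
lemma bounded_law_quantile:
  fixes \<mu> :: "real measure"
  assumes "prob_space \<mu>" and sets: "sets \<mu> = sets borel" and AE: "AE x in \<mu>. a \<le> x \<and> x \<le> b"
    and "a \<le> b"
  obtains q where "q \<in> borel_measurable borel" and "mono_on {0<..<1} q" and "distr unif01 borel q = \<mu>"
    and "\<And>v. a \<le> q v" and "\<And>v. q v \<le> b"
proof -
  obtain q where q[measurable]: "q \<in> borel_measurable borel" and mono: "mono_on {0<..<1} q"
    and distr: "distr unif01 borel q = \<mu>"
    using real_law_quantile[OF assms(1,2)] by blast
  define r where "r v = max a (min b (q v))" for v
  have [measurable]: "r \<in> borel_measurable borel" unfolding r_def by measurable
  have "AE v in unif01. a \<le> q v \<and> q v \<le> b"
    using AE unfolding distr[symmetric] by (subst (asm) AE_distr_iff) auto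
  then have "AE v in unif01. r v = q v" by eventually_elim (auto simp: r_def)
  then have "distr unif01 borel r = distr unif01 borel q"
    by (intro distr_cong_AE) measurable
  moreover have "mono_on {0<..<1} r"
    using mono by (auto simp: mono_on_def r_def) (smt (verit))+
  ultimately show ?thesis using that[of r] \<open>a \<le> b\<close> distr by (auto simp: r_def)
qed

definition uniform_index :: "'w measure \<Rightarrow> ('w \<Rightarrow> 'k::finite) \<Rightarrow> bool" where
  "uniform_index M J \<longleftrightarrow> J \<in> measurable M (count_space UNIV) \<and>
     (\<forall>i. emeasure M {\<omega>\<in>space M. J \<omega> = i} = ennreal (1 / real CARD('k)))"

lemma emeasure_empirical:
  fixes x :: "'k::finite \<Rightarrow> 'b::topological_space"
  assumes "B \<in> sets borel"
  shows "emeasure (empirical x) B = ennreal (real (card {i. x i \<in> B}) / real CARD('k))"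
  unfolding empirical_def
  by (subst emeasure_distr)
    (auto simp: assms emeasure_uniform_count_measure space_uniform_count_measure
      sets_uniform_count_measure measurable_def vimage_def)

lemma nn_integral_uniform_index:
  fixes J :: "'w \<Rightarrow> 'k::finite" and g :: "'k \<Rightarrow> ennreal"
  assumes "uniform_index M J"
  shows "(\<integral>\<^sup>+\<omega>. g (J \<omega>) \<partial>M) = (\<Sum>i\<in>UNIV. ennreal (1 / real CARD('k)) * g i)"
proof -
  have J[measurable]: "J \<in> measurable M (count_space UNIV)"
    using assms by (simp add: uniform_index_def)
  have "(\<integral>\<^sup>+\<omega>. g (J \<omega>) \<partial>M) = (\<integral>\<^sup>+\<omega>. (\<Sum>i\<in>UNIV. g i * indicator {\<omega>\<in>space M. J \<omega> = i} \<omega>) \<partial>M)"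
    by (intro nn_integral_cong) (auto simp: indicator_def if_distrib cong: if_cong)
  also have "\<dots> = (\<Sum>i\<in>UNIV. g i * emeasure M {\<omega>\<in>space M. J \<omega> = i})"
    by (subst nn_integral_sum) (auto intro!: sum.cong nn_integral_cmult_indicator)
  finally show ?thesis
    using assms by (simp add: uniform_index_def mult.commute)
qed

lemma uniform_index_law:
  fixes J :: "'w \<Rightarrow> 'k::finite" and c :: "'k \<Rightarrow> real"
  assumes "uniform_index M J"
  shows "(\<lambda>\<omega>. c (J \<omega>)) \<in> borel_measurable M"
    and "distr M borel (\<lambda>\<omega>. c (J \<omega>)) = empirical c"
proof -
  have J[measurable]: "J \<in> measurable M (count_space UNIV)"
    using assms by (simp add: uniform_index_def)
  show [measurable]: "(\<lambda>\<omega>. c (J \<omega>)) \<in> borel_measurable M" by measurable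
  show "distr M borel (\<lambda>\<omega>. c (J \<omega>)) = empirical c"
  proof (rule measure_eqI)
    fix B assume "B \<in> sets (distr M borel (\<lambda>\<omega>. c (J \<omega>)))"
    then have B[measurable]: "B \<in> sets borel" by simp
    have "emeasure (distr M borel (\<lambda>\<omega>. c (J \<omega>))) B = (\<integral>\<^sup>+x. indicator B x \<partial>distr M borel (\<lambda>\<omega>. c (J \<omega>)))"
      by simp
    also have "\<dots> = (\<integral>\<^sup>+\<omega>. indicator B (c (J \<omega>)) \<partial>M)"
      by (subst nn_integral_distr) auto
    also have "\<dots> = (\<Sum>i\<in>UNIV. ennreal (1 / real CARD('k)) * indicator B (c i))"
      by (rule nn_integral_uniform_index[OF assms])
    also have "\<dots> = (\<Sum>i\<in>UNIV. ennreal (if c i \<in> B then 1 / real CARD('k) else 0))"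
      by (intro sum.cong) (auto simp: indicator_def)
    also have "\<dots> = ennreal (\<Sum>i\<in>UNIV. if c i \<in> B then 1 / real CARD('k) else 0)"
      by (rule sum_ennreal) auto
    also have "(\<Sum>i\<in>UNIV. if c i \<in> B then 1 / real CARD('k) else 0) = real (card {i. c i \<in> B}) / real CARD('k)"
      by (simp add: sum.If_cases Collect_conj_eq)
    finally show "emeasure (distr M borel (\<lambda>\<omega>. c (J \<omega>))) B = emeasure (empirical c) B"
      by (simp add: emeasure_empirical B)
  qed (simp add: empirical_def)
qed

lemma rich_prob_spaceE:
  assumes "rich_prob_space M"
  obtains U where "U \<in> borel_measurable M" and "distr M borel U = unif01"
  using assms by (auto simp: rich_prob_space_def)

text \<open>A uniform index \<open>J\<close> and an independent uniform variable \<open>V\<close>; their joint law enters only through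
integrals, so that no product measure has to be formed.\<close>
definition uniform_pair :: "'w measure \<Rightarrow> ('w \<Rightarrow> 'k::finite) \<Rightarrow> ('w \<Rightarrow> real) \<Rightarrow> bool" where
  "uniform_pair M J V \<longleftrightarrow> uniform_index M J \<and> V \<in> borel_measurable M \<and>
     (\<forall>f. (\<forall>i. f i \<in> borel_measurable borel) \<longrightarrow>
       (\<integral>\<^sup>+\<omega>. f (J \<omega>) (V \<omega>) \<partial>M) = (\<Sum>i\<in>UNIV. ennreal (1 / real CARD('k)) * (\<integral>\<^sup>+v. f i v \<partial>unif01)))"

lemma uniform_pairD:
  fixes J :: "'w \<Rightarrow> 'k::finite"
  assumes "uniform_pair M J V"
  shows "uniform_index M J" and "V \<in> borel_measurable M" and "J \<in> measurable M (count_space UNIV)"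
    and "(\<And>i. f i \<in> borel_measurable borel) \<Longrightarrow>
      (\<integral>\<^sup>+\<omega>. f (J \<omega>) (V \<omega>) \<partial>M) = (\<Sum>i\<in>UNIV. ennreal (1 / real CARD('k)) * (\<integral>\<^sup>+v. f i v \<partial>unif01))"
  using assms by (auto simp: uniform_pair_def uniform_index_def)

lemma rich_uniform_pair:
  assumes "rich_prob_space M"
  obtains J :: "'w \<Rightarrow> 'k::finite" and V :: "'w \<Rightarrow> real" where "uniform_pair M J V"
proof -
  obtain U where U[measurable]: "U \<in> borel_measurable M" and dU: "distr M borel U = unif01"
    using rich_prob_spaceE[OF assms] by blast
  let ?N = "CARD('k)"
  have N: "0 < ?N" by simp
  obtain e :: "nat \<Rightarrow> 'k" where e: "bij_betw e {..<?N} UNIV"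
    using ex_bij_betw_nat_finite[of "UNIV :: 'k set"] by (auto simp: lessThan_atLeast0)
  \<comment> \<open>the cell of \<open>u\<close> and its relative position in the cell; \<open>u = 1\<close> is a null set\<close>
  define j where "j u = e (nat \<lfloor>real ?N * u\<rfloor>)" for u :: real
  define r where "r u = frac (real ?N * u)" for u :: real
  have j[measurable]: "j \<in> measurable borel (count_space UNIV)" unfolding j_def by measurable
  have r[measurable]: "r \<in> borel_measurable borel" unfolding r_def by measurable
  have key: "(\<integral>\<^sup>+\<omega>. f (j (U \<omega>)) (r (U \<omega>)) \<partial>M)
      = (\<Sum>i\<in>UNIV. ennreal (1 / real ?N) * (\<integral>\<^sup>+v. f i v \<partial>unif01))"
    if f[measurable]: "\<And>i. f i \<in> borel_measurable borel" for f :: "'k \<Rightarrow> real \<Rightarrow> ennreal"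
  proof -
    have [measurable]: "(\<lambda>u. f (j u) (r u)) \<in> borel_measurable borel"
      by (rule measurable_compose_countable[where f = "\<lambda>i u. f i (r u)"]) measurable
    have "(\<integral>\<^sup>+\<omega>. f (j (U \<omega>)) (r (U \<omega>)) \<partial>M) = (\<integral>\<^sup>+u. f (j u) (r u) \<partial>unif01)"
      unfolding dU[symmetric] by (subst nn_integral_distr) auto
    also have "\<dots> = (\<Sum>k<?N. ennreal (1 / real ?N)
        * (\<integral>\<^sup>+v. f (j ((real k + v) / real ?N)) (r ((real k + v) / real ?N)) \<partial>unif01))"
      by (rule nn_integral_unif01_split) auto
    also have "\<dots> = (\<Sum>k<?N. ennreal (1 / real ?N) * (\<integral>\<^sup>+v. f (e k) v \<partial>unif01))"
    proof (intro sum.cong refl arg_cong2[where f = "(*)"] nn_integral_cong_AE)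
      fix k
      show "AE v in unif01. f (j ((real k + v) / real ?N)) (r ((real k + v) / real ?N)) = f (e k) v"
        using AE_unif01
      proof eventually_elim
        case (elim v)
        then have "\<lfloor>real k + v\<rfloor> = int k" by (intro floor_unique) auto
        then have "j ((real k + v) / real ?N) = e k" "r ((real k + v) / real ?N) = v"
          by (auto simp: j_def r_def frac_def)
        then show ?case by simp
      qed
    qed
    also have "\<dots> = (\<Sum>i\<in>UNIV. ennreal (1 / real ?N) * (\<integral>\<^sup>+v. f i v \<partial>unif01))"
      by (rule sum.reindex_bij_betw[OF e])
    finally show ?thesis .
  qed
  have "emeasure M {\<omega>\<in>space M. j (U \<omega>) = i} = ennreal (1 / real ?N)" for i
  proof -
    interpret unif: prob_space unif01 by (rule prob_space_unif01)
    have "emeasure M {\<omega>\<in>space M. j (U \<omega>) = i} = (\<integral>\<^sup>+\<omega>. indicator {i} (j (U \<omega>)) \<partial>M)"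
    proof -
      have "(\<integral>\<^sup>+\<omega>. indicator {i} (j (U \<omega>)) \<partial>M) = (\<integral>\<^sup>+\<omega>. indicator {\<omega>\<in>space M. j (U \<omega>) = i} \<omega> \<partial>M)"
        by (intro nn_integral_cong) (auto simp: indicator_def)
      then show ?thesis by simp
    qed
    also have "\<dots> = (\<Sum>k\<in>UNIV. ennreal (1 / real ?N) * (\<integral>\<^sup>+v. indicator {i} k \<partial>unif01))"
      using key[of "\<lambda>k _. indicator {i} k"] by simp
    also have "\<dots> = ennreal (1 / real ?N)"
      using unif.emeasure_space_1
      by (simp add: indicator_def if_distrib cong: if_cong)
    finally show ?thesis .
  qed
  then have "uniform_index M (\<lambda>\<omega>. j (U \<omega>))" unfolding uniform_index_def by auto
  then have "uniform_pair M (\<lambda>\<omega>. j (U \<omega>)) (\<lambda>\<omega>. r (U \<omega>))"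
    unfolding uniform_pair_def using key by auto
  then show ?thesis by (rule that)
qed

section \<open>Rotation averages and splitting of events\<close>

lemma distr_unif01_frac_shift:
  assumes a: "0 \<le> a" "a < 1"
  shows "distr unif01 borel (\<lambda>v. frac (v + a)) = unif01"
proof (rule measure_eqI)
  fix B assume "B \<in> sets (distr unif01 borel (\<lambda>v. frac (v + a)))"
  then have [measurable]: "B \<in> sets borel" by simp
  have "emeasure (distr unif01 borel (\<lambda>v. frac (v + a))) B
      = (\<integral>\<^sup>+x. indicator B x \<partial>distr unif01 borel (\<lambda>v. frac (v + a)))"
    by simp
  also have "\<dots> = (\<integral>\<^sup>+v. indicator B (frac (v + a)) \<partial>unif01)"
    by (subst nn_integral_distr) auto
  also have "\<dots> = (\<integral>\<^sup>+v. indicator B v \<partial>unif01)"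
    by (rule nn_integral_unif01_frac_shift[OF _ a]) measurable
  finally show "emeasure (distr unif01 borel (\<lambda>v. frac (v + a))) B = emeasure unif01 B"
    by (simp add: nn_integral_indicator)
qed simp

text \<open>Off the null set of multiples of \<open>1/K\<close>, a point of the unit interval is a grid point plus a remainder
strictly between \<open>0\<close> and \<open>1/K\<close>, where monotonicity on the open interval can be used.\<close>
lemma AE_unif01_off_grid:
  assumes "0 < K"
  shows "AE v in unif01. \<exists>L<K. \<exists>w. 0 < w \<and> w < 1 / real K \<and> v = w + real L / real K"
proof -
  define G where "G = range (\<lambda>m::int. real_of_int m / real K)"
  have "countable G" by (simp add: G_def)
  then have "AE v in lborel. v \<notin> G"
    by (intro AE_not_in countable_imp_null_set_lborel)
  then have "AE v in unif01. v \<notin> G" by (intro AE_uniform_measureI) auto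
  with AE_unif01 show ?thesis
  proof eventually_elim
    case (elim v)
    define L where "L = nat \<lfloor>real K * v\<rfloor>"
    have L: "real L = of_int \<lfloor>real K * v\<rfloor>" using elim by (simp add: L_def)
    have "real L \<noteq> real K * v"
    proof
      assume "real L = real K * v"
      then have "v = real_of_int (int L) / real K" using assms by (simp add: field_simps)
      then have "v \<in> G" unfolding G_def by (rule image_eqI) simp
      then show False using elim by simp
    qed
    moreover have "real L \<le> real K * v" "real K * v < real L + 1" unfolding L by linarith+
    ultimately have 1: "0 < v - real L / real K" "v - real L / real K < 1 / real K"
    proof -
      have "real L / real K < v" using \<open>real L \<noteq> real K * v\<close> \<open>real L \<le> real K * v\<close> assms
        by (simp add: pos_divide_less_eq mult.commute)
      moreover have "v < (real L + 1) / real K" using \<open>real K * v < real L + 1\<close> assms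
        by (simp add: pos_less_divide_eq mult.commute)
      ultimately show "0 < v - real L / real K" "v - real L / real K < 1 / real K"
        by (simp_all add: add_divide_distrib)
    qed
    have "real K * v < real K" using elim assms by simp
    then have "L < K" using \<open>real L \<le> real K * v\<close> by linarith
    then show ?case using 1 by (intro exI[of _ L] conjI exI[of _ "v - real L / real K"]) auto
  qed
qed

text \<open>The sum \<open>g\<close> of all rotations has period \<open>1/K\<close>, so only its values on one cell matter. There the
arguments of two such sums interlace, and monotonicity bounds the oscillation of the sum by that of
a single value of \<open>q\<close>. As \<open>g\<close> has the same mean as \<open>q\<close> up to the factor \<open>K\<close>, it is nearly constant.\<close>
lemma mono_rotation_average:
  fixes q :: "real \<Rightarrow> real"
  assumes [measurable]: "q \<in> borel_measurable borel" and mono: "mono_on {0<..<1} q"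
    and bnd: "\<And>v. a \<le> q v" "\<And>v. q v \<le> b" and K: "0 < K"
  shows "AE v in unif01. (\<integral>v. q v \<partial>unif01) - (b - a) / real K
    \<le> (1 / real K) * (\<Sum>r<K. q (frac (v + real r / real K)))"
proof -
  interpret prob_space unif01 by (rule prob_space_unif01)
  define g where "g v = (\<Sum>r<K. q (frac (v + real r / real K)))" for v
  have [measurable]: "g \<in> borel_measurable borel" unfolding g_def by measurable
  have step: "g (x + 1 / real K) = g x" for x
  proof -
    have "g (x + 1 / real K) + q (frac (x + real 0 / real K))
      = (\<Sum>r<Suc K. q (frac (x + real r / real K)))"
      unfolding sum.lessThan_Suc_shift g_def
      by (simp add: add_divide_distrib add.assoc)
    also have "\<dots> = g x + q (frac (x + 1))" using K by (simp add: g_def)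
    also have "frac (x + 1) = frac x" by (simp add: frac_def)
    finally show ?thesis by simp
  qed
  have shift: "g (w + real L / real K) = g w" for w L
  proof (induction L)
    case (Suc L)
    then show ?case using step[of "w + real L / real K"] by (simp add: add_divide_distrib add_ac)
  qed simp
  have base: "g w = (\<Sum>r<K. q (w + real r / real K))" if "0 < w" "w < 1 / real K" for w
    unfolding g_def
  proof (rule sum.cong[OF refl])
    fix r assume "r \<in> {..<K}"
    then have "real r / real K \<le> (real K - 1) / real K" using K by (intro divide_right_mono) auto
    also have "\<dots> = 1 - 1 / real K" using K by (simp add: field_simps)
    finally have "frac (w + real r / real K) = w + real r / real K"
      using that by (intro frac_eq[THEN iffD2]) auto
    then show "q (frac (w + real r / real K)) = q (w + real r / real K)" by simp
  qed
  have osc: "g w' - (b - a) \<le> g w"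
    if w: "0 < w" "w < 1 / real K" and w': "0 < w'" "w' < 1 / real K" for w w'
  proof -
    obtain n where n: "K = Suc n" using K gr0_conv_Suc by auto
    have "{..<K} = insert n {..<n}" using n by auto
    then have "g w' = (\<Sum>r<n. q (w' + real r / real K)) + q (w' + real n / real K)"
      by (simp add: base w')
    also have "\<dots> \<le> (\<Sum>r<n. q (w + real (Suc r) / real K)) + b"
    proof (intro add_mono sum_mono bnd)
      fix r assume "r \<in> {..<n}"
      then have "real (Suc r) / real K \<le> (real K - 1) / real K"
        by (intro divide_right_mono) (auto simp: n)
      also have "\<dots> = 1 - 1 / real K" using K by (simp add: field_simps)
      finally have r: "real (Suc r) / real K \<le> 1 - 1 / real K" .
      have "real (Suc r) / real K = real r / real K + 1 / real K"
        by (simp add: add_divide_distrib)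
      moreover have "0 \<le> real r / real K" by simp
      moreover have "q (w' + x) \<le> q (w + x')"
        if "0 \<le> x" "x' = x + d" "x' \<le> 1 - d" "w < d" "w' < d" for x x' d
        using that w(1) w'(1) by (intro mono_onD[OF mono]) auto
      ultimately show "q (w' + real r / real K) \<le> q (w + real (Suc r) / real K)"
        using r w(2) w'(2) by blast
    qed
    also have "(\<Sum>r<n. q (w + real (Suc r) / real K)) = g w - q w"
      unfolding base[OF w] n sum.lessThan_Suc_shift by simp
    finally show ?thesis using bnd(1)[of w] by linarith
  qed
  have off: "AE v in unif01. \<exists>w. 0 < w \<and> w < 1 / real K \<and> g v = g w"
    using AE_unif01_off_grid[OF K] by eventually_elim (metis shift)
  have int: "integrable unif01 (\<lambda>v. q (frac (v + real r / real K)))" for r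
    by (rule integrable_const_bound[of _ "max \<bar>a\<bar> \<bar>b\<bar>"])
      (use bnd in \<open>auto simp: abs_le_iff intro!: AE_I2, (smt (verit))+\<close>)
  have "(\<integral>v. g v \<partial>unif01) = (\<Sum>r<K. \<integral>v. q (frac (v + real r / real K)) \<partial>unif01)"
    unfolding g_def by (rule Bochner_Integration.integral_sum) (rule int)
  also have "\<dots> = (\<Sum>r<K. \<integral>v. q v \<partial>unif01)"
  proof (rule sum.cong[OF refl])
    fix r assume "r \<in> {..<K}"
    then have "distr unif01 borel (\<lambda>v. frac (v + real r / real K)) = unif01"
      by (intro distr_unif01_frac_shift) auto
    then have "(\<integral>v. q v \<partial>unif01) = (\<integral>v. q v \<partial>distr unif01 borel (\<lambda>v. frac (v + real r / real K)))"
      by simp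
    also have "\<dots> = (\<integral>v. q (frac (v + real r / real K)) \<partial>unif01)"
      by (rule integral_distr) auto
    finally show "(\<integral>v. q (frac (v + real r / real K)) \<partial>unif01) = (\<integral>v. q v \<partial>unif01)" by simp
  qed
  finally have mean: "(\<integral>v. g v \<partial>unif01) = real K * (\<integral>v. q v \<partial>unif01)" by simp
  have intg: "integrable unif01 g"
    unfolding g_def using int by (intro Bochner_Integration.integrable_sum)
  show ?thesis
    using off
  proof eventually_elim
    case (elim v)
    then obtain w where w: "0 < w" "w < 1 / real K" "g v = g w" by auto
    have "AE v' in unif01. g v' - (b - a) \<le> g v"
      using off by eventually_elim (metis osc w)
    then have "(\<integral>v'. g v' - (b - a) \<partial>unif01) \<le> (\<integral>v'. g v \<partial>unif01)"
      using intg by (intro integral_mono_AE) auto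
    moreover have "(\<integral>v'. g v' - (b - a) \<partial>unif01) = (\<integral>v'. g v' \<partial>unif01) - (b - a)"
      using intg prob_space by (subst Bochner_Integration.integral_diff) auto
    moreover have "(\<integral>v'. g v \<partial>unif01) = g v"
      using prob_space by simp
    ultimately have "real K * (\<integral>v. q v \<partial>unif01) - (b - a) \<le> g v" by (simp add: mean)
    then have "(real K * (\<integral>v. q v \<partial>unif01) - (b - a)) / real K \<le> g v / real K"
      by (rule divide_right_mono) simp
    then show ?case unfolding g_def[symmetric] using K by (simp add: diff_divide_distrib)
  qed
qed

text \<open>The measure of \<open>A\<close> below the level \<open>u\<close> of a uniform variable is Lipschitz in \<open>u\<close>, so the intermediate
value theorem applies.\<close>
lemma rich_event_split:
  assumes rich: "rich_prob_space M" and A: "A \<in> sets M" and t: "0 \<le> t" "t \<le> measure M A"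
  obtains B where "B \<in> sets M" "B \<subseteq> A" "measure M B = t"
proof -
  interpret prob_space M using rich by (simp add: rich_prob_space_def)
  obtain U where U[measurable]: "U \<in> borel_measurable M" and dU: "distr M borel U = unif01"
    using rich_prob_spaceE[OF rich] by blast
  note [measurable] = A
  define G where "G u = measure M {\<omega>\<in>A. U \<omega> \<le> u}" for u
  have msr[measurable]: "{\<omega>\<in>A. U \<omega> \<le> u} \<in> sets M" for u
  proof -
    have "{\<omega>\<in>A. U \<omega> \<le> u} = A \<inter> {\<omega>\<in>space M. U \<omega> \<le> u}"
      using sets.sets_into_space[OF A] by auto
    then show ?thesis using A by simp
  qed
  have law: "measure M {\<omega>\<in>space M. U \<omega> \<in> S} = measure unif01 S" if "S \<in> sets borel" for S
    using that unfolding dU[symmetric] by (subst measure_distr) (auto intro: arg_cong[where f="measure M"])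
  have inc: "G u \<le> G v" "G v - G u \<le> v - u" if "u \<le> v" for u v
  proof -
    show "G u \<le> G v" unfolding G_def using that by (intro finite_measure_mono) auto
    have "G v - G u = measure M ({\<omega>\<in>A. U \<omega> \<le> v} - {\<omega>\<in>A. U \<omega> \<le> u})"
      unfolding G_def using that by (intro finite_measure_Diff[symmetric]) auto
    also have "\<dots> \<le> measure M {\<omega>\<in>space M. U \<omega> \<in> {u<..v}}"
      using sets.sets_into_space[OF A] by (intro finite_measure_mono) auto
    also have "\<dots> = measure unif01 {u<..v}" by (rule law) simp
    also have "\<dots> = measure lborel ({0..1} \<inter> {u<..v})"
      by (simp add: measure_def divide_ennreal_def)
    also have "\<dots> \<le> measure lborel {u<..v}"
      using that by (intro measure_mono_fmeasurable) (auto simp: fmeasurable_def)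
    also have "\<dots> = v - u" using that by simp
    finally show "G v - G u \<le> v - u" .
  qed
  have "\<bar>G u - G v\<bar> \<le> 1 * \<bar>u - v\<bar>" for u v
    using inc[of u v] inc[of v u] by (cases "u \<le> v") auto
  then have "continuous_on {0..1} G"
    by (intro lipschitz_on_continuous_on[OF lipschitz_onI[where L = 1]]) (auto simp: dist_real_def)
  moreover have "G 0 = 0"
  proof -
    have "G 0 \<le> measure M {\<omega>\<in>space M. U \<omega> \<in> {..0}}"
      unfolding G_def using sets.sets_into_space[OF A] by (intro finite_measure_mono) auto
    also have "\<dots> = measure unif01 {..0}" by (rule law) simp
    also have "\<dots> = 0"
    proof -
      have "{0..1} \<inter> {..0} = {0::real}" by auto
      then show ?thesis by (simp add: measure_def)
    qed
    finally show ?thesis by (simp add: G_def measure_le_0_iff)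
  qed
  moreover have "G 1 = measure M A"
  proof -
    have "AE \<omega> in M. U \<omega> \<le> 1"
    proof -
      have "AE u in distr M borel U. u \<le> 1"
        unfolding dU using AE_unif01 by eventually_elim simp
      then show ?thesis by (subst (asm) AE_distr_iff) auto
    qed
    then show ?thesis unfolding G_def
      by (intro finite_measure_eq_AE) (auto elim!: eventually_mono)
  qed
  ultimately obtain u where "G u = t"
    using IVT'[of G 0 t 1] t by auto
  then show ?thesis using that[of "{\<omega>\<in>A. U \<omega> \<le> u}"] by (auto simp: G_def)
qed

text \<open>Each level set of \<open>Z\<close> has as many multiples of \<open>1/N\<close> in probability as there are indices with that
value. Cutting it into events of probability \<open>1/N\<close>, one for each of these indices, defines \<open>J\<close>.\<close>
lemma rich_uniform_label:
  fixes y :: "'k::finite \<Rightarrow> real"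
  assumes rich: "rich_prob_space M" and Z[measurable]: "Z \<in> borel_measurable M"
    and law: "distr M borel Z = empirical y"
  obtains J where "uniform_index M J" and "AE \<omega> in M. Z \<omega> = y (J \<omega>)"
proof -
  interpret prob_space M using rich by (simp add: rich_prob_space_def)
  let ?N = "real CARD('k)"
  have N: "?N > 0" by simp
  have lev: "measure M {\<omega>\<in>space M. Z \<omega> = v} = real (card {i. y i = v}) / ?N" for v
  proof -
    have "emeasure M {\<omega>\<in>space M. Z \<omega> = v} = emeasure (distr M borel Z) {v}"
      by (subst emeasure_distr) (auto intro: arg_cong[where f="emeasure M"])
    also have "\<dots> = ennreal (real (card {i. y i = v}) / ?N)"
      unfolding law by (subst emeasure_empirical) auto
    finally show ?thesis by (simp add: measure_def)
  qed
  have "\<exists>D. (\<forall>i\<in>F. D i \<in> sets M \<and> D i \<subseteq> {\<omega>\<in>space M. Z \<omega> = y i} \<and> measure M (D i) = 1 / ?N)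
      \<and> disjoint_family_on D F" if "finite F" for F :: "'k set"
    using that
  proof (induction F rule: finite_induct)
    case empty
    show ?case by (simp add: disjoint_family_on_def)
  next
    case (insert j F)
    then obtain D where D: "\<And>i. i \<in> F \<Longrightarrow> D i \<in> sets M"
      "\<And>i. i \<in> F \<Longrightarrow> D i \<subseteq> {\<omega>\<in>space M. Z \<omega> = y i}"
      "\<And>i. i \<in> F \<Longrightarrow> measure M (D i) = 1 / ?N" "disjoint_family_on D F"
      by blast
    \<comment> \<open>the indices already served from the level set of \<open>y j\<close>\<close>
    define E where "E = {i\<in>F. y i = y j}"
    have fE: "finite E" and EF: "E \<subseteq> F" using insert by (auto simp: E_def)
    define A where "A = {\<omega>\<in>space M. Z \<omega> = y j} - (\<Union>i\<in>E. D i)"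
    have UE: "(\<Union>i\<in>E. D i) \<in> sets M" using fE D(1) EF by auto
    have A: "A \<in> sets M" unfolding A_def using UE by auto
    have "measure M A = measure M {\<omega>\<in>space M. Z \<omega> = y j} - measure M (\<Union>i\<in>E. D i)"
    proof -
      have "D i \<subseteq> {\<omega>\<in>space M. Z \<omega> = y j}" if "i \<in> E" for i
        using D(2)[of i] that by (simp add: E_def)
      then have "(\<Union>i\<in>E. D i) \<subseteq> {\<omega>\<in>space M. Z \<omega> = y j}" by (rule UN_least)
      then show ?thesis unfolding A_def using UE by (intro finite_measure_Diff) auto
    qed
    also have "measure M (\<Union>i\<in>E. D i) = (\<Sum>i\<in>E. measure M (D i))"
      using fE D(1,4) EF by (intro finite_measure_finite_Union)
        (auto intro: disjoint_family_on_mono)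
    also have "\<dots> = real (card E) / ?N" using D(3) EF by (simp add: subset_iff)
    finally have mA: "measure M A = (real (card {i. y i = y j}) - real (card E)) / ?N"
      unfolding lev by (simp add: diff_divide_distrib)
    have "card (insert j E) \<le> card {i. y i = y j}" by (intro card_mono) (auto simp: E_def)
    then have "real (card E) + 1 \<le> real (card {i. y i = y j})"
      using fE insert(2) by (simp add: E_def)
    then have "1 / ?N \<le> measure M A" unfolding mA by (intro divide_right_mono) auto
    then obtain B where B: "B \<in> sets M" "B \<subseteq> A" "measure M B = 1 / ?N"
      using rich_event_split[OF rich A, of "1 / ?N"] by auto
    have dis: "B \<inter> D i = {}" if "i \<in> F" for i
    proof (cases "i \<in> E")
      case True then show ?thesis using B(2) unfolding A_def by blast
    next
      case False
      then have "y i \<noteq> y j" using that by (auto simp: E_def)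
      then show ?thesis using D(2)[OF that] B(2) unfolding A_def by fastforce
    qed
    show ?case
    proof (intro exI[of _ "D(j := B)"] conjI ballI)
      fix i assume "i \<in> insert j F"
      then show "(D(j := B)) i \<in> sets M" "(D(j := B)) i \<subseteq> {\<omega>\<in>space M. Z \<omega> = y i}"
        "measure M ((D(j := B)) i) = 1 / ?N"
        using D B by (auto simp: A_def)
    next
      show "disjoint_family_on (D(j := B)) (insert j F)"
        using D(4) dis insert(2) by (auto simp: disjoint_family_on_def)
    qed
  qed
  from this[of UNIV] obtain D where D: "\<And>i. D i \<in> sets M"
    "\<And>i. D i \<subseteq> {\<omega>\<in>space M. Z \<omega> = y i}" "\<And>i. measure M (D i) = 1 / ?N"
    "disjoint_family D" by auto
  \<comment> \<open>the value outside the union of the cells is irrelevant, that set being null\<close>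
  define J where "J \<omega> = (if \<exists>i. \<omega> \<in> D i then THE i. \<omega> \<in> D i else undefined)" for \<omega>
  have JD: "J \<omega> = i" if "\<omega> \<in> D i" for \<omega> i
  proof -
    have "(THE i. \<omega> \<in> D i) = i"
      using that D(4) by (intro the_equality) (auto simp: disjoint_family_on_def)
    then show ?thesis using that by (auto simp: J_def)
  qed
  have UD: "(\<Union>i. D i) \<in> sets M" using D(1) by (intro sets.finite_UN) auto
  have "measure M (\<Union>i. D i) = (\<Sum>i\<in>UNIV. measure M (D i))"
    using D by (intro finite_measure_finite_Union) auto
  also have "\<dots> = 1" using D(3) by simp
  finally have full: "AE \<omega> in M. \<omega> \<in> (\<Union>i. D i)"
    using UD by (simp add: prob_eq_1)
  have pre: "{\<omega>\<in>space M. J \<omega> = i}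
    = D i \<union> (if i = undefined then space M - (\<Union>i. D i) else {})" for i
  proof -
    have "D k \<subseteq> space M" for k by (rule sets.sets_into_space[OF D(1)])
    moreover have "J \<omega> = undefined" if "\<And>i. \<omega> \<notin> D i" for \<omega> using that by (simp add: J_def)
    ultimately show ?thesis using JD by (fastforce split: if_splits)
  qed
  have Jm: "J \<in> measurable M (count_space UNIV)"
  proof (rule measurable_count_space_eq2[THEN iffD2, OF finite], intro conjI ballI)
    fix i show "J -` {i} \<inter> space M \<in> sets M"
      using pre[of i] D(1) UD by (simp add: vimage_def Collect_conj_eq Int_commute)
  qed auto
  note [measurable] = Jm
  have "emeasure M {\<omega>\<in>space M. J \<omega> = i} = ennreal (1 / ?N)" for i
  proof -
    have "emeasure M {\<omega>\<in>space M. J \<omega> = i} = emeasure M (D i)"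
    proof (rule emeasure_eq_AE)
      show "AE \<omega> in M. \<omega> \<in> {\<omega>\<in>space M. J \<omega> = i} \<longleftrightarrow> \<omega> \<in> D i"
        using full by eventually_elim (auto dest: JD sets.sets_into_space[OF D(1), THEN subsetD])
    qed (use D in auto)
    then show ?thesis using D(3)[of i] by (simp add: emeasure_eq_measure)
  qed
  then have "uniform_index M J" using Jm by (auto simp: uniform_index_def)
  moreover have "AE \<omega> in M. Z \<omega> = y (J \<omega>)"
    using full by eventually_elim (use JD D(2) in blast)
  ultimately show ?thesis using that by blast
qed

section \<open>Risk is monotone under conditional means\<close>

lemma ext_expectation_integrable:
  assumes "integrable M f"
  shows "ext_expectation M f = ereal (\<integral>x. f x \<partial>M)"
proof -
  obtain r q where rq: "0 \<le> r" "0 \<le> q" "(\<integral>\<^sup>+x. ennreal (f x) \<partial>M) = ennreal r"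
    "(\<integral>\<^sup>+x. ennreal (- f x) \<partial>M) = ennreal q" "(\<integral>x. f x \<partial>M) = r - q"
    using integrableE[OF assms] by metis
  show ?thesis unfolding ext_expectation_def rq(3,4) by (simp add: rq)
qed

lemma ext_expectation_cong_AE:
  assumes "AE x in M. f x = g x"
  shows "ext_expectation M f = ext_expectation M g"
proof -
  have "(\<integral>\<^sup>+x. ennreal (f x) \<partial>M) = (\<integral>\<^sup>+x. ennreal (g x) \<partial>M)"
    "(\<integral>\<^sup>+x. ennreal (- f x) \<partial>M) = (\<integral>\<^sup>+x. ennreal (- g x) \<partial>M)"
    by (intro nn_integral_cong_AE; use assms in eventually_elim, simp)+
  then show ?thesis by (simp add: ext_expectation_def)
qed

lemma integral_uniform_index:
  fixes J :: "'w \<Rightarrow> 'k::finite" and c :: "'k \<Rightarrow> real"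
  assumes "prob_space M" and J: "uniform_index M J"
  shows "integrable M (\<lambda>\<omega>. c (J \<omega>))"
    and "(\<integral>\<omega>. c (J \<omega>) \<partial>M) = (\<Sum>i\<in>UNIV. c i) / real CARD('k)"
proof -
  interpret prob_space M by fact
  note [measurable] = uniform_index_law(1)[OF J]
  have "\<bar>c i\<bar> \<le> Max (range (\<lambda>i. \<bar>c i\<bar>))" for i by (intro Max_ge) auto
  then show int: "integrable M (\<lambda>\<omega>. c (J \<omega>))"
    by (intro integrable_const_bound[of _ "Max (range (\<lambda>i. \<bar>c i\<bar>))"]) auto
  have "(\<integral>\<omega>. c (J \<omega>) \<partial>M) = (\<integral>x. x \<partial>distr M borel (\<lambda>\<omega>. c (J \<omega>)))"
    by (subst integral_distr) auto
  also have "\<dots> = (\<integral>i. c i \<partial>uniform_count_measure UNIV)"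
    unfolding uniform_index_law(2)[OF J] empirical_def
    by (subst integral_distr) (auto simp: measurable_def sets_uniform_count_measure)
  also have "\<dots> = (\<Sum>i\<in>UNIV. c i) / real CARD('k)"
    by (subst integral_uniform_count_measure) auto
  finally show "(\<integral>\<omega>. c (J \<omega>) \<partial>M) = (\<Sum>i\<in>UNIV. c i) / real CARD('k)" .
qed

text \<open>\<open>L\<close> is the law of a random variable whose conditional law, given a uniform index \<open>i\<close>, is \<open>\<mu> i\<close>.\<close>
definition mixture_law :: "real measure \<Rightarrow> ('k::finite \<Rightarrow> real measure) \<Rightarrow> bool" where
  "mixture_law L \<mu> \<longleftrightarrow> (\<forall>B\<in>sets borel.
     emeasure L B = (\<Sum>i\<in>UNIV. ennreal (1 / real CARD('k)) * emeasure (\<mu> i) B))"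

lemma mixture_law_unique:
  assumes "mixture_law L \<mu>" "mixture_law L' \<mu>" "sets L = sets borel" "sets L' = sets borel"
  shows "L = L'"
  using assms by (intro measure_eqI) (auto simp: mixture_law_def)

locale law_invariant_risk =
  fixes M :: "'w measure" and \<rho> :: "('w \<Rightarrow> real) \<Rightarrow> ereal"
  assumes rich: "rich_prob_space M"
    and coherent: "coherent_risk_measure M \<rho>"
    and law: "law_invariant M \<rho>"
begin

sublocale prob_space M
  using rich by (simp add: rich_prob_space_def)

lemma risk_domainI:
  assumes "X \<in> borel_measurable M" "AE \<omega> in M. a \<le> X \<omega>"
  shows "X \<in> risk_domain M"
  using assms by (auto simp: risk_domain_def)

lemma risk_mono:
  assumes "X \<in> risk_domain M" "Y \<in> risk_domain M" "AE \<omega> in M. Y \<omega> \<le> X \<omega>"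
  shows "\<rho> Y \<le> \<rho> X"
  using coherent assms unfolding coherent_risk_measure_def by blast

lemma risk_add:
  assumes "X \<in> risk_domain M" "Y \<in> risk_domain M"
  shows "\<rho> (\<lambda>\<omega>. X \<omega> + Y \<omega>) \<le> \<rho> X + \<rho> Y"
  using coherent assms unfolding coherent_risk_measure_def by blast

lemma risk_scale:
  assumes "X \<in> risk_domain M" "0 < c"
  shows "\<rho> (\<lambda>\<omega>. c * X \<omega>) = ereal c * \<rho> X"
  using coherent assms unfolding coherent_risk_measure_def by blast

lemma risk_law:
  assumes "X \<in> risk_domain M" "Y \<in> risk_domain M" "distr M borel X = distr M borel Y"
  shows "\<rho> X = \<rho> Y"
  using law assms unfolding law_invariant_def by blast

lemma risk_domain_add_const:
  assumes "X \<in> risk_domain M"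
  shows "(\<lambda>\<omega>. X \<omega> + c) \<in> risk_domain M"
proof -
  obtain b where b: "AE \<omega> in M. b \<le> X \<omega>" using assms by (auto simp: risk_domain_def)
  show ?thesis
    using assms b by (intro risk_domainI[of _ "b + c"]) (auto simp: risk_domain_def elim!: eventually_mono)
qed

lemma risk_shift:
  assumes X: "X \<in> risk_domain M"
  shows "\<rho> (\<lambda>\<omega>. X \<omega> + c) = \<rho> X + ereal c"
proof -
  have pos: "\<rho> (\<lambda>\<omega>. X \<omega> + c) = \<rho> X + ereal c" if "X \<in> risk_domain M" "0 \<le> c" for X c
    using coherent that unfolding coherent_risk_measure_def by blast
  show ?thesis
  proof (cases "0 \<le> c")
    case False
    then have "\<rho> (\<lambda>\<omega>. (X \<omega> + c) + - c) = \<rho> (\<lambda>\<omega>. X \<omega> + c) + ereal (- c)"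
      by (intro pos risk_domain_add_const X) auto
    then have "\<rho> X = \<rho> (\<lambda>\<omega>. X \<omega> + c) + ereal (- c)" by simp
    then show ?thesis by (cases "\<rho> (\<lambda>\<omega>. X \<omega> + c)") auto
  qed (rule pos[OF X])
qed

lemma risk_const: "\<rho> (\<lambda>_. c) = ereal c"
proof -
  have "\<rho> (\<lambda>_. 0) = 0" using coherent by (simp add: coherent_risk_measure_def)
  moreover have "(\<lambda>_. 0) \<in> risk_domain M" by (rule risk_domainI[of _ 0]) auto
  ultimately show ?thesis using risk_shift[of "\<lambda>_. 0" c] by simp
qed

lemma const_in_domain: "(\<lambda>_. c) \<in> risk_domain M"
  by (rule risk_domainI[of _ c]) auto

lemma risk_bounds:
  assumes "X \<in> borel_measurable M"
  shows "(AE \<omega> in M. a \<le> X \<omega>) \<Longrightarrow> ereal a \<le> \<rho> X"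
    and "X \<in> risk_domain M \<Longrightarrow> (AE \<omega> in M. X \<omega> \<le> b) \<Longrightarrow> \<rho> X \<le> ereal b"
  using risk_mono[OF risk_domainI[OF assms] const_in_domain, of a a]
    risk_mono[OF const_in_domain, of X b] by (auto simp: risk_const)

lemma risk_average:
  assumes "0 < K" and X: "\<And>r. r < K \<Longrightarrow> X r \<in> risk_domain M" and R: "\<And>r. r < K \<Longrightarrow> \<rho> (X r) \<le> ereal R"
  shows "\<rho> (\<lambda>\<omega>. (1 / real K) * (\<Sum>r<K. X r \<omega>)) \<le> ereal R"
proof -
  have "n \<le> K \<Longrightarrow> (\<lambda>\<omega>. \<Sum>r<n. X r \<omega>) \<in> risk_domain M \<and> \<rho> (\<lambda>\<omega>. \<Sum>r<n. X r \<omega>) \<le> ereal (real n * R)" for n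
  proof (induction n)
    case 0
    then show ?case using const_in_domain[of 0] risk_const[of 0] by simp
  next
    case (Suc n)
    then have IH: "(\<lambda>\<omega>. \<Sum>r<n. X r \<omega>) \<in> risk_domain M" "\<rho> (\<lambda>\<omega>. \<Sum>r<n. X r \<omega>) \<le> ereal (real n * R)"
      and Xn: "X n \<in> risk_domain M" "\<rho> (X n) \<le> ereal R" using X R by auto
    obtain a b where "AE \<omega> in M. a \<le> (\<Sum>r<n. X r \<omega>)" "AE \<omega> in M. b \<le> X n \<omega>"
      using IH(1) Xn(1) by (auto simp: risk_domain_def)
    then have "AE \<omega> in M. a + b \<le> (\<Sum>r<Suc n. X r \<omega>)"
      by eventually_elim simp
    moreover have "(\<lambda>\<omega>. \<Sum>r<Suc n. X r \<omega>) \<in> borel_measurable M"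
      using IH(1) Xn(1) by (auto simp: risk_domain_def intro: borel_measurable_add)
    moreover have "\<rho> (\<lambda>\<omega>. (\<Sum>r<n. X r \<omega>) + X n \<omega>) \<le> ereal (real n * R) + ereal R"
      by (rule order_trans[OF risk_add[OF IH(1) Xn(1)] add_mono[OF IH(2) Xn(2)]])
    ultimately show ?case by (auto intro: risk_domainI simp: algebra_simps)
  qed
  from this[of K] have *: "(\<lambda>\<omega>. \<Sum>r<K. X r \<omega>) \<in> risk_domain M" "\<rho> (\<lambda>\<omega>. \<Sum>r<K. X r \<omega>) \<le> ereal (real K * R)"
    by auto
  have "\<rho> (\<lambda>\<omega>. (1 / real K) * (\<Sum>r<K. X r \<omega>)) = ereal (1 / real K) * \<rho> (\<lambda>\<omega>. \<Sum>r<K. X r \<omega>)"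
    using \<open>0 < K\<close> by (intro risk_scale *) auto
  also have "\<dots> \<le> ereal (1 / real K) * ereal (real K * R)"
    by (intro ereal_mult_left_mono *) auto
  also have "\<dots> = ereal R" using \<open>0 < K\<close> by simp
  finally show ?thesis .
qed

lemma uniform_index_domain:
  fixes c :: "'k::finite \<Rightarrow> real"
  assumes "uniform_index M J"
  shows "(\<lambda>\<omega>. c (J \<omega>)) \<in> risk_domain M"
    and "(\<And>i. a \<le> c i) \<Longrightarrow> (\<And>i. c i \<le> b) \<Longrightarrow> ereal a \<le> \<rho> (\<lambda>\<omega>. c (J \<omega>)) \<and> \<rho> (\<lambda>\<omega>. c (J \<omega>)) \<le> ereal b"
proof -
  note m = uniform_index_law(1)[OF assms, of c]
  have "Min (range c) \<le> c i" for i by (intro Min_le) auto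
  then show d: "(\<lambda>\<omega>. c (J \<omega>)) \<in> risk_domain M"
    by (intro risk_domainI[OF m, of "Min (range c)"]) auto
  show "(\<And>i. a \<le> c i) \<Longrightarrow> (\<And>i. c i \<le> b) \<Longrightarrow> ereal a \<le> \<rho> (\<lambda>\<omega>. c (J \<omega>)) \<and> \<rho> (\<lambda>\<omega>. c (J \<omega>)) \<le> ereal b"
    using risk_bounds[OF m, of a] risk_bounds(2)[OF m d, of b] by auto
qed

text \<open>Apply the quantile function of \<open>\<mu> i\<close> to the second component of a uniform pair with index \<open>i\<close>.\<close>
lemma ex_mixture_law:
  fixes \<mu> :: "'k::finite \<Rightarrow> real measure"
  assumes "\<And>i. prob_space (\<mu> i)" "\<And>i. sets (\<mu> i) = sets borel"
  obtains X where "X \<in> borel_measurable M" "mixture_law (distr M borel X) \<mu>"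
proof -
  obtain J :: "'w \<Rightarrow> 'k" and V where pair: "uniform_pair M J V"
    using rich_uniform_pair[OF rich] by blast
  note J = uniform_pairD(1)[OF pair] and [measurable] = uniform_pairD(2,3)[OF pair]
    and JV = uniform_pairD(4)[OF pair]
  have "\<exists>q. q \<in> borel_measurable borel \<and> distr unif01 borel q = \<mu> i" for i
    using real_law_quantile[OF assms(1,2), of i] by blast
  then obtain q where q[measurable]: "\<And>i. q i \<in> borel_measurable borel"
    and dq: "\<And>i. distr unif01 borel (q i) = \<mu> i" by metis
  have X[measurable]: "(\<lambda>\<omega>. q (J \<omega>) (V \<omega>)) \<in> borel_measurable M"
    by (rule measurable_compose_countable[where f = "\<lambda>i \<omega>. q i (V \<omega>)"]) measurable
  have "mixture_law (distr M borel (\<lambda>\<omega>. q (J \<omega>) (V \<omega>))) \<mu>"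
    unfolding mixture_law_def
  proof
    fix B :: "real set" assume [measurable]: "B \<in> sets borel"
    have "emeasure (distr M borel (\<lambda>\<omega>. q (J \<omega>) (V \<omega>))) B
      = (\<integral>\<^sup>+x. indicator B x \<partial>distr M borel (\<lambda>\<omega>. q (J \<omega>) (V \<omega>)))" by simp
    also have "\<dots> = (\<integral>\<^sup>+\<omega>. indicator B (q (J \<omega>) (V \<omega>)) \<partial>M)"
      by (subst nn_integral_distr) auto
    also have "\<dots> = (\<Sum>i\<in>UNIV. ennreal (1 / real CARD('k)) * (\<integral>\<^sup>+v. indicator B (q i v) \<partial>unif01))"
      by (rule JV) measurable
    also have "(\<lambda>i. \<integral>\<^sup>+v. indicator B (q i v) \<partial>unif01) = (\<lambda>i. emeasure (\<mu> i) B)"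
    proof
      fix i
      have "(\<integral>\<^sup>+v. indicator B (q i v) \<partial>unif01) = (\<integral>\<^sup>+x. indicator B x \<partial>distr unif01 borel (q i))"
        by (subst nn_integral_distr) auto
      then show "(\<integral>\<^sup>+v. indicator B (q i v) \<partial>unif01) = emeasure (\<mu> i) B"
        by (simp add: dq assms(2))
    qed
    finally show "emeasure (distr M borel (\<lambda>\<omega>. q (J \<omega>) (V \<omega>))) B
      = (\<Sum>i\<in>UNIV. ennreal (1 / real CARD('k)) * emeasure (\<mu> i) B)" .
  qed
  then show ?thesis using X that by blast
qed

text \<open>Monotonicity of the risk under conditional means. By law invariance \<open>X\<close> may be replaced by
\<open>q\<^sub>I(V)\<close> for a uniform pair \<open>(I, V)\<close>, and also by its rotations \<open>q\<^sub>I(V + r/K)\<close>. Their average has at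
most the risk of \<open>X\<close> and dominates the conditional mean up to \<open>(b - a)/K\<close>; let \<open>K\<close> tend to infinity.\<close>
lemma risk_conditional_mean_le:
  fixes \<mu> :: "'k::finite \<Rightarrow> real measure" and J :: "'w \<Rightarrow> 'k"
  assumes \<mu>: "\<And>i. prob_space (\<mu> i)" "\<And>i. sets (\<mu> i) = sets borel"
    and bnd: "\<And>i. AE x in \<mu> i. a \<le> x \<and> x \<le> b" and ab: "a \<le> b"
    and X: "X \<in> risk_domain M" and mix: "mixture_law (distr M borel X) \<mu>" and J: "uniform_index M J"
  shows "\<rho> (\<lambda>\<omega>. \<integral>x. x \<partial>\<mu> (J \<omega>)) \<le> \<rho> X"
proof -
  obtain I :: "'w \<Rightarrow> 'k" and V where pair: "uniform_pair M I V"
    using rich_uniform_pair[OF rich] by blast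
  note I = uniform_pairD(1)[OF pair] and [measurable] = uniform_pairD(2,3)[OF pair]
    and IV = uniform_pairD(4)[OF pair]
  define c where "c i = (\<integral>x. x \<partial>\<mu> i)" for i
  have "\<exists>q. q \<in> borel_measurable borel \<and> mono_on {0<..<1} q \<and> distr unif01 borel q = \<mu> i
      \<and> (\<forall>v. a \<le> q v \<and> q v \<le> b)" for i
    using bounded_law_quantile[OF \<mu> bnd ab, of i] by metis
  then obtain q where q[measurable]: "\<And>i. q i \<in> borel_measurable borel"
    and qmono: "\<And>i. mono_on {0<..<1} (q i)" and dq: "\<And>i. distr unif01 borel (q i) = \<mu> i"
    and qb: "\<And>i v. a \<le> q i v" "\<And>i v. q i v \<le> b" by metis
  have cq: "c i = (\<integral>v. q i v \<partial>unif01)" for i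
    unfolding c_def dq[symmetric] by (subst integral_distr) auto
  have rJ: "\<rho> (\<lambda>\<omega>. c (J \<omega>)) = \<rho> (\<lambda>\<omega>. c (I \<omega>))"
    by (intro risk_law uniform_index_domain I J) (simp add: uniform_index_law(2) I J)
  have cI: "(\<lambda>\<omega>. c (I \<omega>)) \<in> risk_domain M" by (rule uniform_index_domain(1)[OF I])
  have main: "\<rho> (\<lambda>\<omega>. c (I \<omega>)) \<le> \<rho> X + ereal ((b - a) / real K)" if K: "0 < K" for K :: nat
  proof -
    define Y where "Y r \<omega> = q (I \<omega>) (frac (V \<omega> + real r / real K))" for r \<omega>
    have Ym[measurable]: "Y r \<in> borel_measurable M" for r unfolding Y_def
      by (rule measurable_compose_countable[where f = "\<lambda>i \<omega>. q i (frac (V \<omega> + real r / real K))"]) measurable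
    have Yd: "Y r \<in> risk_domain M" for r by (rule risk_domainI[of _ a]) (auto simp: Y_def qb)
    have Ylaw: "mixture_law (distr M borel (Y r)) \<mu>" if "r < K" for r
      unfolding mixture_law_def
    proof
      fix B :: "real set" assume B[measurable]: "B \<in> sets borel"
      have "emeasure (distr M borel (Y r)) B = (\<integral>\<^sup>+x. indicator B x \<partial>distr M borel (Y r))" by simp
      also have "\<dots> = (\<integral>\<^sup>+\<omega>. indicator B (q (I \<omega>) (frac (V \<omega> + real r / real K))) \<partial>M)"
        by (subst nn_integral_distr) (auto simp: Y_def)
      also have "\<dots> = (\<Sum>i\<in>UNIV. ennreal (1 / real CARD('k))
          * (\<integral>\<^sup>+v. indicator B (q i (frac (v + real r / real K))) \<partial>unif01))"
        by (rule IV) measurable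
      also have "(\<lambda>i. \<integral>\<^sup>+v. indicator B (q i (frac (v + real r / real K))) \<partial>unif01) = (\<lambda>i. emeasure (\<mu> i) B)"
      proof
        fix i
        have "(\<integral>\<^sup>+v. indicator B (q i (frac (v + real r / real K))) \<partial>unif01) = (\<integral>\<^sup>+v. indicator B (q i v) \<partial>unif01)"
          using that by (intro nn_integral_unif01_frac_shift[where f = "\<lambda>v. indicator B (q i v)"]) auto
        also have "\<dots> = (\<integral>\<^sup>+x. indicator B x \<partial>distr unif01 borel (q i))"
          by (subst nn_integral_distr) auto
        finally show "(\<integral>\<^sup>+v. indicator B (q i (frac (v + real r / real K))) \<partial>unif01) = emeasure (\<mu> i) B"
          by (simp add: dq \<mu>(2))
      qed
      finally show "emeasure (distr M borel (Y r)) B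
        = (\<Sum>i\<in>UNIV. ennreal (1 / real CARD('k)) * emeasure (\<mu> i) B)" .
    qed
    have YX: "\<rho> (Y r) = \<rho> X" if "r < K" for r
      using mixture_law_unique[OF Ylaw[OF that] mix] by (intro risk_law Yd X) auto
    have "ereal a \<le> \<rho> (Y 0) \<and> \<rho> (Y 0) \<le> ereal b"
      using risk_bounds(1)[OF Ym[of 0], of a] risk_bounds(2)[OF Ym[of 0] Yd[of 0], of b] qb by (auto simp: Y_def)
    then obtain R where R: "\<rho> X = ereal R" using YX[of 0] K by (cases "\<rho> X") auto
    define avg where "avg \<omega> = (1 / real K) * (\<Sum>r<K. Y r \<omega>)" for \<omega>
    have avgR: "\<rho> avg \<le> ereal R"
      unfolding avg_def using YX R by (intro risk_average K Yd) auto
    have [measurable]: "avg \<in> borel_measurable M" unfolding avg_def by measurable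
    have avgd: "avg \<in> risk_domain M"
    proof (rule risk_domainI[of _ a])
      have "a \<le> avg \<omega>" for \<omega>
      proof -
        have "real K * a \<le> (\<Sum>r<K. Y r \<omega>)"
          using sum_mono[of "{..<K}" "\<lambda>_. a" "\<lambda>r. Y r \<omega>"] qb by (simp add: Y_def)
        then show ?thesis using K by (simp add: avg_def field_simps)
      qed
      then show "AE \<omega> in M. a \<le> avg \<omega>" by simp
    qed simp
    \<comment> \<open>the exceptional set is null for each index, and there are finitely many indices\<close>
    define bad where "bad i v \<longleftrightarrow> \<not> (c i - (b - a) / real K
        \<le> (1 / real K) * (\<Sum>r<K. q i (frac (v + real r / real K))))" for i v
    have [measurable]: "Measurable.pred borel (bad i)" for i unfolding bad_def by measurable
    have "(\<integral>\<^sup>+\<omega>. indicator {v. bad (I \<omega>) v} (V \<omega>) \<partial>M)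
      = (\<Sum>i\<in>UNIV. ennreal (1 / real CARD('k)) * (\<integral>\<^sup>+v. indicator {v. bad i v} v \<partial>unif01))"
      by (rule IV) measurable
    also have "\<dots> = 0"
    proof -
      have "(\<integral>\<^sup>+v. indicator {v. bad i v} v \<partial>unif01) = 0" for i
      proof -
        have "AE v in unif01. indicator {v. bad i v} v = (0::ennreal)"
          using mono_rotation_average[OF q qmono qb K, of i]
          by eventually_elim (simp add: bad_def cq)
        then show ?thesis by (subst nn_integral_cong_AE[of _ "\<lambda>_. 0"]) auto
      qed
      then show ?thesis by simp
    qed
    finally have "(\<integral>\<^sup>+\<omega>. indicator {v. bad (I \<omega>) v} (V \<omega>) \<partial>M) = 0" .
    moreover have "(\<lambda>\<omega>. indicator {v. bad (I \<omega>) v} (V \<omega>) :: ennreal) \<in> borel_measurable M"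
      by (rule measurable_compose_countable[where f = "\<lambda>i \<omega>. indicator {v. bad i v} (V \<omega>)"]) measurable
    ultimately have "AE \<omega> in M. indicator {v. bad (I \<omega>) v} (V \<omega>) = (0::ennreal)"
      by (subst (asm) nn_integral_0_iff_AE) auto
    then have "AE \<omega> in M. c (I \<omega>) \<le> avg \<omega> + (b - a) / real K"
      by eventually_elim (auto simp: bad_def avg_def Y_def indicator_def split: if_splits)
    then have "\<rho> (\<lambda>\<omega>. c (I \<omega>)) \<le> \<rho> (\<lambda>\<omega>. avg \<omega> + (b - a) / real K)"
      by (intro risk_mono cI risk_domain_add_const avgd)
    also have "\<dots> = \<rho> avg + ereal ((b - a) / real K)" by (rule risk_shift[OF avgd])
    also have "\<dots> \<le> \<rho> X + ereal ((b - a) / real K)" unfolding R by (intro add_mono avgR order_refl)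
    finally show ?thesis .
  qed
  have "\<rho> (\<lambda>\<omega>. c (I \<omega>)) \<le> \<rho> X"
  proof (rule LIMSEQ_le_const)
    have "(\<lambda>n. ereal ((b - a) / real (Suc n))) \<longlonglongrightarrow> ereal 0"
      by (intro tendsto_intros lim_const_over_n[THEN LIMSEQ_Suc])
    then show "(\<lambda>n. \<rho> X + ereal ((b - a) / real (Suc n))) \<longlonglongrightarrow> \<rho> X"
      using tendsto_add_ereal_general1[of 0 "\<lambda>_. \<rho> X" "\<rho> X" sequentially "\<lambda>n. ereal ((b - a) / real (Suc n))"]
      by (simp add: zero_ereal_def)
    show "\<exists>N. \<forall>n\<ge>N. \<rho> (\<lambda>\<omega>. c (I \<omega>)) \<le> \<rho> X + ereal ((b - a) / real (Suc n))"
      by (intro exI[of _ 0] allI impI main) simp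
  qed
  then show ?thesis using rJ by (simp add: c_def)
qed

end

section \<open>The risk envelope in finite dimensions\<close>

context law_invariant_risk
begin

lemma ex_uniform_index: "\<exists>J :: 'w \<Rightarrow> 'k::finite. uniform_index M J"
  using rich_uniform_pair[OF rich] uniform_pairD(1) by metis

text \<open>The choice of the uniform index does not matter, by law invariance (\<open>risk_uniform_index\<close>). The value
is finite because a function of a finite index is bounded.\<close>
definition empirical_risk :: "('k::finite \<Rightarrow> real) \<Rightarrow> real" where
  "empirical_risk c = real_of_ereal (\<rho> (\<lambda>\<omega>. c ((SOME J. uniform_index M J) \<omega>)))"

lemma risk_uniform_index:
  fixes c :: "'k::finite \<Rightarrow> real"
  assumes "uniform_index M J"
  shows "\<rho> (\<lambda>\<omega>. c (J \<omega>)) = ereal (empirical_risk c)"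
proof -
  define J' :: "'w \<Rightarrow> 'k" where "J' = (SOME J. uniform_index M J)"
  have J': "uniform_index M J'" unfolding J'_def using ex_uniform_index by (rule someI_ex)
  have "\<rho> (\<lambda>\<omega>. c (J \<omega>)) = \<rho> (\<lambda>\<omega>. c (J' \<omega>))"
    by (intro risk_law uniform_index_domain assms J') (simp add: uniform_index_law(2) assms J')
  moreover have "ereal (Min (range c)) \<le> \<rho> (\<lambda>\<omega>. c (J' \<omega>)) \<and> \<rho> (\<lambda>\<omega>. c (J' \<omega>)) \<le> ereal (Max (range c))"
    by (intro uniform_index_domain(2)[OF J']) auto
  then have "ereal (real_of_ereal (\<rho> (\<lambda>\<omega>. c (J' \<omega>)))) = \<rho> (\<lambda>\<omega>. c (J' \<omega>))"
    by (cases "\<rho> (\<lambda>\<omega>. c (J' \<omega>))") auto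
  ultimately show ?thesis by (simp add: empirical_risk_def J'_def)
qed

lemma risk_empirical:
  fixes c :: "'k::finite \<Rightarrow> real"
  assumes "X \<in> risk_domain M" "distr M borel X = empirical c"
  shows "\<rho> X = ereal (empirical_risk c)"
proof -
  obtain J :: "'w \<Rightarrow> 'k" where J: "uniform_index M J" using ex_uniform_index by blast
  have "\<rho> X = \<rho> (\<lambda>\<omega>. c (J \<omega>))"
    using assms by (intro risk_law uniform_index_domain J) (simp_all add: uniform_index_law(2) J)
  then show ?thesis by (simp add: risk_uniform_index J)
qed

lemma empirical_risk_mono:
  fixes c d :: "'k::finite \<Rightarrow> real"
  assumes "\<And>i. c i \<le> d i"
  shows "empirical_risk c \<le> empirical_risk d"
proof -
  obtain J :: "'w \<Rightarrow> 'k" where J: "uniform_index M J" using ex_uniform_index by blast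
  have "\<rho> (\<lambda>\<omega>. c (J \<omega>)) \<le> \<rho> (\<lambda>\<omega>. d (J \<omega>))"
    using assms by (intro risk_mono uniform_index_domain J) auto
  then show ?thesis by (simp add: risk_uniform_index[OF J])
qed

lemma empirical_risk_add:
  fixes c d :: "'k::finite \<Rightarrow> real"
  shows "empirical_risk (\<lambda>i. c i + d i) \<le> empirical_risk c + empirical_risk d"
proof -
  obtain J :: "'w \<Rightarrow> 'k" where J: "uniform_index M J" using ex_uniform_index by blast
  have "\<rho> (\<lambda>\<omega>. c (J \<omega>) + d (J \<omega>)) \<le> \<rho> (\<lambda>\<omega>. c (J \<omega>)) + \<rho> (\<lambda>\<omega>. d (J \<omega>))"
    by (intro risk_add uniform_index_domain J)
  then show ?thesis
    using risk_uniform_index[OF J, of "\<lambda>i. c i + d i"] by (simp add: risk_uniform_index[OF J])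
qed

lemma empirical_risk_scale:
  fixes c :: "'k::finite \<Rightarrow> real"
  assumes "0 < t"
  shows "empirical_risk (\<lambda>i. t * c i) = t * empirical_risk c"
proof -
  obtain J :: "'w \<Rightarrow> 'k" where J: "uniform_index M J" using ex_uniform_index by blast
  have "\<rho> (\<lambda>\<omega>. t * c (J \<omega>)) = ereal t * \<rho> (\<lambda>\<omega>. c (J \<omega>))"
    by (intro risk_scale uniform_index_domain J assms)
  then show ?thesis
    using risk_uniform_index[OF J, of "\<lambda>i. t * c i"] by (simp add: risk_uniform_index[OF J])
qed

lemma empirical_risk_shift:
  fixes c :: "'k::finite \<Rightarrow> real"
  shows "empirical_risk (\<lambda>i. c i + t) = empirical_risk c + t"
proof -
  obtain J :: "'w \<Rightarrow> 'k" where J: "uniform_index M J" using ex_uniform_index by blast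
  have "\<rho> (\<lambda>\<omega>. c (J \<omega>) + t) = \<rho> (\<lambda>\<omega>. c (J \<omega>)) + ereal t"
    by (intro risk_shift uniform_index_domain J)
  then show ?thesis
    using risk_uniform_index[OF J, of "\<lambda>i. c i + t"] by (simp add: risk_uniform_index[OF J])
qed

lemma empirical_risk_const: "empirical_risk (\<lambda>_ :: 'k::finite. t) = t"
proof -
  obtain J :: "'w \<Rightarrow> 'k" where J: "uniform_index M J" using ex_uniform_index by blast
  show ?thesis using risk_uniform_index[OF J, of "\<lambda>_. t"] by (simp add: risk_const)
qed

text \<open>The dual representation of \<open>empirical_risk\<close>; \<open>A_risk_eq_weights\<close> identifies this set with
\<open>A_risk M \<rho>\<close>.\<close>
definition risk_weights :: "(real ^ 'k::finite) set" where
  "risk_weights = {y. \<forall>c. (\<Sum>i\<in>UNIV. y $ i * c i) / real CARD('k) \<le> empirical_risk c}"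

lemma weightsD:
  fixes y :: "real ^ 'k::finite"
  assumes "y \<in> risk_weights"
  shows "(\<Sum>i\<in>UNIV. y $ i * c i) / real CARD('k) \<le> empirical_risk c" and "0 \<le> y $ i"
    and "(\<Sum>i\<in>UNIV. y $ i) / real CARD('k) = 1"
proof -
  show le: "(\<Sum>i\<in>UNIV. y $ i * c i) / real CARD('k) \<le> empirical_risk c" for c
    using assms by (simp add: risk_weights_def)
  \<comment> \<open>lowering one entry cannot raise the risk above that of zero\<close>
  define d where "d j = (if j = i then - 1 else 0 :: real)" for j
  have "(\<Sum>j\<in>UNIV. y $ j * d j) / real CARD('k) \<le> empirical_risk d" by (rule le)
  also have "\<dots> \<le> empirical_risk (\<lambda>_ :: 'k. 0)" by (rule empirical_risk_mono) (simp add: d_def)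
  finally show "0 \<le> y $ i"
    by (simp add: empirical_risk_const d_def if_distrib zero_le_divide_iff cong: if_cong)
  show "(\<Sum>i\<in>UNIV. y $ i) / real CARD('k) = 1"
  proof (rule antisym)
    show "(\<Sum>i\<in>UNIV. y $ i) / real CARD('k) \<le> 1"
      using le[of "\<lambda>_. 1"] by (simp only: empirical_risk_const mult_1_right)
    show "1 \<le> (\<Sum>i\<in>UNIV. y $ i) / real CARD('k)"
      using le[of "\<lambda>_. -1"] by (simp only: empirical_risk_const mult_minus_right mult_1_right sum_negf)
  qed
qed

text \<open>The risk of a random variable is at least its mean: condition on a trivial index.\<close>
lemma one_in_weights: "(\<chi> i. (1 :: real)) \<in> (risk_weights :: (real ^ 'k::finite) set)"
  unfolding risk_weights_def
proof (intro CollectI allI)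
  fix c :: "'k \<Rightarrow> real"
  obtain J :: "'w \<Rightarrow> 'k" where J: "uniform_index M J" using ex_uniform_index by blast
  define L where "L = distr M borel (\<lambda>\<omega>. c (J \<omega>))"
  note [measurable] = uniform_index_law(1)[OF J]
  have "\<rho> (\<lambda>\<omega>. \<integral>x. x \<partial>(\<lambda>_ :: unit. L) ((\<lambda>_. ()) \<omega>)) \<le> \<rho> (\<lambda>\<omega>. c (J \<omega>))"
  proof (rule risk_conditional_mean_le[where a = "Min (range c)" and b = "Max (range c)"])
    show "prob_space L" unfolding L_def by (rule prob_space_distr) measurable
    show "sets L = sets borel" by (simp add: L_def)
    show "AE x in L. Min (range c) \<le> x \<and> x \<le> Max (range c)"
      unfolding L_def by (subst AE_distr_iff) (auto intro!: AE_I2)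
    show "Min (range c) \<le> Max (range c)"
      by (rule order_trans[of _ "c undefined"]) auto
    show "(\<lambda>\<omega>. c (J \<omega>)) \<in> risk_domain M" by (rule uniform_index_domain[OF J])
    show "mixture_law (distr M borel (\<lambda>\<omega>. c (J \<omega>))) (\<lambda>_ :: unit. L)"
      by (simp add: mixture_law_def L_def)
    show "uniform_index M (\<lambda>_. ())"
      by (simp add: uniform_index_def emeasure_space_1)
  qed
  moreover have "(\<integral>x. x \<partial>L) = (\<Sum>i\<in>UNIV. c i) / real CARD('k)"
    unfolding L_def integral_uniform_index(2)[OF prob_space_axioms J, symmetric]
    by (subst integral_distr) auto
  ultimately show "(\<Sum>i\<in>UNIV. (\<chi> i. (1 :: real)) $ i * c i) / real CARD('k) \<le> empirical_risk c"
    by (simp add: risk_const risk_uniform_index[OF J])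
qed

text \<open>The defining inequality of a weight vector, extended from finitely many values to conditional laws.
Truncation at level \<open>n\<close> makes the conditional means finite; monotone convergence removes it, so that
infinite means are covered.\<close>
lemma weights_mixture_le:
  fixes y :: "real ^ 'k::finite" and \<mu> :: "'k \<Rightarrow> real measure"
  assumes y: "y \<in> risk_weights"
    and \<mu>: "\<And>i. prob_space (\<mu> i)" "\<And>i. sets (\<mu> i) = sets borel"
    and nonneg: "\<And>i. AE x in \<mu> i. 0 \<le> x"
    and X: "X \<in> risk_domain M" and mix: "mixture_law (distr M borel X) \<mu>"
  shows "enn2ereal (\<Sum>i\<in>UNIV. ennreal (y $ i / real CARD('k)) * (\<integral>\<^sup>+x. ennreal x \<partial>\<mu> i)) \<le> \<rho> X"
proof -
  obtain J :: "'w \<Rightarrow> 'k" where J: "uniform_index M J" using ex_uniform_index by blast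
  have Xm[measurable]: "X \<in> borel_measurable M" using X by (simp add: risk_domain_def)
  have y0: "0 \<le> y $ i" for i by (rule weightsD[OF y])
  have bound: "enn2ereal (\<Sum>i\<in>UNIV. ennreal (y $ i / real CARD('k)) * (\<integral>\<^sup>+x. ennreal (min x (real n)) \<partial>\<mu> i)) \<le> \<rho> X"
    for n :: nat
  proof -
    \<comment> \<open>\<open>\<nu> i\<close> is the conditional law and \<open>c i\<close> the conditional mean of the truncated variable\<close>
    define \<nu> where "\<nu> i = distr (\<mu> i) borel (\<lambda>x. min x (real n))" for i
    have sm[measurable_cong]: "sets (\<mu> i) = sets borel" for i by (rule \<mu>)
    define c where "c i = (\<integral>x. x \<partial>\<nu> i)" for i
    have cen: "ennreal (c i) = (\<integral>\<^sup>+x. ennreal (min x (real n)) \<partial>\<mu> i)" and c0: "0 \<le> c i" for i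
    proof -
      interpret \<mu>: prob_space "\<mu> i" by (rule \<mu>)
      have ci: "c i = (\<integral>x. min x (real n) \<partial>\<mu> i)"
        unfolding c_def \<nu>_def by (subst integral_distr) auto
      have "integrable (\<mu> i) (\<lambda>x. min x (real n))"
        by (rule \<mu>.integrable_const_bound[of _ "real n"]) (use nonneg[of i] in \<open>auto elim!: eventually_mono\<close>)
      then show "ennreal (c i) = (\<integral>\<^sup>+x. ennreal (min x (real n)) \<partial>\<mu> i)"
        unfolding ci using nonneg[of i]
        by (intro nn_integral_eq_integral[symmetric]) (auto elim!: eventually_mono)
      show "0 \<le> c i" unfolding ci using nonneg[of i]
        by (intro integral_nonneg_AE) (auto elim!: eventually_mono)
    qed
    have Xn: "(\<lambda>\<omega>. min (X \<omega>) (real n)) \<in> risk_domain M"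
    proof -
      obtain b where "AE \<omega> in M. b \<le> X \<omega>" using X by (auto simp: risk_domain_def)
      then have "AE \<omega> in M. min b (real n) \<le> min (X \<omega>) (real n)" by eventually_elim auto
      then show ?thesis by (intro risk_domainI) auto
    qed
    have "\<rho> (\<lambda>\<omega>. c (J \<omega>)) \<le> \<rho> (\<lambda>\<omega>. min (X \<omega>) (real n))"
      unfolding c_def
    proof (rule risk_conditional_mean_le[where a = 0 and b = "real n"])
      show "prob_space (\<nu> i)" for i
      proof -
        interpret \<mu>: prob_space "\<mu> i" by (rule \<mu>)
        show ?thesis unfolding \<nu>_def by (rule \<mu>.prob_space_distr) measurable
      qed
      show "sets (\<nu> i) = sets borel" for i by (simp add: \<nu>_def)
      show "AE x in \<nu> i. 0 \<le> x \<and> x \<le> real n" for i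
        unfolding \<nu>_def using nonneg[of i] by (subst AE_distr_iff) (auto elim!: eventually_mono)
      show "mixture_law (distr M borel (\<lambda>\<omega>. min (X \<omega>) (real n))) \<nu>"
        unfolding mixture_law_def
      proof
        fix B :: "real set" assume B[measurable]: "B \<in> sets borel"
        have pre: "(\<lambda>x. min x (real n)) -` B \<in> sets borel"
          by (rule measurable_sets_borel) measurable
        have "emeasure (distr M borel (\<lambda>\<omega>. min (X \<omega>) (real n))) B = emeasure (distr M borel X) ((\<lambda>x. min x (real n)) -` B)"
          using pre by (subst (1 2) emeasure_distr) (auto intro!: arg_cong[where f = "emeasure M"])
        also have "\<dots> = (\<Sum>i\<in>UNIV. ennreal (1 / real CARD('k)) * emeasure (\<mu> i) ((\<lambda>x. min x (real n)) -` B))"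
          using mix pre by (simp add: mixture_law_def)
        also have "(\<lambda>i. emeasure (\<mu> i) ((\<lambda>x. min x (real n)) -` B)) = (\<lambda>i. emeasure (\<nu> i) B)"
          unfolding \<nu>_def by (subst emeasure_distr) (auto simp: sets_eq_imp_space_eq[OF \<mu>(2)])
        finally show "emeasure (distr M borel (\<lambda>\<omega>. min (X \<omega>) (real n))) B
          = (\<Sum>i\<in>UNIV. ennreal (1 / real CARD('k)) * emeasure (\<nu> i) B)" .
      qed
    qed (use Xn J in auto)
    also have "\<dots> \<le> \<rho> X" by (rule risk_mono[OF X Xn]) auto
    finally have le: "ereal (empirical_risk c) \<le> \<rho> X" by (simp add: risk_uniform_index[OF J])
    have "(\<Sum>i\<in>UNIV. ennreal (y $ i / real CARD('k)) * (\<integral>\<^sup>+x. ennreal (min x (real n)) \<partial>\<mu> i))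
      = (\<Sum>i\<in>UNIV. ennreal (y $ i / real CARD('k) * c i))"
      unfolding cen[symmetric] using y0 c0 by (intro sum.cong refl ennreal_mult[symmetric]) auto
    also have "\<dots> = ennreal (\<Sum>i\<in>UNIV. y $ i / real CARD('k) * c i)"
      using y0 c0 by (intro sum_ennreal) auto
    also have "(\<Sum>i\<in>UNIV. y $ i / real CARD('k) * c i) = (\<Sum>i\<in>UNIV. y $ i * c i) / real CARD('k)"
      by (simp add: sum_divide_distrib)
    finally have "enn2ereal (\<Sum>i\<in>UNIV. ennreal (y $ i / real CARD('k)) * (\<integral>\<^sup>+x. ennreal (min x (real n)) \<partial>\<mu> i))
      = ereal ((\<Sum>i\<in>UNIV. y $ i * c i) / real CARD('k))"
      using y0 c0 by (simp add: enn2ereal_ennreal sum_nonneg)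
    also have "\<dots> \<le> ereal (empirical_risk c)" using weightsD(1)[OF y, of c] by simp
    finally show ?thesis using le by simp
  qed
  have lim: "(\<lambda>n. \<integral>\<^sup>+x. ennreal (min x (real n)) \<partial>\<mu> i) \<longlonglongrightarrow> (\<integral>\<^sup>+x. ennreal x \<partial>\<mu> i)" for i
  proof (rule nn_integral_LIMSEQ)
    show "incseq (\<lambda>n x. ennreal (min x (real n)))"
      by (auto simp: incseq_def le_fun_def intro!: ennreal_leI)
    show "(\<lambda>x. ennreal (min x (real n))) \<in> borel_measurable (\<mu> i)" for n
      by (subst measurable_cong_sets[OF \<mu>(2) refl]) measurable
    fix x :: real
    obtain n0 :: nat where "x \<le> real n0" using real_arch_simple by blast
    then have "ennreal (min x (real n)) = ennreal x" if "n0 \<le> n" for n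
      using that by (intro arg_cong[where f = ennreal]) (simp add: min_def)
    then show "(\<lambda>n. ennreal (min x (real n))) \<longlonglongrightarrow> ennreal x"
      by (intro tendsto_eventually) (auto simp: eventually_sequentially)
  qed
  have "(\<lambda>n. enn2ereal (\<Sum>i\<in>UNIV. ennreal (y $ i / real CARD('k)) * (\<integral>\<^sup>+x. ennreal (min x (real n)) \<partial>\<mu> i)))
    \<longlonglongrightarrow> enn2ereal (\<Sum>i\<in>UNIV. ennreal (y $ i / real CARD('k)) * (\<integral>\<^sup>+x. ennreal x \<partial>\<mu> i))"
    by (intro tendsto_enn2erealI tendsto_sum ennreal_tendsto_cmult lim) auto
  then show ?thesis by (rule LIMSEQ_le_const2) (use bound in auto)
qed

text \<open>A weight vector evaluated at a uniform index satisfies the inequality that defines the risk envelope.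
Adding a constant makes \<open>X\<close> nonnegative, and the constant cancels since the weights have mean one.\<close>
lemma ext_expectation_weights_le:
  fixes y :: "real ^ 'k::finite" and J :: "'w \<Rightarrow> 'k"
  assumes y: "y \<in> risk_weights" and J: "uniform_index M J" and X: "X \<in> risk_domain M"
  shows "ext_expectation M (\<lambda>\<omega>. y $ J \<omega> * X \<omega>) \<le> \<rho> X"
proof (cases "\<rho> X = \<infinity>")
  case False
  have Xm[measurable]: "X \<in> borel_measurable M" using X by (simp add: risk_domain_def)
  have Jm[measurable]: "J \<in> measurable M (count_space UNIV)" using J by (simp add: uniform_index_def)
  note [measurable] = uniform_index_law(1)[OF J]
  obtain b where "AE \<omega> in M. b \<le> X \<omega>" using X by (auto simp: risk_domain_def)
  then have W0: "AE \<omega> in M. 0 \<le> X \<omega> + \<bar>b\<bar>" by eventually_elim auto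
  define W where "W \<omega> = X \<omega> + \<bar>b\<bar>" for \<omega>
  have [measurable]: "W \<in> borel_measurable M" unfolding W_def by measurable
  have Wd: "W \<in> risk_domain M" using W0 by (intro risk_domainI) (auto simp: W_def)
  have y0: "0 \<le> y $ i" for i by (rule weightsD[OF y])
  define \<mu> where "\<mu> i = distr (uniform_measure M {\<omega>\<in>space M. J \<omega> = i}) borel W" for i
  have eJ: "emeasure M {\<omega>\<in>space M. J \<omega> = i} = ennreal (1 / real CARD('k))" for i
    using J by (simp add: uniform_index_def)
  have scale: "ennreal (1 / real CARD('k)) * (t / ennreal (1 / real CARD('k))) = t" for t
    by (subst ennreal_times_divide) (simp add: ennreal_mult_divide_eq mult.commute)
  have ps: "prob_space (uniform_measure M {\<omega>\<in>space M. J \<omega> = i})" for i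
    by (rule prob_space_uniform_measure) (simp_all add: eJ)
  have "enn2ereal (\<Sum>i\<in>UNIV. ennreal (y $ i / real CARD('k)) * (\<integral>\<^sup>+x. ennreal x \<partial>\<mu> i)) \<le> \<rho> W"
  proof (rule weights_mixture_le[OF y])
    fix i
    interpret u: prob_space "uniform_measure M {\<omega>\<in>space M. J \<omega> = i}" by (rule ps)
    show "prob_space (\<mu> i)" unfolding \<mu>_def by (rule u.prob_space_distr) measurable
    show "sets (\<mu> i) = sets borel" by (simp add: \<mu>_def)
    have "AE \<omega> in uniform_measure M {\<omega>\<in>space M. J \<omega> = i}. 0 \<le> W \<omega>"
      using W0 by (intro AE_uniform_measureI) (auto simp: W_def elim!: eventually_mono)
    then show "AE x in \<mu> i. 0 \<le> x" unfolding \<mu>_def by (subst AE_distr_iff) auto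
  next
    show "mixture_law (distr M borel W) \<mu>"
      unfolding mixture_law_def
    proof
      fix B :: "real set" assume [measurable]: "B \<in> sets borel"
      have "emeasure (distr M borel W) B = emeasure M (\<Union>i\<in>UNIV. {\<omega>\<in>space M. J \<omega> = i} \<inter> (W -` B \<inter> space M))"
        by (subst emeasure_distr) (auto intro!: arg_cong[where f = "emeasure M"])
      also have "\<dots> = (\<Sum>i\<in>UNIV. emeasure M ({\<omega>\<in>space M. J \<omega> = i} \<inter> (W -` B \<inter> space M)))"
        by (intro sum_emeasure[symmetric]) (auto simp: disjoint_family_on_def)
      also have "\<dots> = (\<Sum>i\<in>UNIV. ennreal (1 / real CARD('k)) * emeasure (\<mu> i) B)"
      proof (rule sum.cong[OF refl])
        fix i
        have "emeasure (\<mu> i) B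
          = emeasure M ({\<omega>\<in>space M. J \<omega> = i} \<inter> (W -` B \<inter> space M)) / ennreal (1 / real CARD('k))"
          unfolding \<mu>_def by (subst emeasure_distr) (auto simp: eJ)
        then show "emeasure M ({\<omega>\<in>space M. J \<omega> = i} \<inter> (W -` B \<inter> space M))
          = ennreal (1 / real CARD('k)) * emeasure (\<mu> i) B"
          by (simp only: scale)
      qed
      finally show "emeasure (distr M borel W) B = (\<Sum>i\<in>UNIV. ennreal (1 / real CARD('k)) * emeasure (\<mu> i) B)" .
    qed
  qed (rule Wd)
  moreover have "(\<Sum>i\<in>UNIV. ennreal (y $ i / real CARD('k)) * (\<integral>\<^sup>+x. ennreal x \<partial>\<mu> i))
    = (\<integral>\<^sup>+\<omega>. ennreal (y $ J \<omega> * W \<omega>) \<partial>M)"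
  proof -
    have "(\<integral>\<^sup>+\<omega>. ennreal (y $ J \<omega> * W \<omega>) \<partial>M)
      = (\<integral>\<^sup>+\<omega>. (\<Sum>i\<in>UNIV. ennreal (y $ i) * (ennreal (W \<omega>) * indicator {\<omega>\<in>space M. J \<omega> = i} \<omega>)) \<partial>M)"
    proof (rule nn_integral_cong)
      fix \<omega> assume "\<omega> \<in> space M"
      then have "(\<Sum>i\<in>UNIV. ennreal (y $ i) * (ennreal (W \<omega>) * indicator {\<omega>\<in>space M. J \<omega> = i} \<omega>))
        = (\<Sum>i\<in>UNIV. if i = J \<omega> then ennreal (y $ i) * ennreal (W \<omega>) else 0)"
        by (intro sum.cong) (auto simp: indicator_def)
      then show "ennreal (y $ J \<omega> * W \<omega>)
        = (\<Sum>i\<in>UNIV. ennreal (y $ i) * (ennreal (W \<omega>) * indicator {\<omega>\<in>space M. J \<omega> = i} \<omega>))"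
        by (simp add: ennreal_mult' y0)
    qed
    also have "\<dots> = (\<Sum>i\<in>UNIV. ennreal (y $ i) * (\<integral>\<^sup>+\<omega>. ennreal (W \<omega>) * indicator {\<omega>\<in>space M. J \<omega> = i} \<omega> \<partial>M))"
      by (simp add: nn_integral_sum nn_integral_cmult)
    also have "\<dots> = (\<Sum>i\<in>UNIV. ennreal (y $ i / real CARD('k)) * (\<integral>\<^sup>+x. ennreal x \<partial>\<mu> i))"
    proof (rule sum.cong[OF refl])
      fix i
      have "(\<integral>\<^sup>+x. ennreal x \<partial>\<mu> i)
        = (\<integral>\<^sup>+\<omega>. ennreal (W \<omega>) * indicator {\<omega>\<in>space M. J \<omega> = i} \<omega> \<partial>M) / ennreal (1 / real CARD('k))"
        unfolding \<mu>_def by (subst nn_integral_distr) (simp_all add: nn_integral_uniform_measure eJ)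
      moreover have "ennreal (y $ i / real CARD('k)) = ennreal (y $ i) * ennreal (1 / real CARD('k))"
        using y0[of i] by (simp add: ennreal_mult[symmetric])
      ultimately show "ennreal (y $ i) * (\<integral>\<^sup>+\<omega>. ennreal (W \<omega>) * indicator {\<omega>\<in>space M. J \<omega> = i} \<omega> \<partial>M)
        = ennreal (y $ i / real CARD('k)) * (\<integral>\<^sup>+x. ennreal x \<partial>\<mu> i)"
        by (simp only: mult.assoc scale)
    qed
    finally show ?thesis by simp
  qed
  moreover have "\<rho> W = \<rho> X + ereal \<bar>b\<bar>" unfolding W_def by (rule risk_shift[OF X])
  ultimately have le: "enn2ereal (\<integral>\<^sup>+\<omega>. ennreal (y $ J \<omega> * W \<omega>) \<partial>M) \<le> \<rho> X + ereal \<bar>b\<bar>" by simp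
  have "\<rho> X \<noteq> -\<infinity>" using risk_bounds(1)[OF Xm \<open>AE \<omega> in M. b \<le> X \<omega>\<close>] by auto
  then obtain R where R: "\<rho> X = ereal R" using False by (cases "\<rho> X") auto
  have nn: "AE \<omega> in M. 0 \<le> y $ J \<omega> * W \<omega>"
    using W0 by eventually_elim (simp add: W_def y0)
  have "(\<integral>\<^sup>+\<omega>. ennreal (y $ J \<omega> * W \<omega>) \<partial>M) \<noteq> \<infinity>" using le R by auto
  then have intW: "integrable M (\<lambda>\<omega>. y $ J \<omega> * W \<omega>)"
    using nn by (intro integrableI_nonneg) (auto simp: top.not_eq_extremum)
  have "enn2ereal (\<integral>\<^sup>+\<omega>. ennreal (y $ J \<omega> * W \<omega>) \<partial>M) = ereal (\<integral>\<omega>. y $ J \<omega> * W \<omega> \<partial>M)"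
    using nn_integral_eq_integral[OF intW nn] integral_nonneg_AE[OF nn] by (simp add: enn2ereal_ennreal)
  with le R have leW: "(\<integral>\<omega>. y $ J \<omega> * W \<omega> \<partial>M) \<le> R + \<bar>b\<bar>" by simp
  note inty = integral_uniform_index[OF prob_space_axioms J, of "\<lambda>i. y $ i"]
  have eq: "y $ J \<omega> * X \<omega> = y $ J \<omega> * W \<omega> - y $ J \<omega> * \<bar>b\<bar>" for \<omega>
    by (simp add: W_def algebra_simps)
  have intX: "integrable M (\<lambda>\<omega>. y $ J \<omega> * X \<omega>)"
    unfolding eq using intW inty(1) by (intro Bochner_Integration.integrable_diff integrable_mult_left)
  have "(\<integral>\<omega>. y $ J \<omega> * X \<omega> \<partial>M) = (\<integral>\<omega>. y $ J \<omega> * W \<omega> \<partial>M) - (\<integral>\<omega>. y $ J \<omega> * \<bar>b\<bar> \<partial>M)"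
    unfolding eq using intW inty(1) by (intro Bochner_Integration.integral_diff integrable_mult_left)
  also have "\<dots> = (\<integral>\<omega>. y $ J \<omega> * W \<omega> \<partial>M) - \<bar>b\<bar>"
    using inty weightsD(3)[OF y] by simp
  also have "\<dots> \<le> R" using leW by simp
  finally show ?thesis using ext_expectation_integrable[OF intX] R by simp
qed simp

lemma A_risk_eq_weights: "A_risk M \<rho> = (risk_weights :: (real ^ 'k::finite) set)"
proof (intro set_eqI iffI)
  fix y :: "real ^ 'k"
  assume y: "y \<in> risk_weights"
  obtain J :: "'w \<Rightarrow> 'k" where J: "uniform_index M J" using ex_uniform_index by blast
  have "(\<lambda>\<omega>. y $ J \<omega>) \<in> risk_envelope M \<rho>"
    using integral_uniform_index[OF prob_space_axioms J, of "\<lambda>i. y $ i"] weightsD(2,3)[OF y]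
      ext_expectation_weights_le[OF y J]
    by (auto simp: risk_envelope_def)
  moreover have "distr M borel (\<lambda>\<omega>. y $ J \<omega>) = empirical (\<lambda>i. y $ i)"
    by (rule uniform_index_law[OF J])
  ultimately show "y \<in> A_risk M \<rho>" unfolding A_risk_def by blast
next
  fix y :: "real ^ 'k"
  assume "y \<in> A_risk M \<rho>"
  then obtain Z where Z: "Z \<in> risk_envelope M \<rho>" "distr M borel Z = empirical (\<lambda>i. y $ i)"
    unfolding A_risk_def by blast
  have "Z \<in> borel_measurable M" using Z(1) by (auto simp: risk_envelope_def)
  then obtain J :: "'w \<Rightarrow> 'k" where J: "uniform_index M J" and ZJ: "AE \<omega> in M. Z \<omega> = y $ J \<omega>"
    using rich_uniform_label[OF rich _ Z(2)] by metis
  show "y \<in> risk_weights" unfolding risk_weights_def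
  proof (intro CollectI allI)
    fix c :: "'k \<Rightarrow> real"
    have "ext_expectation M (\<lambda>\<omega>. Z \<omega> * c (J \<omega>)) \<le> \<rho> (\<lambda>\<omega>. c (J \<omega>))"
      using Z(1) uniform_index_domain(1)[OF J, of c] by (auto simp: risk_envelope_def)
    moreover have "ext_expectation M (\<lambda>\<omega>. Z \<omega> * c (J \<omega>)) = ext_expectation M (\<lambda>\<omega>. y $ J \<omega> * c (J \<omega>))"
      using ZJ by (intro ext_expectation_cong_AE) (auto elim!: eventually_mono)
    moreover have "\<dots> = ereal ((\<Sum>i\<in>UNIV. y $ i * c i) / real CARD('k))"
      using integral_uniform_index[OF prob_space_axioms J, of "\<lambda>i. y $ i * c i"]
      by (simp add: ext_expectation_integrable)
    ultimately show "(\<Sum>i\<in>UNIV. y $ i * c i) / real CARD('k) \<le> empirical_risk c"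
      by (simp add: risk_uniform_index[OF J])
  qed
qed

end

section \<open>Transport plans and weak duality\<close>

lemma transport_planD:
  assumes "P \<in> transport_plans S x"
  shows "prob_space P" and "space P = S \<times> S" and "distr P borel fst = empirical x"
    and "continuous_on UNIV g \<Longrightarrow> (g :: 'b::euclidean_space \<times> 'b \<Rightarrow> 'c::topological_space) \<in> borel_measurable P"
proof -
  have sets: "sets P = sets (restrict_space borel (S \<times> S))"
    using assms by (simp add: transport_plans_def)
  show "prob_space P" "distr P borel fst = empirical x"
    using assms by (auto simp: transport_plans_def)
  show "space P = S \<times> S"
    using sets_eq_imp_space_eq[OF sets] by (simp add: space_restrict_space)
  show "g \<in> borel_measurable P" if "continuous_on UNIV g"
    by (subst measurable_cong_sets[OF sets refl])
      (intro measurable_restrict_space1 borel_measurable_continuous_onI that)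
qed

text \<open>Conditioning on the atom \<open>x i\<close>. If \<open>m\<close> indices share an atom, the atom has mass \<open>m/N\<close>, and its
conditional law appears \<open>m\<close> times with weight \<open>1/N\<close>; hence the mixture over the indices is correct even if some of the points coincide.\<close>
lemma plan_disintegration:
  fixes x :: "'k::finite \<Rightarrow> 'b::euclidean_space"
  assumes P: "P \<in> transport_plans S x"
  defines "Q \<equiv> \<lambda>i. uniform_measure P {\<omega>\<in>space P. fst \<omega> = x i}"
  shows "prob_space (Q i)" and "AE \<omega> in Q i. fst \<omega> = x i \<and> snd \<omega> \<in> S"
    and "f \<in> borel_measurable P \<Longrightarrow>
      (\<integral>\<^sup>+\<omega>. f \<omega> \<partial>P) = (\<Sum>i\<in>UNIV. ennreal (1 / real CARD('k)) * (\<integral>\<^sup>+\<omega>. f \<omega> \<partial>Q i))"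
proof -
  interpret prob_space P by (rule transport_planD[OF P])
  let ?N = "real CARD('k)"
  let ?E = "\<lambda>i. {\<omega>\<in>space P. fst \<omega> = x i}"
  let ?n = "\<lambda>i. card {j. x j = x i}"
  have fst[measurable]: "fst \<in> borel_measurable P"
    by (rule transport_planD[OF P]) (intro continuous_intros)
  have n: "0 < ?n i" for i by (auto simp: card_gt_0_iff)
  have E: "?E i \<in> sets P" for i by measurable
  have eE: "emeasure P (?E i) = ennreal (real (?n i) / ?N)" for i
  proof -
    have "emeasure P (?E i) = emeasure (distr P borel fst) {x i}"
      by (subst emeasure_distr) (auto intro: arg_cong[where f = "emeasure P"])
    then show ?thesis by (simp add: transport_planD(3)[OF P] emeasure_empirical)
  qed
  have npos: "0 < real (?n i) / ?N" for i using n[of i] by simp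
  show "prob_space (Q i)" unfolding Q_def
    using npos[of i] by (intro prob_space_uniform_measure) (auto simp: eE)
  show "AE \<omega> in Q i. fst \<omega> = x i \<and> snd \<omega> \<in> S" unfolding Q_def
  proof (rule AE_uniform_measureI[OF E AE_I2])
    fix \<omega> assume "\<omega> \<in> space P"
    then have "snd \<omega> \<in> S" unfolding transport_planD(2)[OF P] by (rule mem_Times_iff[THEN iffD1, THEN conjunct2])
    then show "\<omega> \<in> ?E i \<longrightarrow> fst \<omega> = x i \<and> snd \<omega> \<in> S" by simp
  qed
  show "(\<integral>\<^sup>+\<omega>. f \<omega> \<partial>P) = (\<Sum>i\<in>UNIV. ennreal (1 / ?N) * (\<integral>\<^sup>+\<omega>. f \<omega> \<partial>Q i))"
    if f[measurable]: "f \<in> borel_measurable P"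
  proof -
    have slice: "ennreal (1 / ?N) * (\<integral>\<^sup>+\<omega>. f \<omega> \<partial>Q i)
      = (\<integral>\<^sup>+\<omega>. f \<omega> * (ennreal (1 / real (?n i)) * indicator (?E i) \<omega>) \<partial>P)" for i
    proof -
      have "ennreal (1 / ?N) / ennreal (real (?n i) / ?N) = ennreal (1 / real (?n i))"
        using n[of i] by (subst divide_ennreal) auto
      then have "ennreal (1 / ?N) * (t / ennreal (real (?n i) / ?N)) = t * ennreal (1 / real (?n i))" for t
        by (metis ennreal_times_divide mult.commute)
      then have "ennreal (1 / ?N) * (\<integral>\<^sup>+\<omega>. f \<omega> \<partial>Q i)
        = (\<integral>\<^sup>+\<omega>. f \<omega> * indicator (?E i) \<omega> \<partial>P) * ennreal (1 / real (?n i))"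
        unfolding Q_def by (subst nn_integral_uniform_measure[OF f E]) (simp only: eE)
      also have "\<dots> = (\<integral>\<^sup>+\<omega>. f \<omega> * indicator (?E i) \<omega> * ennreal (1 / real (?n i)) \<partial>P)"
        by (rule nn_integral_multc[symmetric]) measurable
      finally show ?thesis by (simp add: mult_ac)
    qed
    have one: "AE \<omega> in P. (\<Sum>i\<in>UNIV. ennreal (1 / real (?n i)) * indicator (?E i) \<omega>) = 1"
    proof -
      have "AE y in empirical x. y \<in> range x"
        unfolding empirical_def
        by (subst AE_distr_iff) (auto simp: measurable_def sets_uniform_count_measure
          intro!: AE_I2 finite_imp_closed borel_closed)
      then have "AE \<omega> in P. fst \<omega> \<in> range x"
        unfolding transport_planD(3)[OF P, symmetric]
        by (subst (asm) AE_distr_iff) (auto intro!: finite_imp_closed borel_closed)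
      with AE_space show ?thesis
      proof eventually_elim
        case (elim \<omega>)
        then obtain k where k: "fst \<omega> = x k" by auto
        have "(\<Sum>i\<in>UNIV. ennreal (1 / real (?n i)) * indicator (?E i) \<omega>)
          = (\<Sum>i\<in>UNIV. if x i = x k then ennreal (1 / real (?n k)) else 0)"
          using elim k by (intro sum.cong) (auto simp: indicator_def)
        also have "\<dots> = of_nat (?n k) * ennreal (1 / real (?n k))"
          by (simp add: sum.If_cases Collect_conj_eq)
        also have "\<dots> = 1"
          using n[of k] by (auto simp add: ennreal_of_nat_eq_real_of_nat ennreal_mult[symmetric] del: ennreal_eq_1)
        finally show ?case .
      qed
    qed
    have "(\<Sum>i\<in>UNIV. ennreal (1 / ?N) * (\<integral>\<^sup>+\<omega>. f \<omega> \<partial>Q i))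
      = (\<integral>\<^sup>+\<omega>. (\<Sum>i\<in>UNIV. f \<omega> * (ennreal (1 / real (?n i)) * indicator (?E i) \<omega>)) \<partial>P)"
      unfolding slice by (rule nn_integral_sum[symmetric]) measurable
    also have "\<dots> = (\<integral>\<^sup>+\<omega>. f \<omega> * (\<Sum>i\<in>UNIV. ennreal (1 / real (?n i)) * indicator (?E i) \<omega>) \<partial>P)"
      by (simp only: sum_distrib_left)
    also have "\<dots> = (\<integral>\<^sup>+\<omega>. f \<omega> \<partial>P)"
      using one by (intro nn_integral_cong_AE) (auto elim!: eventually_mono)
    finally show ?thesis by simp
  qed
qed

text \<open>The inequality \<open>a \<le> s + t\<close> with positive and negative parts sorted so that nothing is subtracted.
It can be integrated without knowing that any of the integrals is finite.\<close>
lemma ennreal_signed_le: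
  assumes "(a::real) \<le> s + t" "0 \<le> t"
  shows "ennreal a + ennreal (- s) \<le> ennreal (- a) + ennreal s + ennreal t"
    and "ennreal a \<le> ennreal s + ennreal t"
proof -
  have e: "ennreal r = ennreal (max 0 r)" for r by simp
  have "max 0 a + max 0 (- s) \<le> max 0 (- a) + max 0 s + max 0 t" using assms by linarith
  then show "ennreal a + ennreal (- s) \<le> ennreal (- a) + ennreal s + ennreal t"
    unfolding e[of a] e[of "- s"] e[of "- a"] e[of s] e[of t]
    by (simp add: ennreal_plus[symmetric] del: ennreal_plus ennreal_max_0 ennreal_max_0')
  have "max 0 a \<le> max 0 s + max 0 t" using assms by linarith
  then show "ennreal a \<le> ennreal s + ennreal t"
    unfolding e[of a] e[of s] e[of t]
    by (simp add: ennreal_plus[symmetric] del: ennreal_plus ennreal_max_0 ennreal_max_0')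
qed

lemma concave_continuous:
  fixes l :: "'b::euclidean_space \<Rightarrow> real"
  assumes "concave_on UNIV l"
  shows "continuous_on UNIV l"
  using continuous_on_minus[OF convex_on_continuous[OF open_UNIV assms[unfolded concave_on_def]]] by simp

lemma continuous_cost:
  fixes nrm :: "'b::euclidean_space \<Rightarrow> real"
  assumes "is_norm nrm"
  shows "continuous_on UNIV (\<lambda>(x, y). nrm (x - y))"
  unfolding case_prod_beta
  by (intro continuous_on_compose2[OF continuous_is_norm[OF assms]] continuous_intros) auto

lemma continuous_loss:
  fixes l :: "'b::euclidean_space \<Rightarrow> real"
  assumes "concave_on UNIV l"
  shows "continuous_on UNIV (\<lambda>(x :: 'b, y). l y)"
  unfolding case_prod_beta
  by (intro continuous_on_compose2[OF concave_continuous[OF assms]] continuous_intros) auto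

context law_invariant_risk
begin

lemma risk_domain_of_law:
  assumes "X \<in> borel_measurable M" and "distr M borel X = distr P borel C" and "C \<in> borel_measurable P"
    and "\<And>\<omega>. a \<le> C \<omega>"
  shows "X \<in> risk_domain M"
proof -
  have "AE x in distr P borel C. a \<le> x" using assms(3,4) by (subst AE_distr_iff) auto
  then have "AE \<omega> in M. a \<le> X \<omega>"
    unfolding assms(2)[symmetric] using assms(1) by (subst (asm) AE_distr_iff) auto
  then show ?thesis by (rule risk_domainI[OF assms(1)])
qed

text \<open>The cost has the mixture of its conditional laws as law, so \<open>weights_mixture_le\<close> applies to any copy
of it on the reference space.\<close>
lemma plan_weighted_cost_le:
  fixes x :: "'k::finite \<Rightarrow> 'b::euclidean_space" and y :: "real ^ 'k"
  assumes P: "P \<in> transport_plans S x" and C[measurable]: "C \<in> borel_measurable P" and C0: "\<And>\<omega>. 0 \<le> C \<omega>"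
    and risk: "risk_under M \<rho> P C \<le> ereal \<epsilon>" and eps: "0 \<le> \<epsilon>" and y: "y \<in> risk_weights"
  shows "(\<Sum>i\<in>UNIV. ennreal (y $ i / real CARD('k))
      * (\<integral>\<^sup>+\<omega>. ennreal (C \<omega>) \<partial>uniform_measure P {\<omega>\<in>space P. fst \<omega> = x i})) \<le> ennreal \<epsilon>"
proof -
  define Q where "Q i = uniform_measure P {\<omega>\<in>space P. fst \<omega> = x i}" for i
  have sQ[measurable_cong]: "sets (Q i) = sets P" for i by (simp add: Q_def)
  note dis = plan_disintegration[OF P, folded Q_def]
  define \<mu> where "\<mu> i = distr (Q i) borel C" for i
  have \<mu>: "prob_space (\<mu> i)" "sets (\<mu> i) = sets borel" for i
  proof -
    show "prob_space (\<mu> i)"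
      unfolding \<mu>_def by (rule prob_space.prob_space_distr[OF dis(1)]) measurable
    show "sets (\<mu> i) = sets borel" by (simp add: \<mu>_def)
  qed
  have mix: "mixture_law (distr P borel C) \<mu>"
    unfolding mixture_law_def
  proof
    fix B :: "real set" assume [measurable]: "B \<in> sets borel"
    have "emeasure (distr P borel C) B = (\<integral>\<^sup>+z. indicator B z \<partial>distr P borel C)" by simp
    also have "\<dots> = (\<integral>\<^sup>+\<omega>. indicator B (C \<omega>) \<partial>P)"
      by (subst nn_integral_distr) auto
    also have "\<dots> = (\<Sum>i\<in>UNIV. ennreal (1 / real CARD('k)) * (\<integral>\<^sup>+\<omega>. indicator B (C \<omega>) \<partial>Q i))"
      by (rule dis(3)) measurable
    also have "(\<lambda>i. \<integral>\<^sup>+\<omega>. indicator B (C \<omega>) \<partial>Q i) = (\<lambda>i. emeasure (\<mu> i) B)"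
    proof
      fix i
      have "(\<integral>\<^sup>+\<omega>. indicator B (C \<omega>) \<partial>Q i) = (\<integral>\<^sup>+z. indicator B z \<partial>\<mu> i)"
        unfolding \<mu>_def by (subst nn_integral_distr) auto
      then show "(\<integral>\<^sup>+\<omega>. indicator B (C \<omega>) \<partial>Q i) = emeasure (\<mu> i) B" by (simp add: \<mu>)
    qed
    finally show "emeasure (distr P borel C) B = (\<Sum>i\<in>UNIV. ennreal (1 / real CARD('k)) * emeasure (\<mu> i) B)" .
  qed
  define X where "X = (SOME X. X \<in> borel_measurable M \<and> distr M borel X = distr P borel C)"
  obtain X' where "X' \<in> borel_measurable M" "mixture_law (distr M borel X') \<mu>"
    by (rule ex_mixture_law[OF \<mu>])
  then have "X' \<in> borel_measurable M \<and> distr M borel X' = distr P borel C"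
    using mixture_law_unique[OF _ mix] by simp
  then have "\<exists>X. X \<in> borel_measurable M \<and> distr M borel X = distr P borel C" by blast
  from someI_ex[OF this, folded X_def]
  have X: "X \<in> borel_measurable M" "distr M borel X = distr P borel C" by auto
  have Xd: "X \<in> risk_domain M" by (rule risk_domain_of_law[OF X C C0])
  have "enn2ereal (\<Sum>i\<in>UNIV. ennreal (y $ i / real CARD('k)) * (\<integral>\<^sup>+z. ennreal z \<partial>\<mu> i)) \<le> \<rho> X"
  proof (rule weights_mixture_le[OF y \<mu> _ Xd])
    show "AE z in \<mu> i. 0 \<le> z" for i unfolding \<mu>_def using C0 by (subst AE_distr_iff) auto
    show "mixture_law (distr M borel X) \<mu>" by (simp add: X(2) mix)
  qed
  also have "\<dots> \<le> ereal \<epsilon>" using risk by (simp add: risk_under_def X_def)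
  finally have "enn2ereal (\<Sum>i\<in>UNIV. ennreal (y $ i / real CARD('k)) * (\<integral>\<^sup>+z. ennreal z \<partial>\<mu> i)) \<le> enn2ereal (ennreal \<epsilon>)"
    using eps by (simp add: enn2ereal_ennreal)
  then have "(\<Sum>i\<in>UNIV. ennreal (y $ i / real CARD('k)) * (\<integral>\<^sup>+z. ennreal z \<partial>\<mu> i)) \<le> ennreal \<epsilon>"
    by (simp add: less_eq_ennreal.rep_eq)
  moreover have "(\<integral>\<^sup>+z. ennreal z \<partial>\<mu> i) = (\<integral>\<^sup>+\<omega>. ennreal (C \<omega>) \<partial>Q i)" for i
    unfolding \<mu>_def by (subst nn_integral_distr) auto
  ultimately show ?thesis by (simp add: Q_def)
qed

lemma weak_duality:
  fixes x :: "'k::finite \<Rightarrow> 'b::euclidean_space" and p s :: "real ^ 'k"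
  assumes P: "P \<in> transport_plans S x" and nrm: "is_norm nrm" and l: "concave_on UNIV l"
    and risk: "risk_under M \<rho> P (\<lambda>(x, y). nrm (x - y)) \<le> ereal \<epsilon>" and eps: "0 \<le> \<epsilon>"
    and conj: "\<And>i. conjugate (\<lambda>x. - l x) (z i - \<nu> i) + support_fun S (\<nu> i) - ereal (z i \<bullet> x i) \<le> ereal (s $ i)"
    and dual: "\<And>i. dual_norm nrm (z i) \<le> p $ i"
    and lam: "(1 / real CARD('k)) * (\<Sum>i\<in>UNIV. p $ i) = lam" and ratio: "ratio_in p lam risk_weights"
  shows "ext_expectation P (\<lambda>(x, y). l y) \<le> ereal (lam * \<epsilon> + (1 / real CARD('k)) * (\<Sum>i\<in>UNIV. s $ i))"
proof -
  let ?N = "real CARD('k)"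
  define C where "C = (\<lambda>(x, y). nrm (x - y))"
  define L where "L = (\<lambda>(x :: 'b, y). l y)"
  define Q where "Q i = uniform_measure P {\<omega>\<in>space P. fst \<omega> = x i}" for i
  have sQ[measurable_cong]: "sets (Q i) = sets P" for i by (simp add: Q_def)
  note dis = plan_disintegration[OF P, folded Q_def]
  have [measurable]: "C \<in> borel_measurable P" unfolding C_def by (rule transport_planD(4)[OF P continuous_cost[OF nrm]])
  have [measurable]: "L \<in> borel_measurable P" unfolding L_def by (rule transport_planD(4)[OF P continuous_loss[OF l]])
  have C0: "0 \<le> C \<omega>" for \<omega> by (simp add: C_def case_prod_beta is_norm_simps(1)[OF nrm])
  have p0: "0 \<le> p $ i" for i using dual[of i] dual_norm_nonneg[OF nrm, of "z i"] by linarith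
  have lam0: "0 \<le> lam" using p0 by (simp add: lam[symmetric] sum_nonneg)
  have cost: "(\<Sum>i\<in>UNIV. ennreal (p $ i / ?N) * (\<integral>\<^sup>+\<omega>. ennreal (C \<omega>) \<partial>Q i)) \<le> ennreal (lam * \<epsilon>)"
  proof (cases "lam = 0")
    case True
    then show ?thesis using ratio by (simp add: ratio_in_def)
  next
    case False
    then have y: "p /\<^sub>R lam \<in> risk_weights" using ratio by (simp add: ratio_in_def)
    have "(\<Sum>i\<in>UNIV. ennreal (p $ i / ?N) * (\<integral>\<^sup>+\<omega>. ennreal (C \<omega>) \<partial>Q i))
      = ennreal lam * (\<Sum>i\<in>UNIV. ennreal ((p /\<^sub>R lam) $ i / ?N) * (\<integral>\<^sup>+\<omega>. ennreal (C \<omega>) \<partial>Q i))"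
      unfolding sum_distrib_left
    proof (rule sum.cong[OF refl])
      fix i
      have "ennreal (p $ i / ?N) = ennreal lam * ennreal ((p /\<^sub>R lam) $ i / ?N)"
        using lam0 p0[of i] False by (subst ennreal_mult[symmetric]) auto
      then show "ennreal (p $ i / ?N) * (\<integral>\<^sup>+\<omega>. ennreal (C \<omega>) \<partial>Q i)
        = ennreal lam * (ennreal ((p /\<^sub>R lam) $ i / ?N) * (\<integral>\<^sup>+\<omega>. ennreal (C \<omega>) \<partial>Q i))"
        by (simp only: mult.assoc)
    qed
    also have "\<dots> \<le> ennreal lam * ennreal \<epsilon>"
    proof -
      have "risk_under M \<rho> P C \<le> ereal \<epsilon>" using risk by (simp add: C_def)
      then show ?thesis unfolding Q_def
        by (intro mult_left_mono plan_weighted_cost_le[OF P _ C0 _ eps y]) auto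
    qed
    also have "\<dots> = ennreal (lam * \<epsilon>)" using lam0 eps by (simp add: ennreal_mult)
    finally show ?thesis .
  qed
  have bound: "AE \<omega> in Q i. L \<omega> \<le> s $ i + p $ i * C \<omega>" for i
    using dis(2)[of i]
  proof eventually_elim
    case (elim \<omega>)
    have "l (snd \<omega>) \<le> s $ i + z i \<bullet> (x i - snd \<omega>)"
      using dual_feasible_majorant[OF conj] elim by blast
    also have "z i \<bullet> (x i - snd \<omega>) \<le> dual_norm nrm (z i) * nrm (x i - snd \<omega>)"
      by (rule inner_le_dual_norm[OF nrm])
    also have "\<dots> \<le> p $ i * nrm (x i - snd \<omega>)"
      by (intro mult_right_mono dual is_norm_simps(1)[OF nrm])
    finally show ?case using elim by (simp add: L_def C_def case_prod_beta)
  qed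
  define a where "a = (\<integral>\<^sup>+\<omega>. ennreal (L \<omega>) \<partial>P)"
  define b where "b = (\<integral>\<^sup>+\<omega>. ennreal (- L \<omega>) \<partial>P)"
  define sp where "sp = (\<Sum>i\<in>UNIV. max 0 (s $ i)) / ?N"
  define sn where "sn = (\<Sum>i\<in>UNIV. max 0 (- s $ i)) / ?N"
  have sp0: "0 \<le> sp" "0 \<le> sn" by (auto simp: sp_def sn_def sum_nonneg)
  have spn: "sp - sn = (1 / ?N) * (\<Sum>i\<in>UNIV. s $ i)"
    unfolding sp_def sn_def diff_divide_distrib[symmetric] sum_subtractf[symmetric]
    by (simp add: max_def if_distrib[of "\<lambda>u. _ - u"]) (intro sum.cong, auto)
  have sum_e: "(\<Sum>i\<in>UNIV. ennreal (1 / ?N) * ennreal (g i)) = ennreal ((\<Sum>i\<in>UNIV. max 0 (g i)) / ?N)"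
    for g :: "'k \<Rightarrow> real"
  proof -
    have "(\<Sum>i\<in>UNIV. ennreal (1 / ?N) * ennreal (g i)) = (\<Sum>i\<in>UNIV. ennreal (max 0 (g i) / ?N))"
    proof (rule sum.cong[OF refl])
      fix i
      have "ennreal (max 0 (g i) / ?N) = ennreal (1 / ?N) * ennreal (max 0 (g i))"
        by (subst ennreal_mult[symmetric]) auto
      then show "ennreal (1 / ?N) * ennreal (g i) = ennreal (max 0 (g i) / ?N)" by simp
    qed
    also have "\<dots> = ennreal (\<Sum>i\<in>UNIV. max 0 (g i) / ?N)" by (rule sum_ennreal) auto
    finally show ?thesis by (simp add: sum_divide_distrib)
  qed
  have prob1: "emeasure (Q i) (space (Q i)) = 1" for i by (rule prob_space.emeasure_space_1[OF dis(1)])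
  have costi: "(\<integral>\<^sup>+\<omega>. ennreal (p $ i * C \<omega>) \<partial>Q i) = ennreal (p $ i) * (\<integral>\<^sup>+\<omega>. ennreal (C \<omega>) \<partial>Q i)" for i
    using p0 by (simp add: ennreal_mult' nn_integral_cmult)
  have cost': "(\<Sum>i\<in>UNIV. ennreal (1 / ?N) * (\<integral>\<^sup>+\<omega>. ennreal (p $ i * C \<omega>) \<partial>Q i)) \<le> ennreal (lam * \<epsilon>)"
  proof -
    have "ennreal (1 / ?N) * ennreal (p $ i) = ennreal (p $ i / ?N)" for i
      using p0[of i] by (subst ennreal_mult[symmetric]) auto
    then show ?thesis using cost unfolding costi by (simp only: mult.assoc[symmetric])
  qed
  have A: "a + ennreal sn \<le> b + ennreal sp + ennreal (lam * \<epsilon>)"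
  proof -
    have "a + ennreal sn = (\<Sum>i\<in>UNIV. ennreal (1 / ?N) * ((\<integral>\<^sup>+\<omega>. ennreal (L \<omega>) \<partial>Q i) + ennreal (- s $ i)))"
      unfolding a_def sn_def sum_e[symmetric] by (subst dis(3)) (simp_all add: sum.distrib distrib_left)
    also have "\<dots> \<le> (\<Sum>i\<in>UNIV. ennreal (1 / ?N) * ((\<integral>\<^sup>+\<omega>. ennreal (- L \<omega>) \<partial>Q i) + ennreal (s $ i)
        + (\<integral>\<^sup>+\<omega>. ennreal (p $ i * C \<omega>) \<partial>Q i)))"
    proof (intro sum_mono mult_left_mono)
      fix i
      have "(\<integral>\<^sup>+\<omega>. ennreal (L \<omega>) \<partial>Q i) + ennreal (- s $ i) = (\<integral>\<^sup>+\<omega>. ennreal (L \<omega>) + ennreal (- s $ i) \<partial>Q i)"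
        by (subst nn_integral_add) (simp_all add: prob1)
      also have "\<dots> \<le> (\<integral>\<^sup>+\<omega>. ennreal (- L \<omega>) + ennreal (s $ i) + ennreal (p $ i * C \<omega>) \<partial>Q i)"
        using bound[of i] by (intro nn_integral_mono_AE) (auto elim!: eventually_mono intro!: ennreal_signed_le mult_nonneg_nonneg p0 C0)
      also have "\<dots> = (\<integral>\<^sup>+\<omega>. ennreal (- L \<omega>) \<partial>Q i) + ennreal (s $ i) + (\<integral>\<^sup>+\<omega>. ennreal (p $ i * C \<omega>) \<partial>Q i)"
        by (subst nn_integral_add, simp, simp, subst nn_integral_add) (simp_all add: prob1)
      finally show "(\<integral>\<^sup>+\<omega>. ennreal (L \<omega>) \<partial>Q i) + ennreal (- s $ i)
        \<le> (\<integral>\<^sup>+\<omega>. ennreal (- L \<omega>) \<partial>Q i) + ennreal (s $ i) + (\<integral>\<^sup>+\<omega>. ennreal (p $ i * C \<omega>) \<partial>Q i)" .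
    qed simp
    also have "\<dots> = b + ennreal sp + (\<Sum>i\<in>UNIV. ennreal (1 / ?N) * (\<integral>\<^sup>+\<omega>. ennreal (p $ i * C \<omega>) \<partial>Q i))"
      unfolding b_def sp_def sum_e[symmetric] by (subst dis(3)) (simp_all add: sum.distrib distrib_left)
    also have "\<dots> \<le> b + ennreal sp + ennreal (lam * \<epsilon>)" by (intro add_mono order_refl cost')
    finally show ?thesis .
  qed
  have "a \<le> ennreal sp + ennreal (lam * \<epsilon>)"
  proof -
    have "a = (\<Sum>i\<in>UNIV. ennreal (1 / ?N) * (\<integral>\<^sup>+\<omega>. ennreal (L \<omega>) \<partial>Q i))"
      unfolding a_def by (rule dis(3)) simp
    also have "\<dots> \<le> (\<Sum>i\<in>UNIV. ennreal (1 / ?N) * (ennreal (s $ i) + (\<integral>\<^sup>+\<omega>. ennreal (p $ i * C \<omega>) \<partial>Q i)))"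
    proof (intro sum_mono mult_left_mono)
      fix i
      have "(\<integral>\<^sup>+\<omega>. ennreal (L \<omega>) \<partial>Q i) \<le> (\<integral>\<^sup>+\<omega>. ennreal (s $ i) + ennreal (p $ i * C \<omega>) \<partial>Q i)"
        using bound[of i] by (intro nn_integral_mono_AE) (auto elim!: eventually_mono intro!: ennreal_signed_le mult_nonneg_nonneg p0 C0)
      also have "\<dots> = ennreal (s $ i) + (\<integral>\<^sup>+\<omega>. ennreal (p $ i * C \<omega>) \<partial>Q i)"
        by (subst nn_integral_add) (simp_all add: prob1)
      finally show "(\<integral>\<^sup>+\<omega>. ennreal (L \<omega>) \<partial>Q i) \<le> ennreal (s $ i) + (\<integral>\<^sup>+\<omega>. ennreal (p $ i * C \<omega>) \<partial>Q i)" .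
    qed simp
    also have "\<dots> = ennreal sp + (\<Sum>i\<in>UNIV. ennreal (1 / ?N) * (\<integral>\<^sup>+\<omega>. ennreal (p $ i * C \<omega>) \<partial>Q i))"
      unfolding sp_def sum_e[symmetric] by (simp add: sum.distrib distrib_left)
    also have "\<dots> \<le> ennreal sp + ennreal (lam * \<epsilon>)" by (intro add_mono order_refl cost')
    finally show ?thesis .
  qed
  then have "a < top" by (simp add: le_less_trans)
  then obtain a' where a': "a = ennreal a'" "0 \<le> a'" by (cases a) auto
  have ext: "ext_expectation P L = enn2ereal a - enn2ereal b" by (simp add: ext_expectation_def a_def b_def)
  show ?thesis
  proof (cases b)
    case top
    then show ?thesis using ext a' by (simp add: L_def enn2ereal_ennreal)
  next
    case (real b')
    have le0: "0 \<le> lam * \<epsilon>" using lam0 eps by simp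
    have "ennreal (a' + sn) \<le> ennreal (b' + sp + lam * \<epsilon>)"
      using A real a' sp0 le0 by (simp add: ennreal_plus)
    then have "a' + sn \<le> b' + sp + lam * \<epsilon>"
      using real a' sp0 le0 by (subst (asm) ennreal_le_iff) auto
    then show ?thesis using ext a' real spn by (simp add: L_def enn2ereal_ennreal)
  qed
qed

end

section \<open>Strong duality\<close>

text \<open>The supremum of a sum of functions of separate variables is the sum of the suprema.\<close>
lemma separable_sup_bound:
  fixes f :: "'k::finite \<Rightarrow> 'b \<Rightarrow> real" and a :: "'k \<Rightarrow> 'b"
  assumes a: "\<And>i. a i \<in> S" and le: "\<forall>\<xi>. (\<forall>i. \<xi> i \<in> S) \<longrightarrow> (\<Sum>i\<in>UNIV. f i (\<xi> i)) \<le> c"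
  obtains s where "\<forall>i. \<forall>\<eta>\<in>S. f i \<eta> \<le> s i" and "(\<Sum>i\<in>UNIV. s i) \<le> c"
proof -
  have bdd: "bdd_above (f i ` S)" for i
  proof (rule bdd_aboveI2)
    fix \<eta> assume "\<eta> \<in> S"
    then have "(\<Sum>j\<in>UNIV. f j ((a(i := \<eta>)) j)) \<le> c" using a by (intro le[rule_format]) auto
    moreover have "(\<Sum>j\<in>UNIV. f j ((a(i := \<eta>)) j)) = f i \<eta> + (\<Sum>j\<in>UNIV - {i}. f j (a j))"
      by (subst sum.remove[of UNIV i]) auto
    ultimately show "f i \<eta> \<le> c - (\<Sum>j\<in>UNIV - {i}. f j (a j))" by linarith
  qed
  define s where "s i = (SUP \<eta>\<in>S. f i \<eta>)" for i
  have up: "f i \<eta> \<le> s i" if "\<eta> \<in> S" for i \<eta>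
    unfolding s_def by (rule cSUP_upper[OF that bdd])
  have "(\<Sum>i\<in>UNIV. s i) \<le> c"
  proof (rule field_le_epsilon)
    fix e :: real assume e: "0 < e"
    have "\<exists>\<eta>\<in>S. s i - e / real CARD('k) < f i \<eta>" for i
    proof -
      have "s i - e / real CARD('k) < s i" using e by simp
      then show ?thesis unfolding s_def
        using less_cSUP_iff[OF _ bdd[of i]] a by (metis empty_iff)
    qed
    then obtain \<xi> where \<xi>: "\<And>i. \<xi> i \<in> S" "\<And>i. s i - e / real CARD('k) < f i (\<xi> i)" by metis
    have "(\<Sum>i\<in>UNIV. s i) - e = (\<Sum>i\<in>UNIV. s i - e / real CARD('k))" by (simp add: sum_subtractf)
    also have "\<dots> \<le> (\<Sum>i\<in>UNIV. f i (\<xi> i))" by (intro sum_mono less_imp_le \<xi>)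
    also have "\<dots> \<le> c" by (rule le[rule_format, OF \<xi>(1)])
    finally show "(\<Sum>i\<in>UNIV. s i) \<le> c + e" by simp
  qed
  then show ?thesis using up that by blast
qed

context law_invariant_risk
begin

lemma deterministic_plan:
  fixes x \<xi> :: "'k::finite \<Rightarrow> 'b::euclidean_space"
  assumes x: "\<And>i. x i \<in> S" and \<xi>: "\<And>i. \<xi> i \<in> S" and nrm: "is_norm nrm" and l: "concave_on UNIV l"
  obtains P where "P \<in> transport_plans S x"
    and "risk_under M \<rho> P (\<lambda>(x, y). nrm (x - y)) = ereal (empirical_risk (\<lambda>i. nrm (x i - \<xi> i)))"
    and "ext_expectation P (\<lambda>(x, y). l y) = ereal ((\<Sum>i\<in>UNIV. l (\<xi> i)) / real CARD('k))"
proof -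
  let ?U = "uniform_count_measure (UNIV :: 'k set)"
  let ?R = "restrict_space borel (S \<times> S) :: ('b \<times> 'b) measure"
  define P where "P = distr ?U ?R (\<lambda>i. (x i, \<xi> i))"
  have g: "(\<lambda>i. (x i, \<xi> i)) \<in> measurable ?U ?R"
    using x \<xi> by (auto simp: measurable_def sets_uniform_count_measure space_restrict_space)
  have R: "h \<in> borel_measurable ?R" if "continuous_on UNIV h" for h :: "'b \<times> 'b \<Rightarrow> 'c::topological_space"
    using that by (intro measurable_restrict_space1 borel_measurable_continuous_onI)
  have comp: "distr P borel h = empirical (\<lambda>i. h (x i, \<xi> i))" if "continuous_on UNIV h"
    for h :: "'b \<times> 'b \<Rightarrow> 'c::topological_space"
    unfolding P_def empirical_def by (subst distr_distr[OF R[OF that] g]) (simp add: comp_def)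
  have "prob_space P" unfolding P_def
    by (intro prob_space.prob_space_distr prob_space_uniform_count_measure g) auto
  moreover have "distr P borel fst = empirical x"
    using comp[OF continuous_on_fst[OF continuous_on_id]] by simp
  ultimately have plan: "P \<in> transport_plans S x"
    by (simp add: transport_plans_def P_def)
  define C where "C = (\<lambda>(x :: 'b, y). nrm (x - y))"
  have Ccont: "continuous_on UNIV C" unfolding C_def by (rule continuous_cost[OF nrm])
  have C0: "0 \<le> C \<omega>" for \<omega> by (simp add: C_def case_prod_beta is_norm_simps(1)[OF nrm])
  obtain J :: "'w \<Rightarrow> 'k" where J: "uniform_index M J" using ex_uniform_index by blast
  define X where "X = (SOME X. X \<in> borel_measurable M \<and> distr M borel X = distr P borel C)"
  have "(\<lambda>\<omega>. C (x (J \<omega>), \<xi> (J \<omega>))) \<in> borel_measurable M \<and>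
      distr M borel (\<lambda>\<omega>. C (x (J \<omega>), \<xi> (J \<omega>))) = distr P borel C"
    using uniform_index_law[OF J, of "\<lambda>i. C (x i, \<xi> i)"] comp[OF Ccont] by simp
  then have "\<exists>X. X \<in> borel_measurable M \<and> distr M borel X = distr P borel C" by blast
  from someI_ex[OF this, folded X_def]
  have X: "X \<in> borel_measurable M" "distr M borel X = distr P borel C" by auto
  have "X \<in> risk_domain M"
    by (rule risk_domain_of_law[OF X transport_planD(4)[OF plan Ccont] C0])
  then have "\<rho> X = ereal (empirical_risk (\<lambda>i. C (x i, \<xi> i)))"
    using X comp[OF Ccont] by (intro risk_empirical) auto
  then have risk: "risk_under M \<rho> P C = ereal (empirical_risk (\<lambda>i. C (x i, \<xi> i)))"
    by (simp add: risk_under_def X_def)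
  define L where "L = (\<lambda>(x :: 'b, y). l y)"
  have L: "L \<in> borel_measurable ?R" unfolding L_def by (rule R[OF continuous_loss[OF l]])
  have "integrable ?U (\<lambda>i. L (x i, \<xi> i))"
    unfolding uniform_count_measure_def by (rule integrable_point_measure_finite) simp
  then have "integrable P L" unfolding P_def by (subst integrable_distr_eq[OF g L])
  moreover have "(\<integral>\<omega>. L \<omega> \<partial>P) = (\<Sum>i\<in>UNIV. L (x i, \<xi> i)) / real CARD('k)"
    unfolding P_def by (subst integral_distr[OF g L]) (simp add: integral_uniform_count_measure)
  ultimately have "ext_expectation P L = ereal ((\<Sum>i\<in>UNIV. L (x i, \<xi> i)) / real CARD('k))"
    by (simp add: ext_expectation_integrable)
  with plan risk that show ?thesis by (simp add: C_def L_def)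
qed

text \<open>Separate the pairs (cost vector, mean loss) that can be attained or are worse than an attained pair
from the pairs whose cost vector is affordable and whose mean loss exceeds \<open>v\<close>. The component
of the normal along the mean loss is positive because zero cost is attained while all costs equal to \<open>\<epsilon> > 0\<close> are affordable. Affordable
cost vectors with \<open>empirical_risk d = 0\<close> form a cone, on which the normal \<open>q\<close> must be nonpositive;
shifting an arbitrary \<open>c\<close> into this cone by a constant gives \<open>q \<bullet> c \<le> \<lambda> \<phi>(c)\<close> with \<open>\<lambda>\<close> the sum of the
entries of \<open>q\<close>.\<close>
lemma lagrange_multipliers:
  fixes x :: "'k::finite \<Rightarrow> 'b::euclidean_space"
  assumes S: "convex S" and x: "\<And>i. x i \<in> S" and nrm: "is_norm nrm" and l: "concave_on UNIV l"
    and eps: "0 < \<epsilon>"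
    and v: "\<forall>\<xi>. (\<forall>i. \<xi> i \<in> S) \<longrightarrow> empirical_risk (\<lambda>i. nrm (x i - \<xi> i)) \<le> \<epsilon> \<longrightarrow>
      (\<Sum>i\<in>UNIV. l (\<xi> i)) / real CARD('k) \<le> v"
  obtains p :: "real ^ 'k" and lam where "\<And>i. 0 \<le> p $ i"
    and "(1 / real CARD('k)) * (\<Sum>i\<in>UNIV. p $ i) = lam" and "ratio_in p lam risk_weights"
    and "\<forall>\<xi>. (\<forall>i. \<xi> i \<in> S) \<longrightarrow>
      (\<Sum>i\<in>UNIV. l (\<xi> i) - p $ i * nrm (x i - \<xi> i)) \<le> real CARD('k) * (v - lam * \<epsilon>)"
proof -
  let ?N = "real CARD('k)"
  define G where "G \<xi> = (\<Sum>i\<in>UNIV. l (\<xi> i)) / ?N" for \<xi> :: "'k \<Rightarrow> 'b"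
  define A where "A = {(c :: real ^ 'k, t). \<exists>\<xi>. (\<forall>i. \<xi> i \<in> S \<and> nrm (x i - \<xi> i) \<le> c $ i) \<and> t \<le> G \<xi>}"
  define B where "B = {(c :: real ^ 'k, t). empirical_risk (\<lambda>i. c $ i) \<le> \<epsilon> \<and> v < t}"
  have "convex A"
  proof (rule convexI)
    fix P Q :: "(real ^ 'k) \<times> real" and a b :: real
    assume *: "P \<in> A" "Q \<in> A" "0 \<le> a" "0 \<le> b" "a + b = 1"
    obtain c t d r where PQ: "P = (c, t)" "Q = (d, r)" by (cases P, cases Q) auto
    obtain \<xi> where \<xi>: "\<And>i. \<xi> i \<in> S" "\<And>i. nrm (x i - \<xi> i) \<le> c $ i" "t \<le> G \<xi>"
      using * PQ by (auto simp: A_def)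
    obtain \<eta> where \<eta>: "\<And>i. \<eta> i \<in> S" "\<And>i. nrm (x i - \<eta> i) \<le> d $ i" "r \<le> G \<eta>"
      using * PQ by (auto simp: A_def)
    define \<zeta> where "\<zeta> i = a *\<^sub>R \<xi> i + b *\<^sub>R \<eta> i" for i
    have "\<zeta> i \<in> S" for i unfolding \<zeta>_def using S \<xi>(1) \<eta>(1) * by (intro convexD) auto
    moreover have "nrm (x i - \<zeta> i) \<le> (a *\<^sub>R c + b *\<^sub>R d) $ i" for i
    proof -
      have "nrm (x i - \<zeta> i) \<le> a * nrm (x i - \<xi> i) + b * nrm (x i - \<eta> i)"
        unfolding \<zeta>_def using convex_on_is_norm[OF nrm, of "x i"] * by (simp add: convex_on_def)
      also have "\<dots> \<le> a * c $ i + b * d $ i" using * \<xi>(2) \<eta>(2) by (intro add_mono mult_left_mono) auto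
      finally show ?thesis by simp
    qed
    moreover have "a * t + b * r \<le> G \<zeta>"
    proof -
      have "a * t + b * r \<le> a * G \<xi> + b * G \<eta>" using * \<xi>(3) \<eta>(3) by (intro add_mono mult_left_mono) auto
      also have "\<dots> = (\<Sum>i\<in>UNIV. a * l (\<xi> i) + b * l (\<eta> i)) / ?N"
        by (simp add: G_def sum.distrib sum_distrib_left add_divide_distrib)
      also have "\<dots> \<le> G \<zeta>" unfolding G_def \<zeta>_def
        using l * by (intro divide_right_mono sum_mono) (auto simp: concave_on_iff)
      finally show ?thesis .
    qed
    ultimately show "a *\<^sub>R P + b *\<^sub>R Q \<in> A" by (auto simp: A_def PQ)
  qed
  moreover have "convex B"
  proof (rule convexI)
    fix P Q :: "(real ^ 'k) \<times> real" and a b :: real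
    assume *: "P \<in> B" "Q \<in> B" "0 \<le> a" "0 \<le> b" "a + b = 1"
    show "a *\<^sub>R P + b *\<^sub>R Q \<in> B"
    proof (cases "a = 0 \<or> b = 0")
      case True then show ?thesis using * by auto
    next
      case False
      then have ab: "0 < a" "0 < b" using * by auto
      obtain c t d r where PQ: "P = (c, t)" "Q = (d, r)" by (cases P, cases Q) auto
      have cd: "empirical_risk (\<lambda>i. c $ i) \<le> \<epsilon>" "v < t" "empirical_risk (\<lambda>i. d $ i) \<le> \<epsilon>" "v < r"
        using * PQ by (auto simp: B_def)
      have "empirical_risk (\<lambda>i. a * c $ i + b * d $ i) \<le> empirical_risk (\<lambda>i. a * c $ i) + empirical_risk (\<lambda>i. b * d $ i)"
        by (rule empirical_risk_add)
      also have "\<dots> \<le> a * \<epsilon> + b * \<epsilon>"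
        using ab cd by (simp add: empirical_risk_scale add_mono)
      also have "\<dots> = \<epsilon>" using * by (simp flip: distrib_right)
      also have "(\<lambda>i. a * c $ i + b * d $ i) = (\<lambda>i. (a *\<^sub>R c + b *\<^sub>R d) $ i)" by auto
      finally have "empirical_risk (\<lambda>i. (a *\<^sub>R c + b *\<^sub>R d) $ i) \<le> \<epsilon>" .
      moreover have "a * v + b * v < a * t + b * r" using ab cd by (intro add_strict_mono) auto
      then have "v < a * t + b * r" using * by (simp flip: distrib_right)
      ultimately show ?thesis
        by (simp add: B_def PQ del: vector_add_component vector_scaleR_component)
    qed
  qed
  moreover have A0: "(c, t) \<in> A" if "\<And>i. 0 \<le> c $ i" "t \<le> G x" for c t
    using that x by (auto simp: A_def is_norm_simps(2)[OF nrm] intro!: exI[of _ x])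
  have "A \<noteq> {}" using A0[of 0 "G x"] by auto
  moreover have Bconst: "((\<chi> i. \<epsilon>), v + 1) \<in> B"
  proof -
    have "($) (\<chi> i. \<epsilon>) = (\<lambda>_ :: 'k. \<epsilon>)" by (rule ext) simp
    then show ?thesis by (simp add: B_def empirical_risk_const)
  qed
  then have "B \<noteq> {}" by blast
  moreover have "A \<inter> B = {}"
  proof (rule ccontr)
    assume "A \<inter> B \<noteq> {}"
    then obtain c t \<xi> where *: "\<And>i. \<xi> i \<in> S" "\<And>i. nrm (x i - \<xi> i) \<le> c $ i" "t \<le> G \<xi>"
      "empirical_risk (\<lambda>i. c $ i) \<le> \<epsilon>" "v < t" by (auto simp: A_def B_def)
    have "empirical_risk (\<lambda>i. nrm (x i - \<xi> i)) \<le> empirical_risk (\<lambda>i. c $ i)" by (rule empirical_risk_mono[OF *(2)])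
    then have "G \<xi> \<le> v" unfolding G_def using *(1,4) v by auto
    then show False using * by simp
  qed
  ultimately obtain n \<beta> where n: "n \<noteq> 0" "\<forall>P\<in>A. n \<bullet> P \<le> \<beta>" "\<forall>P\<in>B. \<beta> \<le> n \<bullet> P"
    using separating_hyperplane_sets[of A B] by metis
  obtain w' \<alpha> where n': "n = (w', \<alpha>)" by (cases n)
  \<comment> \<open>the sign is chosen so that \<open>w\<close> becomes a vector of prices of the costs\<close>
  define w where "w = - w'"
  have sepA: "\<alpha> * t - w \<bullet> c \<le> \<beta>" if "(c, t) \<in> A" for c t
    using n(2) that by (force simp: n' w_def)
  have sepB: "\<beta> \<le> \<alpha> * t - w \<bullet> c" if "(c, t) \<in> B" for c t
    using n(3) that by (force simp: n' w_def)
  have w0: "0 \<le> w $ i" for i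
  proof (rule ccontr)
    assume "\<not> 0 \<le> w $ i"
    then have neg: "w $ i < 0" by simp
    \<comment> \<open>costs may be increased without leaving \<open>A\<close>, so a negative price would be unbounded profit\<close>
    define k where "k = (\<bar>\<beta> - \<alpha> * G x\<bar> + 1) / (- w $ i)"
    have k: "0 \<le> k" "k * w $ i = - (\<bar>\<beta> - \<alpha> * G x\<bar> + 1)"
      using neg by (auto simp: k_def divide_nonneg_neg)
    have "\<alpha> * G x - w \<bullet> (k *\<^sub>R axis i 1) \<le> \<beta>"
      using k by (intro sepA A0) (auto simp: axis_def)
    then have "\<alpha> * G x - k * w $ i \<le> \<beta>" by (simp add: inner_axis)
    then show False unfolding k(2) by linarith
  qed
  have "0 \<le> \<alpha>"
  proof (rule ccontr)
    assume "\<not> 0 \<le> \<alpha>"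
    then have neg: "\<alpha> < 0" by simp
    \<comment> \<open>losses may be decreased without leaving \<open>A\<close>\<close>
    define t where "t = min (G x) ((\<beta> + 1) / \<alpha>)"
    have "\<alpha> * ((\<beta> + 1) / \<alpha>) \<le> \<alpha> * t" using neg by (intro mult_left_mono_neg) (auto simp: t_def)
    then have "\<beta> + 1 \<le> \<alpha> * t" using neg by simp
    moreover have "\<alpha> * t - w \<bullet> 0 \<le> \<beta>" by (intro sepA A0) (auto simp: t_def)
    ultimately show False by simp
  qed
  moreover have "\<alpha> \<noteq> 0"
  proof
    assume 0: "\<alpha> = 0"
    have "0 \<le> \<beta>" using sepA[OF A0[of 0 "G x"]] 0 by simp
    then have "w \<bullet> (\<chi> i. \<epsilon>) \<le> 0" using sepB[OF Bconst] 0 by simp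
    then have "\<epsilon> * (\<Sum>i\<in>UNIV. w $ i) \<le> 0"
      by (simp add: inner_vec_def sum_distrib_left mult.commute)
    then have "(\<Sum>i\<in>UNIV. w $ i) \<le> 0" using eps by (simp add: mult_le_0_iff)
    then have "(\<Sum>i\<in>UNIV. w $ i) = 0" using w0 by (intro antisym sum_nonneg) auto
    then have "w = 0" using w0 by (simp add: sum_nonneg_eq_0_iff vec_eq_iff)
    then show False using n(1) 0 by (simp add: n' w_def zero_prod_def)
  qed
  ultimately have \<alpha>: "0 < \<alpha>" by simp
  define q where "q i = w $ i / \<alpha>" for i
  define lam where "lam = (\<Sum>i\<in>UNIV. q i)"
  have q0: "0 \<le> q i" for i using w0 \<alpha> by (simp add: q_def)
  have wq: "w \<bullet> c = \<alpha> * (\<Sum>i\<in>UNIV. q i * c $ i)" for c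
    using \<alpha> by (simp add: q_def inner_vec_def sum_distrib_left)
  have qB: "\<beta> / \<alpha> \<le> v - (\<Sum>i\<in>UNIV. q i * c i)" if "empirical_risk c \<le> \<epsilon>" for c
  proof (rule dense_ge)
    fix t assume t: "v - (\<Sum>i\<in>UNIV. q i * c i) < t"
    have "($) (\<chi> i. c i) = c" by (rule ext) simp
    then have "((\<chi> i. c i), t + (\<Sum>i\<in>UNIV. q i * c i)) \<in> B" using that t by (simp add: B_def)
    from sepB[OF this] have "\<beta> \<le> \<alpha> * t" by (simp add: wq algebra_simps)
    then show "\<beta> / \<alpha> \<le> t" using \<alpha> by (simp add: pos_divide_le_eq mult.commute)
  qed
  have dom: "(\<Sum>i\<in>UNIV. q i * c i) \<le> lam * empirical_risk c" for c
  proof -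
    \<comment> \<open>shift \<open>c\<close> to risk zero; all positive multiples of \<open>d\<close> are then affordable\<close>
    define d where "d i = c i + - empirical_risk c" for i
    have d0: "empirical_risk d = 0" unfolding d_def by (subst empirical_risk_shift) simp
    have "(\<Sum>i\<in>UNIV. q i * d i) \<le> 0"
    proof (rule ccontr)
      assume "\<not> (\<Sum>i\<in>UNIV. q i * d i) \<le> 0"
      then have pos: "0 < (\<Sum>i\<in>UNIV. q i * d i)" by simp
      define k where "k = (\<bar>v - \<beta> / \<alpha>\<bar> + 1) / (\<Sum>i\<in>UNIV. q i * d i)"
      have k: "0 < k" "k * (\<Sum>i\<in>UNIV. q i * d i) = \<bar>v - \<beta> / \<alpha>\<bar> + 1"
        using pos by (auto simp: k_def add_nonneg_pos)
      have "\<beta> / \<alpha> \<le> v - (\<Sum>i\<in>UNIV. q i * (k * d i))"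
        using eps by (intro qB) (simp add: empirical_risk_scale k d0)
      moreover have "(\<Sum>i\<in>UNIV. q i * (k * d i)) = k * (\<Sum>i\<in>UNIV. q i * d i)"
        by (simp add: sum_distrib_left mult_ac)
      ultimately show False using k by linarith
    qed
    moreover have "(\<Sum>i\<in>UNIV. q i * d i) = (\<Sum>i\<in>UNIV. q i * c i) - lam * empirical_risk c"
      by (simp add: d_def lam_def right_diff_distrib sum_subtractf sum_distrib_right)
    ultimately show ?thesis by simp
  qed
  have leps: "\<beta> / \<alpha> \<le> v - lam * \<epsilon>"
    using qB[of "\<lambda>_. \<epsilon>"] by (simp add: empirical_risk_const lam_def sum_distrib_right)
  \<comment> \<open>the factor \<open>N\<close> turns prices \<open>q\<close> into values of a density on the indices\<close>
  define p where "p = (\<chi> i. ?N * q i)"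
  show ?thesis
  proof
    show "0 \<le> p $ i" for i using q0 by (simp add: p_def)
    show "(1 / ?N) * (\<Sum>i\<in>UNIV. p $ i) = lam"
      by (simp add: p_def lam_def sum_distrib_left[symmetric])
    show "ratio_in p lam risk_weights"
    proof (cases "lam = 0")
      case True
      then have "q i = 0" for i using q0 by (simp add: lam_def sum_nonneg_eq_0_iff)
      then show ?thesis using True by (simp add: ratio_in_def p_def vec_eq_iff)
    next
      case False
      then have pos: "0 < lam" using q0 by (simp add: lam_def less_le sum_nonneg)
      have "(\<Sum>i\<in>UNIV. (p /\<^sub>R lam) $ i * c i) / ?N \<le> empirical_risk c" for c
      proof -
        have "(\<Sum>i\<in>UNIV. (p /\<^sub>R lam) $ i * c i) / ?N = (\<Sum>i\<in>UNIV. q i * c i) / lam"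
          by (simp add: p_def sum_divide_distrib field_simps)
        then show ?thesis using dom[of c] pos by (simp add: pos_divide_le_eq mult.commute)
      qed
      then show ?thesis using False by (simp add: ratio_in_def risk_weights_def)
    qed
    show "\<forall>\<xi>. (\<forall>i. \<xi> i \<in> S) \<longrightarrow>
      (\<Sum>i\<in>UNIV. l (\<xi> i) - p $ i * nrm (x i - \<xi> i)) \<le> ?N * (v - lam * \<epsilon>)"
    proof (intro allI impI)
      fix \<xi> :: "'k \<Rightarrow> 'b" assume \<xi>: "\<forall>i. \<xi> i \<in> S"
      have "((\<chi> i. nrm (x i - \<xi> i)), G \<xi>) \<in> A" using \<xi> by (auto simp: A_def)
      from sepA[OF this] have "\<alpha> * (G \<xi> - (\<Sum>i\<in>UNIV. q i * nrm (x i - \<xi> i))) \<le> \<beta>"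
        by (simp add: wq algebra_simps)
      then have "G \<xi> - (\<Sum>i\<in>UNIV. q i * nrm (x i - \<xi> i)) \<le> \<beta> / \<alpha>"
        using \<alpha> by (simp add: pos_le_divide_eq mult.commute)
      then have "?N * (G \<xi> - (\<Sum>i\<in>UNIV. q i * nrm (x i - \<xi> i))) \<le> ?N * (v - lam * \<epsilon>)"
        using leps by (intro mult_left_mono) auto
      moreover have "?N * (G \<xi> - (\<Sum>i\<in>UNIV. q i * nrm (x i - \<xi> i)))
        = (\<Sum>i\<in>UNIV. l (\<xi> i) - p $ i * nrm (x i - \<xi> i))"
        by (simp add: G_def p_def right_diff_distrib sum_subtractf mult.assoc flip: sum_distrib_left)
      ultimately show "(\<Sum>i\<in>UNIV. l (\<xi> i) - p $ i * nrm (x i - \<xi> i)) \<le> ?N * (v - lam * \<epsilon>)"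
        by simp
    qed
  qed
qed

text \<open>For radius zero the multiplier \<open>\<lambda>\<close> costs nothing and can be chosen as large as the slopes of \<open>l\<close> at the
points \<open>x i\<close>. The supergradients come from the sandwich theorem on a single point.\<close>
lemma zero_radius_multipliers:
  fixes x :: "'k::finite \<Rightarrow> 'b::euclidean_space"
  assumes nrm: "is_norm nrm" and l: "concave_on UNIV l" and ne: "S \<noteq> {}"
  obtains lam and p :: "real ^ 'k" and z \<nu> where
    "\<And>i. conjugate (\<lambda>x. - l x) (z i - \<nu> i) + support_fun S (\<nu> i) - ereal (z i \<bullet> x i) \<le> ereal (l (x i))"
    and "\<And>i. dual_norm nrm (z i) \<le> p $ i" and "(1 / real CARD('k)) * (\<Sum>i\<in>UNIV. p $ i) = lam"
    and "ratio_in p lam risk_weights"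
proof -
  have "\<exists>g. \<forall>y. l y \<le> l (x i) + g \<bullet> (y - x i)" for i
  proof -
    obtain a b where ab: "\<And>y. l y \<le> a \<bullet> y + b" "\<And>y. y \<in> {x i} \<Longrightarrow> a \<bullet> y + b \<le> l y"
      by (rule affine_sandwich[OF l, of "{x i}" l]) (auto simp: convex_on_def simp flip: distrib_right scaleR_add_left)
    have "l y \<le> l (x i) + a \<bullet> (y - x i)" for y
      using ab(1)[of y] ab(1)[of "x i"] ab(2)[of "x i"] by (simp add: inner_diff_right)
    then show ?thesis by blast
  qed
  then obtain g where g: "\<And>i y. l y \<le> l (x i) + g i \<bullet> (y - x i)" by metis
  define lam where "lam = Max (insert 1 (range (\<lambda>i. dual_norm nrm (- g i))))"
  have lam: "1 \<le> lam" "dual_norm nrm (- g i) \<le> lam" for i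
    unfolding lam_def by (intro Max_ge; simp)+
  define p :: "real ^ 'k" where "p = (\<chi> i. lam)"
  show ?thesis
  proof (rule that[of "\<lambda>i. - g i" "\<lambda>_. 0" p lam])
    fix i
    have "conjugate (\<lambda>x. - l x) (- g i - 0) \<le> ereal (l (x i) - g i \<bullet> x i)"
      unfolding conjugate_def
    proof (rule SUP_least)
      fix y show "ereal ((- g i - 0) \<bullet> y - - l y) \<le> ereal (l (x i) - g i \<bullet> x i)"
        using g[of y i] by (simp add: inner_diff_right)
    qed
    moreover have "support_fun S 0 \<le> ereal 0"
      unfolding support_fun_def by (rule SUP_least) simp
    ultimately have "conjugate (\<lambda>x. - l x) (- g i - 0) + support_fun S 0 - ereal (- g i \<bullet> x i)
      \<le> ereal (l (x i) - g i \<bullet> x i) + ereal 0 - ereal (- g i \<bullet> x i)"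
      by (intro ereal_minus_mono add_mono) auto
    then show "conjugate (\<lambda>x. - l x) (- g i - 0) + support_fun S 0 - ereal (- g i \<bullet> x i) \<le> ereal (l (x i))"
      by simp
    show "dual_norm nrm (- g i) \<le> p $ i" using lam by (simp add: p_def)
  next
    show "(1 / real CARD('k)) * (\<Sum>i\<in>UNIV. p $ i) = lam" by (simp add: p_def)
    have "p /\<^sub>R lam = (\<chi> i. (1 :: real))" using lam(1) by (simp add: vec_eq_iff p_def)
    then show "ratio_in p lam risk_weights"
      using lam(1) one_in_weights by (simp add: ratio_in_def)
  qed
qed

lemma strong_duality:
  fixes x :: "'k::finite \<Rightarrow> 'b::euclidean_space"
  assumes S: "convex S" and x: "\<And>i. x i \<in> S" and nrm: "is_norm nrm" and l: "concave_on UNIV l"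
    and eps: "0 \<le> \<epsilon>"
    and v: "\<forall>\<xi>. (\<forall>i. \<xi> i \<in> S) \<longrightarrow> empirical_risk (\<lambda>i. nrm (x i - \<xi> i)) \<le> \<epsilon> \<longrightarrow>
      (\<Sum>i\<in>UNIV. l (\<xi> i)) / real CARD('k) \<le> v"
  obtains lam and p s :: "real ^ 'k" and z \<nu> where
    "\<And>i. conjugate (\<lambda>x. - l x) (z i - \<nu> i) + support_fun S (\<nu> i) - ereal (z i \<bullet> x i) \<le> ereal (s $ i)"
    and "\<And>i. dual_norm nrm (z i) \<le> p $ i" and "(1 / real CARD('k)) * (\<Sum>i\<in>UNIV. p $ i) = lam"
    and "ratio_in p lam risk_weights" and "lam * \<epsilon> + (1 / real CARD('k)) * (\<Sum>i\<in>UNIV. s $ i) \<le> v"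
proof (cases "\<epsilon> = 0")
  case True
  have ne: "S \<noteq> {}" using x by auto
  obtain lam and p :: "real ^ 'k" and z \<nu> where *:
    "\<And>i. conjugate (\<lambda>x. - l x) (z i - \<nu> i) + support_fun S (\<nu> i) - ereal (z i \<bullet> x i) \<le> ereal (l (x i))"
    "\<And>i. dual_norm nrm (z i) \<le> p $ i" "(1 / real CARD('k)) * (\<Sum>i\<in>UNIV. p $ i) = lam"
    "ratio_in p lam risk_weights"
    by (rule zero_radius_multipliers[OF nrm l ne, of x]) (rule that)
  have "(\<Sum>i\<in>UNIV. l (x i)) / real CARD('k) \<le> v"
    using x eps by (intro v[rule_format]) (auto simp: is_norm_simps(2)[OF nrm] empirical_risk_const)
  then show ?thesis using * True by (intro that[of z \<nu> "\<chi> i. l (x i)" p lam]) auto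
next
  case False
  then have "0 < \<epsilon>" using eps by simp
  then obtain p :: "real ^ 'k" and lam where p: "\<And>i. 0 \<le> p $ i"
    "(1 / real CARD('k)) * (\<Sum>i\<in>UNIV. p $ i) = lam" "ratio_in p lam risk_weights"
    "\<forall>\<xi>. (\<forall>i. \<xi> i \<in> S) \<longrightarrow>
      (\<Sum>i\<in>UNIV. l (\<xi> i) - p $ i * nrm (x i - \<xi> i)) \<le> real CARD('k) * (v - lam * \<epsilon>)"
    by (rule lagrange_multipliers[of S x nrm l \<epsilon> v, OF S x nrm l _ v]) (rule that)
  obtain s where s: "\<forall>i. \<forall>\<eta>\<in>S. l \<eta> - p $ i * nrm (x i - \<eta>) \<le> s i"
    "(\<Sum>i\<in>UNIV. s i) \<le> real CARD('k) * (v - lam * \<epsilon>)"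
    by (rule separable_sup_bound[of x S "\<lambda>i \<eta>. l \<eta> - p $ i * nrm (x i - \<eta>)", OF x p(4)]) (rule that)
  have "\<exists>z \<nu>. dual_norm nrm z \<le> p $ i \<and>
    conjugate (\<lambda>x. - l x) (z - \<nu>) + support_fun S \<nu> - ereal (z \<bullet> x i) \<le> ereal (s i)" for i
  proof -
    have "S \<noteq> {}" using x by auto
    from fenchel_multipliers[OF nrm l S this p(1)[of i] s(1)[rule_format]] show ?thesis by blast
  qed
  then obtain z \<nu> where "\<And>i. dual_norm nrm (z i) \<le> p $ i"
    "\<And>i. conjugate (\<lambda>x. - l x) (z i - \<nu> i) + support_fun S (\<nu> i) - ereal (z i \<bullet> x i) \<le> ereal (s i)"
    by metis
  moreover have "lam * \<epsilon> + (1 / real CARD('k)) * (\<Sum>i\<in>UNIV. s i) \<le> v"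
    using s(2) by (simp add: field_simps)
  ultimately show ?thesis using p by (intro that[of z \<nu> "\<chi> i. s i" p lam]) auto
qed

end

theorem corollary1:
  fixes M :: "'w measure" and \<rho> :: "('w \<Rightarrow> real) \<Rightarrow> ereal"
    and \<Xi> :: "(real ^ 'm) set" and xhat :: "'k::finite \<Rightarrow> real ^ 'm"
    and nrm l :: "real ^ 'm \<Rightarrow> real" and \<epsilon> :: real
  assumes "rich_prob_space M"
    and "coherent_risk_measure M \<rho>" and "law_invariant M \<rho>"
    and "convex \<Xi>" and "\<And>i. xhat i \<in> \<Xi>" and "0 \<le> \<epsilon>"
    and "is_norm nrm" and "concave_on UNIV l"
  shows "(SUP P \<in> {P \<in> transport_plans \<Xi> xhat.
                      risk_under M \<rho> P (\<lambda>(x, y). nrm (x - y)) \<le> ereal \<epsilon>}.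
            ext_expectation P (\<lambda>(x, y). l y))
       = Inf {ereal (lam * \<epsilon> + (1 / real CARD('k)) * (\<Sum>i\<in>UNIV. s $ i)) |
              (lam :: real) (p :: real ^ 'k) (s :: real ^ 'k)
              (z :: 'k \<Rightarrow> real ^ 'm) (\<nu> :: 'k \<Rightarrow> real ^ 'm).
                (\<forall>i. conjugate (\<lambda>x. - l x) (z i - \<nu> i) + support_fun \<Xi> (\<nu> i)
                       - ereal (z i \<bullet> xhat i) \<le> ereal (s $ i)) \<and>
                (\<forall>i. dual_norm nrm (z i) \<le> p $ i) \<and>
                (1 / real CARD('k)) * (\<Sum>i\<in>UNIV. p $ i) = lam \<and>
                ratio_in p lam (A_risk M \<rho>)}"
    (is "?primal = Inf ?D")
proof -
  interpret law_invariant_risk M \<rho> by unfold_locales fact+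
  let ?F = "{P \<in> transport_plans \<Xi> xhat. risk_under M \<rho> P (\<lambda>(x, y). nrm (x - y)) \<le> ereal \<epsilon>}"
  let ?E = "\<lambda>P. ext_expectation P (\<lambda>(x, y). l y)"
  have "?primal \<le> Inf ?D"
  proof (intro SUP_least Inf_greatest)
    fix P d assume P: "P \<in> ?F" and "d \<in> ?D"
    then obtain lam and p s :: "real ^ 'k" and z \<nu> where d: "d = ereal (lam * \<epsilon> + (1 / real CARD('k)) * (\<Sum>i\<in>UNIV. s $ i))"
      and feas: "\<And>i. conjugate (\<lambda>x. - l x) (z i - \<nu> i) + support_fun \<Xi> (\<nu> i)
                       - ereal (z i \<bullet> xhat i) \<le> ereal (s $ i)"
        "\<And>i. dual_norm nrm (z i) \<le> p $ i"
        "(1 / real CARD('k)) * (\<Sum>i\<in>UNIV. p $ i) = lam" "ratio_in p lam risk_weights"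
      unfolding A_risk_eq_weights by blast
    show "?E P \<le> d"
      unfolding d using P by (intro weak_duality[OF _ assms(7,8) _ assms(6) feas]) auto
  qed
  moreover have "Inf ?D \<le> ?primal"
  proof (cases ?primal)
    case (real v)
    have v: "\<forall>\<xi>. (\<forall>i. \<xi> i \<in> \<Xi>) \<longrightarrow> empirical_risk (\<lambda>i. nrm (xhat i - \<xi> i)) \<le> \<epsilon> \<longrightarrow>
      (\<Sum>i\<in>UNIV. l (\<xi> i)) / real CARD('k) \<le> v"
    proof (intro allI impI)
      fix \<xi> assume \<xi>: "\<forall>i. \<xi> i \<in> \<Xi>" and e: "empirical_risk (\<lambda>i. nrm (xhat i - \<xi> i)) \<le> \<epsilon>"
      obtain P where P: "P \<in> transport_plans \<Xi> xhat"
        "risk_under M \<rho> P (\<lambda>(x, y). nrm (x - y)) = ereal (empirical_risk (\<lambda>i. nrm (xhat i - \<xi> i)))"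
        "?E P = ereal ((\<Sum>i\<in>UNIV. l (\<xi> i)) / real CARD('k))"
        by (rule deterministic_plan[OF assms(5) \<xi>[rule_format] assms(7,8)])
      have "?E P \<le> ?primal" using P e by (intro SUP_upper) auto
      then show "(\<Sum>i\<in>UNIV. l (\<xi> i)) / real CARD('k) \<le> v" by (simp add: P(3) real)
    qed
    obtain lam and p s :: "real ^ 'k" and z \<nu> where *:
      "\<And>i. conjugate (\<lambda>x. - l x) (z i - \<nu> i) + support_fun \<Xi> (\<nu> i) - ereal (z i \<bullet> xhat i) \<le> ereal (s $ i)"
      "\<And>i. dual_norm nrm (z i) \<le> p $ i" "(1 / real CARD('k)) * (\<Sum>i\<in>UNIV. p $ i) = lam"
      "ratio_in p lam risk_weights" "lam * \<epsilon> + (1 / real CARD('k)) * (\<Sum>i\<in>UNIV. s $ i) \<le> v"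
      by (rule strong_duality[of \<Xi> xhat nrm l \<epsilon> v, OF assms(4,5,7,8,6) v]) (rule that)
    have "ereal (lam * \<epsilon> + (1 / real CARD('k)) * (\<Sum>i\<in>UNIV. s $ i)) \<in> ?D"
      unfolding A_risk_eq_weights using *(1-4) by blast
    then have "Inf ?D \<le> ereal (lam * \<epsilon> + (1 / real CARD('k)) * (\<Sum>i\<in>UNIV. s $ i))" by (rule Inf_lower)
    also have "\<dots> \<le> ?primal" using *(5) by (simp add: real)
    finally show ?thesis .
  next
    case MInf
    obtain P where P: "P \<in> transport_plans \<Xi> xhat"
      "risk_under M \<rho> P (\<lambda>(x, y). nrm (x - y)) = ereal (empirical_risk (\<lambda>i. nrm (xhat i - xhat i)))"
      "?E P = ereal ((\<Sum>i\<in>UNIV. l (xhat i)) / real CARD('k))"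
      by (rule deterministic_plan[OF assms(5,5,7,8)])
    have "?E P \<le> ?primal"
      using P assms(6) by (intro SUP_upper) (auto simp: is_norm_simps(2)[OF assms(7)] empirical_risk_const)
    then show ?thesis by (simp add: P(3) MInf)
  qed simp
  ultimately show ?thesis by (rule antisym)
qed

end
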